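(* Let $\Bbbk$ be a field, $R=\Bbbk[x_1,\dots,x_n]$, $m\ge1$ an integer, and $\mathfrak f\in R$ a nonzero form of degree $e$ with $\mathfrak f\notin(x_1^m,\dots,x_n^m)$. Put $s=n(m-1)-e$ and $I=(x_1^m,\dots,x_n^m):\mathfrak f$. The following are equivalent: (i) $I$ is a codimension $n$ Gorenstein ideal generated by forms of a single degree and having a linear resolution (i.e., for some $d$, a minimal graded free resolution $0\to R(-2d-n+2)\to R(-d-n+2)^{b_{n-1}}\to\cdots\to R(-d-1)^{b_2}\to R(-d)^{b_1}\to R$); (ii) $s$ is even and $\mathrm{rank}\,\mathcal M_{e,s/2,m}=\binom{s/2+n-1}{n-1}$; (iii) $s$ is even and $P_{\mathfrak f}$ lies in the Zariski open set $\mathbb P^{\binom{e+n-1}{n-1}-1}\setminus V(I_k(\mathcal{MG}_{e,s/2,m}))$, where $k=\binom{s/2+n-1}{n-1}$. Moreover, in this case $I$ is generated in degree $s/2+1$.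
   Context: $\mathcal M_{e,e',m}$: for $\mathfrak f=\sum_{|\alpha|=e}a_\alpha\mathbf x^\alpha$, the matrix with rows indexed by $\gamma\in\mathbb N^n$, $|\gamma|=e+e'$, all $\gamma_i\le m-1$, columns indexed by $\beta\in\mathbb N^n$, $|\beta|=e'$, and $(\gamma,\beta)$ entry $a_{\gamma-\beta}$ if $\gamma-\beta\in\mathbb N^n$, $0$ otherwise. $P_{\mathfrak f}=(a_\alpha)_{|\alpha|=e}\in\mathbb P^{\binom{e+n-1}{n-1}-1}$ is the coefficient point of $\mathfrak f$, with homogeneous coordinates $Y_\alpha$, $|\alpha|=e$. $\mathcal{MG}_{e,e',m}$ is the matrix obtained from $\mathcal M_{e,e',m}$ by replacing each $a_\alpha$ by $Y_\alpha$, and $I_k(\cdot)$ is its ideal of $k\times k$ minors.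
   Formalization: The formal theorem assumes n ≥ 2. For n = 1 the statement fails: with m = 3 and f = 1, s = 2 and I = (x^3), so (ii) and (iii) hold, but I is not generated in degree s/2+1 = 2. *)

theory Defs
  imports "HOL-Library.Poly_Mapping" "HOL-Library.Cardinality" "HOL-Combinatorics.Permutations"
begin

text \<open>Polynomial ring k[x_i : i in 'n] with 'n a finite type (n = CARD('n)):
  monomials are exponent vectors 'n =>0 nat, polynomials are finitely supported
  coefficient functions on monomials (convolution product).\<close>

type_synonym ('n, 'k) mpoly = "('n \<Rightarrow>\<^sub>0 nat) \<Rightarrow>\<^sub>0 'k"

definition mdeg :: "('v \<Rightarrow>\<^sub>0 nat) \<Rightarrow> nat" where
  "mdeg \<alpha> = (\<Sum>i\<in>Poly_Mapping.keys \<alpha>. Poly_Mapping.lookup \<alpha> i)"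

definition Xvar :: "'v \<Rightarrow> ('v \<Rightarrow>\<^sub>0 nat) \<Rightarrow>\<^sub>0 'k::comm_semiring_1" where
  "Xvar i = Poly_Mapping.single (Poly_Mapping.single i 1) 1"

text \<open>homogeneous of degree d (the zero polynomial is homogeneous of every degree)\<close>
definition homog :: "nat \<Rightarrow> (('v \<Rightarrow>\<^sub>0 nat) \<Rightarrow>\<^sub>0 'k::zero) \<Rightarrow> bool" where
  "homog d p \<longleftrightarrow> (\<forall>\<alpha>\<in>Poly_Mapping.keys p. mdeg \<alpha> = d)"

definition ideal_gen :: "'a::comm_ring_1 set \<Rightarrow> 'a set" where
  "ideal_gen G = {p. \<exists>F c. finite F \<and> F \<subseteq> G \<and> p = (\<Sum>g\<in>F. c g * g)}"

definition powers_ideal :: "nat \<Rightarrow> ('n::finite, 'k::field) mpoly set" where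
  "powers_ideal m = ideal_gen {Xvar i ^ m | i. True}"

definition colon_ideal :: "'a::comm_ring_1 set \<Rightarrow> 'a \<Rightarrow> 'a set" where
  "colon_ideal J f = {g. g * f \<in> J}"

text \<open>Free modules R^b are represented by vectors nat => R supported on {..<b};
  a map R^c -> R^r is given by an r x c matrix A (A j k, j < r, k < c).\<close>
definition fvecs :: "nat \<Rightarrow> (nat \<Rightarrow> 'a::zero) set" where
  "fvecs b = {v. \<forall>k\<ge>b. v k = 0}"

definition matvec :: "(nat \<Rightarrow> nat \<Rightarrow> 'a::comm_ring_1) \<Rightarrow> nat \<Rightarrow> nat \<Rightarrow> (nat \<Rightarrow> 'a) \<Rightarrow> (nat \<Rightarrow> 'a)" where
  "matvec A r c v = (\<lambda>j. if j < r then (\<Sum>k<c. A j k * v k) else 0)"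

text \<open>Twists of the resolution: F_0 = R, F_1 = R(-d)^{b_1}, F_i = R(-d-i+1)^{b_i} (2 <= i <= n-1),
  F_n = R(-2d-n+2).\<close>
definition res_shift :: "nat \<Rightarrow> nat \<Rightarrow> nat \<Rightarrow> nat" where
  "res_shift n d i = (if i = 0 then 0 else if i = n then 2*d + n - 2 else d + i - 1)"

text \<open>Condition (i): I has a graded free resolution of R/I of the shape
  0 -> R(-2d-n+2) -> R(-d-n+2)^{b_{n-1}} -> ... -> R(-d-1)^{b_2} -> R(-d)^{b_1} -> R.
  The differential D i : F_i -> F_{i-1} is a b_{i-1} x b_i matrix whose entries are forms
  of degree res_shift i - res_shift (i-1) (degree preserving maps); these degrees are
  positive, so the resolution is automatically minimal.\<close>
definition linear_gorenstein_resolution :: "('n::finite, 'k::field) mpoly set \<Rightarrow> nat \<Rightarrow> bool" where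
  "linear_gorenstein_resolution I d \<longleftrightarrow>
    (let n = CARD('n) in
     \<exists>(b :: nat \<Rightarrow> nat) (D :: nat \<Rightarrow> nat \<Rightarrow> nat \<Rightarrow> ('n, 'k) mpoly).
       b 0 = 1 \<and> b n = 1 \<and>
       (\<forall>i\<in>{1..n}. \<forall>j<b (i-1). \<forall>k<b i.
          homog (res_shift n d i - res_shift n d (i-1)) (D i j k)) \<and>
       (\<lambda>v. matvec (D 1) 1 (b 1) v 0) ` fvecs (b 1) = I \<and>
       (\<forall>i\<in>{1..<n}. {v\<in>fvecs (b i). matvec (D i) (b (i-1)) (b i) v = (\<lambda>_. 0)}
                     = matvec (D (i+1)) (b i) (b (i+1)) ` fvecs (b (i+1))) \<and>
       (\<forall>v\<in>fvecs (b n). matvec (D n) (b (n-1)) (b n) v = (\<lambda>_. 0) \<longrightarrow> v = (\<lambda>_. 0)))"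

definition Mrows :: "nat \<Rightarrow> nat \<Rightarrow> nat \<Rightarrow> ('n::finite \<Rightarrow>\<^sub>0 nat) set" where
  "Mrows e e' m = {\<gamma>. mdeg \<gamma> = e + e' \<and> (\<forall>i. Poly_Mapping.lookup \<gamma> i \<le> m - 1)}"

definition Mcols :: "nat \<Rightarrow> ('n::finite \<Rightarrow>\<^sub>0 nat) set" where
  "Mcols e' = {\<beta>. mdeg \<beta> = e'}"

definition Mentry :: "(('n \<Rightarrow>\<^sub>0 nat) \<Rightarrow>\<^sub>0 'k::zero) \<Rightarrow> ('n \<Rightarrow>\<^sub>0 nat) \<Rightarrow> ('n \<Rightarrow>\<^sub>0 nat) \<Rightarrow> 'k" where
  "Mentry f \<gamma> \<beta> = (if (\<forall>i. Poly_Mapping.lookup \<beta> i \<le> Poly_Mapping.lookup \<gamma> i) then Poly_Mapping.lookup f (\<gamma> - \<beta>) else 0)"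

definition mat_rank :: "('r \<Rightarrow> 'c \<Rightarrow> 'k::field) \<Rightarrow> 'r set \<Rightarrow> 'c set \<Rightarrow> nat" where
  "mat_rank A Rw Cl = Max {card C | C. C \<subseteq> Cl \<and>
      (\<forall>c. (\<forall>r\<in>Rw. (\<Sum>\<beta>\<in>C. c \<beta> * A r \<beta>) = 0) \<longrightarrow> (\<forall>\<beta>\<in>C. c \<beta> = 0))}"

definition Yvar :: "('n \<Rightarrow>\<^sub>0 nat) \<Rightarrow> (('n \<Rightarrow>\<^sub>0 nat) \<Rightarrow>\<^sub>0 nat) \<Rightarrow>\<^sub>0 'k::comm_semiring_1" where
  "Yvar \<alpha> = Poly_Mapping.single (Poly_Mapping.single \<alpha> 1) 1"

definition MGentry :: "('n \<Rightarrow>\<^sub>0 nat) \<Rightarrow> ('n \<Rightarrow>\<^sub>0 nat) \<Rightarrow> (('n \<Rightarrow>\<^sub>0 nat) \<Rightarrow>\<^sub>0 nat) \<Rightarrow>\<^sub>0 'k::comm_semiring_1" where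
  "MGentry \<gamma> \<beta> = (if (\<forall>i. Poly_Mapping.lookup \<beta> i \<le> Poly_Mapping.lookup \<gamma> i) then Yvar (\<gamma> - \<beta>) else 0)"

text \<open>The k x k minors of a matrix A with rows in Rw and columns in Cl (Leibniz formula,
  rows/columns selected by injections from {..<k}; each minor appears up to sign, which does
  not change the ideal they generate).\<close>
definition minors :: "nat \<Rightarrow> ('r \<Rightarrow> 'c \<Rightarrow> 'a::comm_ring_1) \<Rightarrow> 'r set \<Rightarrow> 'c set \<Rightarrow> 'a set" where
  "minors k A Rw Cl = {(\<Sum>p | p permutes {..<k}. of_int (sign p) * (\<Prod>i<k. A (r i) (c (p i))))
      | r c. inj_on r {..<k} \<and> r ` {..<k} \<subseteq> Rw \<and> inj_on c {..<k} \<and> c ` {..<k} \<subseteq> Cl}"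

definition peval :: "(('y \<Rightarrow>\<^sub>0 nat) \<Rightarrow>\<^sub>0 'k::comm_semiring_1) \<Rightarrow> ('y \<Rightarrow> 'k) \<Rightarrow> 'k" where
  "peval g P = (\<Sum>\<mu>\<in>Poly_Mapping.keys g. Poly_Mapping.lookup g \<mu> * (\<Prod>y\<in>Poly_Mapping.keys \<mu>. P y ^ Poly_Mapping.lookup \<mu> y))"

text \<open>zero locus V(J) (on affine coordinate vectors; for homogeneous J it is a cone, i.e.
  describes a projective set)\<close>
definition zero_locus :: "(('y \<Rightarrow>\<^sub>0 nat) \<Rightarrow>\<^sub>0 'k::comm_semiring_1) set \<Rightarrow> ('y \<Rightarrow> 'k) set" where
  "zero_locus J = {P. \<forall>g\<in>J. peval g P = 0}"

definition coeff_point :: "nat \<Rightarrow> (('n \<Rightarrow>\<^sub>0 nat) \<Rightarrow>\<^sub>0 'k::zero) \<Rightarrow> ('n \<Rightarrow>\<^sub>0 nat) \<Rightarrow> 'k" where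
  "coeff_point e f = (\<lambda>\<alpha>. if mdeg \<alpha> = e then Poly_Mapping.lookup f \<alpha> else 0)"

end

theory Submission
  imports Defs "Jordan_Normal_Form.Determinant" "HOL-Library.Function_Algebras"
begin

text \<open>
  Reading off the coefficient of the top monomial of \<open>g * f\<close> gives a functional \<open>lam\<close> with
  \<open>I = {g. \<forall>r. lam (r * g) = 0}\<close>, so \<open>A = R/I\<close> is Gorenstein with socle degree \<open>s\<close>, and the rank
  condition says that \<open>I\<close> has no nonzero form of degree \<open>s/2\<close>.

  The Koszul complex of the operators \<open>x\<^sub>v \<otimes> 1 - 1 \<otimes> x\<^sub>v\<close> on \<open>R \<otimes> A\<close> (over the base field) is a finite
  graded free resolution of \<open>A\<close> of length \<open>n\<close>; its transpose is the Koszul complex of the dual basis, hence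
  again a resolution of \<open>A\<close>. Cancelling unit entries of the differentials preserves both properties and ends
  in a minimal resolution with minimal transpose. Minimality makes the twists grow strictly from either
  end, and starting both at the initial degree of \<open>I\<close> leaves only the linear shape when that degree exceeds \<open>s/2\<close>.

  Conversely, a socle element \<open>z\<close> of degree \<open>s\<close> gives a map from the residue field to \<open>A\<close>, which lifts to a map from
  the Koszul complex of the variables to any given resolution of \<open>A\<close>. If its last component had no constant term, the
  exactness of the dual Koszul complex would make the lift null homotopic, putting \<open>z\<close> into \<open>I\<close>. Hence
  the last twist of a linear resolution is \<open>s + n\<close>, that is, \<open>s = 2d - 2\<close>.
\<close>

text \<open>The claim concerns twists, so neither Ext nor depth is developed; the twists are read
  off one self-dual complex. Since \<open>lam (p * q)\<close> is a perfect pairing on A, the dual of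
  a basis of A has the transposed multiplication matrices, so the transposed Koszul complex is the
  Koszul complex of another basis of the same A. Its generator sits in degree -(s + n): n comes from
  complementing subsets of the variables, and s because 1 is expressed by the duals of basis
  monomials of degree s only. With t = s/2 the bounds from the two ends read t + i <= twist and
  twist <= t + i for 0 < i < n. Testing I in degree t alone is enough: a form of I of lower degree,
  multiplied by a power of a variable, lands in degree t. The matrix in (ii) is multiplication by f
  from the forms of degree t to degree e + t of R/(x_1^m, ..., x_n^m), so its kernel is the degree t
  part of I. In the converse the given linear resolution comes without information on its transpose;
  this is why only the Koszul side of the lift is dualised.\<close>

abbreviation lookup where "lookup \<equiv> Poly_Mapping.lookup"
abbreviation keys where "keys \<equiv> Poly_Mapping.keys"
abbreviation single where "single \<equiv> Poly_Mapping.single"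

section \<open>Polynomials and their homogeneous components\<close>

lemma mdeg_UNIV: "mdeg \<alpha> = (\<Sum>i\<in>UNIV. lookup \<alpha> i)" for \<alpha> :: "'n::finite \<Rightarrow>\<^sub>0 nat"
  unfolding mdeg_def by (rule sum.mono_neutral_left) (auto simp: in_keys_iff)

lemma mdeg_0 [simp]: "mdeg 0 = 0"
  by (simp add: mdeg_def)

lemma mdeg_add [simp]: "mdeg (\<alpha> + \<beta>) = mdeg \<alpha> + mdeg \<beta>" for \<alpha> :: "'n::finite \<Rightarrow>\<^sub>0 nat"
  by (simp add: mdeg_UNIV lookup_add sum.distrib)

lemma mdeg_single [simp]: "mdeg (single i k) = k" for i :: "'n::finite"
  by (simp add: mdeg_UNIV lookup_single when_def)

lemma mdeg_eq_0_iff: "mdeg \<alpha> = 0 \<longleftrightarrow> \<alpha> = 0" for \<alpha> :: "'n::finite \<Rightarrow>\<^sub>0 nat"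
  by (auto simp: mdeg_UNIV intro!: poly_mapping_eqI)

lemma finite_mdeg_le: "finite {\<alpha> :: 'n::finite \<Rightarrow>\<^sub>0 nat. mdeg \<alpha> \<le> d}"
proof -
  have "inj_on lookup {\<alpha> :: 'n \<Rightarrow>\<^sub>0 nat. mdeg \<alpha> \<le> d}"
    by (simp add: inj_on_def)
  moreover have "lookup ` {\<alpha> :: 'n \<Rightarrow>\<^sub>0 nat. mdeg \<alpha> \<le> d} \<subseteq> (UNIV \<rightarrow>\<^sub>E {..d})"
  proof -
    have "lookup \<alpha> i \<le> mdeg \<alpha>" for \<alpha> :: "'n \<Rightarrow>\<^sub>0 nat" and i
      unfolding mdeg_UNIV by (rule member_le_sum) auto
    then show ?thesis by (auto simp: PiE_iff intro: order_trans)
  qed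
  moreover have "finite ((UNIV::'n set) \<rightarrow>\<^sub>E {..d})" by (intro finite_PiE) auto
  ultimately show ?thesis using finite_imageD finite_subset by blast
qed

lemma lookup_single_mult_add:
  "lookup (single \<beta> c * p) (\<beta> + \<alpha>) = c * lookup p \<alpha>"
  for p :: "('n \<Rightarrow>\<^sub>0 nat) \<Rightarrow>\<^sub>0 'k::comm_semiring_1"
proof -
  have *: "Sum_any (\<lambda>q. lookup p q when \<beta> + \<alpha> = k + q) = (lookup p \<alpha> when k = \<beta>)" if "k = \<beta>" for k
    using that by simp
  have "lookup (single \<beta> c * p) (\<beta> + \<alpha>) = Sum_any (\<lambda>k. (c when \<beta> = k) * (Sum_any (\<lambda>q. lookup p q when \<beta> + \<alpha> = k + q)))"
    by (simp add: lookup_mult lookup_single)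
  also have "\<dots> = Sum_any (\<lambda>k. (c * lookup p \<alpha>) when \<beta> = k)"
    by (rule Sum_any.cong) (auto simp: when_def)
  finally show ?thesis by simp
qed

lemma lookup_single_mult:
  "lookup (single \<beta> c * p) \<gamma> = (if \<forall>i. lookup \<beta> i \<le> lookup \<gamma> i then c * lookup p (\<gamma> - \<beta>) else 0)"
  for p :: "('n \<Rightarrow>\<^sub>0 nat) \<Rightarrow>\<^sub>0 'k::comm_semiring_1"
proof (cases "\<forall>i. lookup \<beta> i \<le> lookup \<gamma> i")
  case True
  then have "\<gamma> = \<beta> + (\<gamma> - \<beta>)" by (auto intro!: poly_mapping_eqI simp: lookup_add lookup_minus)
  then show ?thesis using True lookup_single_mult_add[of \<beta> c p "\<gamma> - \<beta>"] by simp
next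
  case False
  have "\<gamma> \<notin> keys (single \<beta> c * p)"
  proof
    assume "\<gamma> \<in> keys (single \<beta> c * p)"
    then obtain a b where "a \<in> keys (single \<beta> c)" "\<gamma> = a + b" using keys_mult by blast
    then show False using False by (auto simp: lookup_add split: if_splits)
  qed
  then show ?thesis unfolding in_keys_iff if_not_P[OF False] by simp
qed

lemma monomial_expansion: "p = (\<Sum>\<alpha>\<in>keys p. single \<alpha> (lookup p \<alpha>))"
  for p :: "'a \<Rightarrow>\<^sub>0 'k::comm_monoid_add"
proof (rule poly_mapping_eqI)
  fix \<beta>
  have "(\<Sum>\<alpha>\<in>keys p. lookup (single \<alpha> (lookup p \<alpha>)) \<beta>) = (\<Sum>\<alpha>\<in>keys p. if \<alpha> = \<beta> then lookup p \<beta> else 0)"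
    by (rule sum.cong) (auto simp: lookup_single when_def)
  also have "\<dots> = lookup p \<beta>" by (simp add: in_keys_iff)
  finally show "lookup p \<beta> = lookup (\<Sum>\<alpha>\<in>keys p. single \<alpha> (lookup p \<alpha>)) \<beta>" by (simp add: lookup_sum)
qed

abbreviation Const :: "'k::zero \<Rightarrow> ('n \<Rightarrow>\<^sub>0 nat) \<Rightarrow>\<^sub>0 'k" where "Const c \<equiv> single 0 c"

lemma lookup_Const_mult [simp]: "lookup (Const c * p) \<alpha> = c * lookup p \<alpha>"
  for p :: "('n \<Rightarrow>\<^sub>0 nat) \<Rightarrow>\<^sub>0 'k::comm_semiring_1"
  using lookup_single_mult_add[of 0 c p \<alpha>] by simp

lemma Const_mult: "Const c * Const d = Const (c * d :: 'k::comm_semiring_1)"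
  by (simp add: mult_single)

lemma Const_sum: "Const (\<Sum>x\<in>A. c x) = (\<Sum>x\<in>A. Const (c x))"
  by (induction A rule: infinite_finite_induct) (auto simp: single_add)

lemma single_eq_Const_mult: "single \<alpha> c = Const c * single \<alpha> (1::'k::comm_semiring_1)"
  by (simp add: mult_single)

text \<open>Reduction modulo the ideal of the variables; a complex is minimal when this map kills
  all its entries.\<close>

definition ccoeff :: "(('n \<Rightarrow>\<^sub>0 nat) \<Rightarrow>\<^sub>0 'k) \<Rightarrow> 'k::zero" where
  "ccoeff p = lookup p 0"

lemma ccoeff_0 [simp]: "ccoeff 0 = 0" by (simp add: ccoeff_def)
lemma ccoeff_1 [simp]: "ccoeff 1 = (1::'k::zero_neq_one)" by (simp add: ccoeff_def)
lemma ccoeff_add [simp]: "ccoeff (p + q) = ccoeff p + (ccoeff q::'k::monoid_add)"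
  by (simp add: ccoeff_def lookup_add)
lemma ccoeff_sum: "ccoeff (\<Sum>x\<in>A. p x) = (\<Sum>x\<in>A. ccoeff (p x)::'k::comm_monoid_add)"
  by (simp add: ccoeff_def lookup_sum)
lemma ccoeff_Const [simp]: "ccoeff (Const c) = c" by (simp add: ccoeff_def)

lemma ccoeff_mult [simp]: "ccoeff (p * q) = ccoeff p * ccoeff q"
  for p q :: "('n::finite \<Rightarrow>\<^sub>0 nat) \<Rightarrow>\<^sub>0 'k::comm_semiring_1"
proof -
  have 1: "lookup (single \<alpha> c * q) 0 = (if \<alpha> = 0 then c * lookup q 0 else 0)" for \<alpha> c
    unfolding lookup_single_mult by (auto intro!: poly_mapping_eqI)
  have "lookup (p * q) 0 = lookup ((\<Sum>\<alpha>\<in>keys p. single \<alpha> (lookup p \<alpha>)) * q) 0"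
    using monomial_expansion[of p] by simp
  also have "\<dots> = (\<Sum>\<alpha>\<in>keys p. if \<alpha> = 0 then lookup p \<alpha> * lookup q 0 else 0)"
    by (simp add: sum_distrib_right lookup_sum 1)
  also have "\<dots> = lookup p 0 * lookup q 0"
    by (subst sum.delta) (auto simp: in_keys_iff)
  finally show ?thesis by (simp add: ccoeff_def)
qed

lemma homog_keysD: "homog d p \<Longrightarrow> \<alpha> \<in> keys p \<Longrightarrow> mdeg \<alpha> = d"
  by (simp add: homog_def)

lemma homog_0 [simp]: "homog d 0" by (simp add: homog_def)

lemma homog_add: "homog d p \<Longrightarrow> homog d q \<Longrightarrow> homog d (p + q)" for p q :: "_ \<Rightarrow>\<^sub>0 'k::monoid_add"
  unfolding homog_def using keys_add[of p q] by blast

lemma homog_sum: "(\<And>x. x \<in> A \<Longrightarrow> homog d (p x)) \<Longrightarrow> homog d (\<Sum>x\<in>A. p x)"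
  for p :: "_ \<Rightarrow> _ \<Rightarrow>\<^sub>0 'k::comm_monoid_add"
  by (induction A rule: infinite_finite_induct) (auto intro: homog_add)

lemma homog_mult: "homog c p \<Longrightarrow> homog d q \<Longrightarrow> homog (c + d) (p * q)"
  for p q :: "('n::finite \<Rightarrow>\<^sub>0 nat) \<Rightarrow>\<^sub>0 'k::semiring_0"
  unfolding homog_def using keys_mult[of p q] by force

lemma homog_single: "mdeg \<alpha> = d \<Longrightarrow> homog d (single \<alpha> c)"
  by (simp add: homog_def)

definition hcomp :: "nat \<Rightarrow> (('n \<Rightarrow>\<^sub>0 nat) \<Rightarrow>\<^sub>0 'k::comm_monoid_add) \<Rightarrow> ('n \<Rightarrow>\<^sub>0 nat) \<Rightarrow>\<^sub>0 'k" where
  "hcomp d p = (\<Sum>\<alpha>\<in>{\<alpha>\<in>keys p. mdeg \<alpha> = d}. single \<alpha> (lookup p \<alpha>))"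

lemma lookup_hcomp: "lookup (hcomp d p) \<beta> = (if mdeg \<beta> = d then lookup p \<beta> else 0)"
proof -
  have "lookup (hcomp d p) \<beta> = (\<Sum>\<alpha>\<in>{\<alpha>\<in>keys p. mdeg \<alpha> = d}. if \<alpha> = \<beta> then lookup p \<beta> else 0)"
    unfolding hcomp_def lookup_sum by (rule sum.cong) (auto simp: lookup_single when_def)
  then show ?thesis by (auto simp: in_keys_iff)
qed

lemma homog_hcomp [simp]: "homog d (hcomp d p)"
  by (auto simp: homog_def in_keys_iff lookup_hcomp split: if_splits)

lemma hcomp_id: "homog d p \<Longrightarrow> hcomp d p = p"
  by (rule poly_mapping_eqI) (auto simp: lookup_hcomp homog_def in_keys_iff)

lemma hcomp_id_iff: "hcomp d p = p \<longleftrightarrow> (\<forall>\<alpha>\<in>keys p. mdeg \<alpha> = d)"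
  using hcomp_id[of d p] homog_hcomp[of d p] by (metis homog_def)

lemma hcomp_homog: "homog c p \<Longrightarrow> hcomp d p = (if c = d then p else 0)"
  by (rule poly_mapping_eqI) (auto simp: lookup_hcomp homog_def in_keys_iff)

lemma hcomp_0 [simp]: "hcomp d 0 = 0" by (simp add: hcomp_def)

lemma hcomp_add: "hcomp d (p + q) = hcomp d p + hcomp d q"
  by (rule poly_mapping_eqI) (simp add: lookup_hcomp lookup_add)

lemma hcomp_diff: "hcomp d (p - q) = hcomp d p - hcomp d (q :: _ \<Rightarrow>\<^sub>0 'k::ab_group_add)"
  by (rule poly_mapping_eqI) (simp add: lookup_hcomp lookup_minus)

lemma hcomp_sum: "hcomp d (\<Sum>x\<in>A. p x) = (\<Sum>x\<in>A. hcomp d (p x))"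
  by (induction A rule: infinite_finite_induct) (auto simp: hcomp_add)

text \<open>Without the guard \<open>c \<le> d\<close>, truncated subtraction would select the
  constant term of \<open>p\<close> when \<open>d < c\<close>.\<close>

lemma hcomp_mult:
  fixes p q :: "('n::finite \<Rightarrow>\<^sub>0 nat) \<Rightarrow>\<^sub>0 'k::comm_ring_1"
  assumes "homog c q"
  shows "hcomp d (p * q) = (if c \<le> d then hcomp (d - c) p * q else 0)"
proof -
  have gen: "hcomp d (r * q) = 0" if "\<And>\<alpha>. \<alpha> \<in> keys r \<Longrightarrow> mdeg \<alpha> + c \<noteq> d" for r
  proof (rule poly_mapping_eqI)
    fix \<beta>
    have "mdeg \<beta> = d \<Longrightarrow> \<beta> \<notin> keys (r * q)"
      using keys_mult[of r q] that assms unfolding homog_def by fastforce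
    then show "lookup (hcomp d (r * q)) \<beta> = lookup 0 \<beta>" by (simp add: lookup_hcomp in_keys_iff)
  qed
  show ?thesis
  proof (cases "c \<le> d")
    case True
    let ?h = "hcomp (d - c) p"
    have "hcomp d ((p - ?h) * q) = 0"
      by (rule gen) (use True in \<open>auto simp: in_keys_iff lookup_minus lookup_hcomp split: if_splits\<close>)
    moreover have "hcomp d (?h * q) = ?h * q"
      using homog_mult[OF homog_hcomp assms, of "d - c" p] True by (intro hcomp_id) simp
    moreover have "p * q = (p - ?h) * q + ?h * q" by (simp add: algebra_simps)
    ultimately show ?thesis using True by (metis hcomp_add add.left_neutral)
  next
    case False
    then show ?thesis using gen[of p] by auto
  qed
qed

lemma hcomp_mult_left:
  fixes p q :: "('n::finite \<Rightarrow>\<^sub>0 nat) \<Rightarrow>\<^sub>0 'k::comm_ring_1"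
  shows "homog c q \<Longrightarrow> hcomp d (q * p) = (if c \<le> d then q * hcomp (d - c) p else 0)"
  using hcomp_mult[of c q d p] by (simp add: mult.commute)

lemma homog_Xvar: "homog 1 (Xvar v :: ('n::finite,'k::field) mpoly)"
  unfolding Xvar_def by (rule homog_single) simp

lemma homog_0_Const: "homog 0 p \<Longrightarrow> p = Const (ccoeff p)"
  for p :: "('n::finite \<Rightarrow>\<^sub>0 nat) \<Rightarrow>\<^sub>0 'k::comm_semiring_1"
  by (rule poly_mapping_eqI)
    (auto simp: ccoeff_def homog_def in_keys_iff lookup_single when_def mdeg_eq_0_iff)

section \<open>Ideals and the monomial complete intersection\<close>

definition is_ideal :: "'a::comm_ring_1 set \<Rightarrow> bool" where
  "is_ideal I \<longleftrightarrow> 0 \<in> I \<and> (\<forall>p\<in>I. \<forall>q\<in>I. p + q \<in> I) \<and> (\<forall>r. \<forall>p\<in>I. r * p \<in> I)"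

lemma is_idealD:
  assumes "is_ideal I"
  shows "0 \<in> I" "p \<in> I \<Longrightarrow> q \<in> I \<Longrightarrow> p + q \<in> I" "p \<in> I \<Longrightarrow> r * p \<in> I" "p \<in> I \<Longrightarrow> p * r \<in> I"
    "p \<in> I \<Longrightarrow> q \<in> I \<Longrightarrow> p - q \<in> I"
proof -
  show 1: "0 \<in> I" "p \<in> I \<Longrightarrow> q \<in> I \<Longrightarrow> p + q \<in> I" "p \<in> I \<Longrightarrow> r * p \<in> I" for p q r
    using assms by (auto simp: is_ideal_def)
  show "p \<in> I \<Longrightarrow> p * r \<in> I" using 1(3)[of p r] by (simp add: mult.commute)
  show "p - q \<in> I" if "p \<in> I" "q \<in> I"
    using 1(2)[of p "-1 * q"] 1(3)[of q "-1"] that by simp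
qed

lemma is_ideal_sum: "is_ideal I \<Longrightarrow> (\<And>x. x \<in> A \<Longrightarrow> p x \<in> I) \<Longrightarrow> (\<Sum>x\<in>A. p x) \<in> I"
  by (induction A rule: infinite_finite_induct) (simp_all add: is_idealD(1,2))

lemma ideal_gen_ideal: "is_ideal (ideal_gen G)"
  unfolding is_ideal_def
proof (intro conjI ballI allI)
  show "0 \<in> ideal_gen G" unfolding ideal_gen_def by (auto intro!: exI[of _ "{}"])
next
  fix p q assume "p \<in> ideal_gen G" "q \<in> ideal_gen G"
  obtain F c where F: "finite F" "F \<subseteq> G" "p = (\<Sum>g\<in>F. c g * g)"
    using \<open>p \<in> ideal_gen G\<close> unfolding ideal_gen_def by blast
  obtain F' c' where F': "finite F'" "F' \<subseteq> G" "q = (\<Sum>g\<in>F'. c' g * g)"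
    using \<open>q \<in> ideal_gen G\<close> unfolding ideal_gen_def by blast
  have "p = (\<Sum>g\<in>F \<union> F'. (if g \<in> F then c g else 0) * g)"
    unfolding F(3) by (rule sum.mono_neutral_cong_left) (use F(1,2) F'(1,2) in auto)
  moreover have "q = (\<Sum>g\<in>F \<union> F'. (if g \<in> F' then c' g else 0) * g)"
    unfolding F'(3) by (rule sum.mono_neutral_cong_left) (use F(1,2) F'(1,2) in auto)
  ultimately have "p + q = (\<Sum>g\<in>F \<union> F'. ((if g \<in> F then c g else 0) + (if g \<in> F' then c' g else 0)) * g)"
    by (simp only: distrib_right sum.distrib)
  then show "p + q \<in> ideal_gen G" unfolding ideal_gen_def using F F'
    by (intro CollectI exI[of _ "F \<union> F'"]
        exI[of _ "\<lambda>g. (if g \<in> F then c g else 0) + (if g \<in> F' then c' g else 0)"]) simp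
next
  fix r p assume "p \<in> ideal_gen G"
  then obtain F c where F: "finite F" "F \<subseteq> G" "p = (\<Sum>g\<in>F. c g * g)"
    unfolding ideal_gen_def by blast
  then have "r * p = (\<Sum>g\<in>F. (r * c g) * g)" by (simp add: sum_distrib_left mult.assoc)
  then show "r * p \<in> ideal_gen G" unfolding ideal_gen_def using F
    by (intro CollectI exI[of _ F] exI[of _ "\<lambda>g. r * c g"]) simp
qed

lemma ideal_gen_superset: "g \<in> G \<Longrightarrow> g \<in> ideal_gen G"
  unfolding ideal_gen_def by (intro CollectI exI[of _ "{g}"] exI[of _ "\<lambda>_. 1"]) auto

lemma ideal_gen_least: "is_ideal I \<Longrightarrow> G \<subseteq> I \<Longrightarrow> ideal_gen G \<subseteq> I"
  unfolding ideal_gen_def by (auto intro!: is_ideal_sum is_idealD(3))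

lemma Xvar_power: "Xvar i ^ m = (single (single i m) 1 :: ('n, 'k::comm_semiring_1) mpoly)"
  by (induction m) (auto simp: Xvar_def mult_single single_add[symmetric])

lemma powers_ideal_iff:
  "p \<in> powers_ideal m \<longleftrightarrow> (\<forall>\<alpha>\<in>keys p. \<exists>i. m \<le> lookup \<alpha> i)"
  for p :: "('n::finite, 'k::field) mpoly"
proof
  assume "p \<in> powers_ideal m"
  then obtain F c where F: "F \<subseteq> {Xvar i ^ m | i. True}" "p = (\<Sum>g\<in>F. c g * g)"
    unfolding powers_ideal_def ideal_gen_def by blast
  show "\<forall>\<alpha>\<in>keys p. \<exists>i. m \<le> lookup \<alpha> i"
  proof
    fix \<alpha> assume "\<alpha> \<in> keys p"
    then have "lookup (\<Sum>g\<in>F. c g * g) \<alpha> \<noteq> 0" using F by (simp add: in_keys_iff)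
    then obtain g where g: "g \<in> F" "lookup (c g * g) \<alpha> \<noteq> 0" unfolding lookup_sum by (meson sum.neutral)
    from F(1) g(1) obtain i where "g = Xvar i ^ m" by blast
    then have i: "g = single (single i m) 1" by (simp add: Xvar_power)
    from g(2) have "\<alpha> \<in> keys (c g * g)" by (simp add: in_keys_iff)
    then obtain b where "\<alpha> = b + single i m" using keys_mult[of "c g" g] i by auto
    then show "\<exists>i. m \<le> lookup \<alpha> i" by (auto simp: lookup_add intro: exI[of _ i])
  qed
next
  assume *: "\<forall>\<alpha>\<in>keys p. \<exists>i. m \<le> lookup \<alpha> i"
  have "single \<alpha> (lookup p \<alpha>) \<in> powers_ideal m" if \<alpha>: "\<alpha> \<in> keys p" for \<alpha>
  proof -
    obtain i where i: "m \<le> lookup \<alpha> i" using * \<alpha> by blast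
    have "\<alpha> = (\<alpha> - single i m) + single i m"
      by (rule poly_mapping_eqI) (use i in \<open>auto simp: lookup_add lookup_minus lookup_single when_def\<close>)
    then have "single \<alpha> (lookup p \<alpha>) = single (\<alpha> - single i m) (lookup p \<alpha>) * Xvar i ^ m"
      by (metis Xvar_power mult_single mult.right_neutral)
    moreover have "Xvar i ^ m \<in> (powers_ideal m :: ('n,'k) mpoly set)"
      unfolding powers_ideal_def by (rule ideal_gen_superset) auto
    ultimately show ?thesis using is_idealD(3)[OF ideal_gen_ideal] unfolding powers_ideal_def by metis
  qed
  then have "(\<Sum>\<alpha>\<in>keys p. single \<alpha> (lookup p \<alpha>)) \<in> powers_ideal m"
    unfolding powers_ideal_def by (intro is_ideal_sum ideal_gen_ideal) auto
  then show "p \<in> powers_ideal m" using monomial_expansion[of p] by simp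
qed

text \<open>Macaulay's dual generator as a linear form: \<open>lam\<close> lives in degree
  \<open>s\<close>, and \<open>I\<close> is the largest ideal inside its kernel, so
  \<open>lam (p * q)\<close> is a nondegenerate pairing on R/I. Besides the colon ideal, the ideal
  of the variables with \<open>ccoeff\<close> and \<open>s = 0\<close> is an instance; this is how
  the residue field gets its resolution.\<close>

locale dual_functional =
  fixes I :: "('n::finite, 'k::field) mpoly set"
    and lam :: "('n, 'k) mpoly \<Rightarrow> 'k"
    and s :: nat
  assumes lam_add: "lam (p + q) = lam p + lam q"
    and lam_Const: "lam (Const c * p) = c * lam p"
    and lam_hcomp: "lam (hcomp s p) = lam p"
    and lam_nz: "\<exists>r. lam r \<noteq> 0"
    and I_eq: "I = {g. \<forall>r. lam (r * g) = 0}"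
begin

lemma lam_0 [simp]: "lam 0 = 0"
  using lam_Const[of 0 0] by simp

lemma lam_sum: "lam (\<Sum>x\<in>A. p x) = (\<Sum>x\<in>A. lam (p x))"
  by (induction A rule: infinite_finite_induct) (auto simp: lam_add)

lemma I_ideal: "is_ideal I"
  unfolding is_ideal_def
proof (intro conjI ballI allI)
  show "0 \<in> I" by (simp add: I_eq)
  show "p + q \<in> I" if "p \<in> I" "q \<in> I" for p q
    using that by (simp add: I_eq distrib_left lam_add)
  show "r * p \<in> I" if "p \<in> I" for r p
    using that unfolding I_eq by (simp add: mult.assoc[symmetric])
qed

lemma lam_I: "g \<in> I \<Longrightarrow> lam g = 0"
  unfolding I_eq by (metis (mono_tags) mem_Collect_eq mult_1)

lemma one_notin_I: "1 \<notin> I"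
  using lam_nz by (auto simp: I_eq)

lemma lam_diff: "lam (p - q) = lam p - lam q"
  using lam_add[of "p - q" q] by simp

lemma I_by_monomials: "g \<in> I \<longleftrightarrow> (\<forall>\<alpha>. lam (single \<alpha> 1 * g) = 0)"
proof
  assume "\<forall>\<alpha>. lam (single \<alpha> 1 * g) = 0"
  then have "lam (single \<alpha> c * g) = 0" for \<alpha> c
    by (subst single_eq_Const_mult) (simp add: mult.assoc lam_Const)
  then have "lam ((\<Sum>\<alpha>\<in>keys r. single \<alpha> (lookup r \<alpha>)) * g) = 0" for r
    by (simp add: sum_distrib_right lam_sum)
  then show "g \<in> I" unfolding I_eq by (simp only: monomial_expansion[symmetric]) simp
qed (auto simp: I_eq)

lemma lam_homog: "homog d p \<Longrightarrow> d \<noteq> s \<Longrightarrow> lam p = 0"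
  using lam_hcomp[of p] by (simp add: hcomp_homog)

text \<open>\<open>lam\<close> only sees degree \<open>s\<close>: a monomial times a component of
  \<open>g\<close> either has another degree or is the degree \<open>s\<close> component of that
  monomial times \<open>g\<close>.\<close>

lemma hcomp_in_I: assumes "g \<in> I" shows "hcomp d g \<in> I"
  unfolding I_by_monomials
proof
  fix \<alpha> :: "'n \<Rightarrow>\<^sub>0 nat"
  have h: "homog (mdeg \<alpha>) (single \<alpha> (1::'k))" by (simp add: homog_single)
  have "homog (mdeg \<alpha> + d) (single \<alpha> 1 * hcomp d g)" by (rule homog_mult[OF h]) simp
  moreover have "lam (single \<alpha> 1 * hcomp d g) = 0" if "mdeg \<alpha> + d = s"
  proof -
    have "single \<alpha> 1 * hcomp d g = hcomp s (single \<alpha> 1 * g)"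
      using that by (auto simp: hcomp_mult_left[OF h])
    then show ?thesis using assms by (simp add: lam_hcomp) (simp add: I_eq)
  qed
  ultimately show "lam (single \<alpha> 1 * hcomp d g) = 0" using lam_homog by blast
qed

lemma homog_in_I: assumes "homog d p" "d > s" shows "p \<in> I"
  unfolding I_by_monomials
proof
  fix \<alpha> :: "'n \<Rightarrow>\<^sub>0 nat"
  have "homog (mdeg \<alpha> + d) (single \<alpha> 1 * p)" by (rule homog_mult[OF _ assms(1)]) (simp add: homog_single)
  then show "lam (single \<alpha> 1 * p) = 0" using lam_homog assms by force
qed

lemma socle_exists: "\<exists>z. homog s z \<and> z \<notin> I"
  using lam_nz lam_hcomp lam_I homog_hcomp by metis

end

text \<open>Exponent of (x_1 ... x_n)^(m-1), which spans the socle of R/(x_1^m, ..., x_n^m).\<close>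

definition top_exponent :: "nat \<Rightarrow> 'n::finite \<Rightarrow>\<^sub>0 nat" where
  "top_exponent m = Poly_Mapping.Abs_poly_mapping (\<lambda>_. m - 1)"

lemma lookup_top_exponent [simp]: "lookup (top_exponent m) i = m - 1"
  by (simp add: top_exponent_def)

lemma mdeg_top_exponent: "mdeg (top_exponent m :: 'n::finite \<Rightarrow>\<^sub>0 nat) = CARD('n) * (m - 1)"
  by (simp add: mdeg_UNIV)

text \<open>A monomial outside the ideal divides the top monomial; multiplying by the complementary
  monomial moves its coefficient to the top position.\<close>

lemma powers_ideal_functional:
  fixes p :: "('n::finite, 'k::field) mpoly"
  assumes m: "m \<ge> 1"
  shows "p \<in> powers_ideal m \<longleftrightarrow> (\<forall>r. lookup (r * p) (top_exponent m) = 0)"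
proof
  assume "p \<in> powers_ideal m"
  then have "r * p \<in> powers_ideal m" for r using is_idealD(3)[OF ideal_gen_ideal] unfolding powers_ideal_def by metis
  then show "\<forall>r. lookup (r * p) (top_exponent m) = 0"
    using m unfolding powers_ideal_iff by (force simp: in_keys_iff)
next
  assume *: "\<forall>r. lookup (r * p) (top_exponent m) = 0"
  show "p \<in> powers_ideal m"
  proof (rule ccontr)
    assume "\<not> ?thesis"
    then obtain \<alpha> where \<alpha>: "\<alpha> \<in> keys p" "\<And>i. \<not> m \<le> lookup \<alpha> i" unfolding powers_ideal_iff by blast
    then have le: "lookup \<alpha> i \<le> m - 1" for i using m \<alpha>(2)[of i] by linarith
    then have "top_exponent m = (top_exponent m - \<alpha>) + \<alpha>"
      by (intro poly_mapping_eqI) (simp only: lookup_add lookup_minus lookup_top_exponent le_add_diff_inverse2)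
    then have "lookup (single (top_exponent m - \<alpha>) 1 * p) (top_exponent m) = lookup p \<alpha>"
      by (metis lookup_single_mult_add mult_1)
    then show False using * \<alpha>(1) by (simp add: in_keys_iff)
  qed
qed

text \<open>Whether \<open>g * f\<close> lies in the ideal of powers is tested by the top
  coefficients of its multiples, and \<open>f\<close> raises degrees by \<open>e\<close>; so the
  form lives in degree n(m-1) - e. The second claim makes this truncated subtraction a true
  difference.\<close>

lemma colon_dual_functional:
  fixes f :: "('n::finite, 'k::field) mpoly"
  assumes m: "m \<ge> 1" and f: "homog e f" "f \<notin> powers_ideal m"
  shows "dual_functional (colon_ideal (powers_ideal m) f) (\<lambda>g. lookup (g * f) (top_exponent m)) (CARD('n) * (m - 1) - e)"
    and "e \<le> CARD('n) * (m - 1)"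
proof -
  obtain \<alpha> where \<alpha>: "\<alpha> \<in> keys f" "\<And>i. \<not> m \<le> lookup \<alpha> i" using f(2) unfolding powers_ideal_iff by blast
  have "mdeg \<alpha> \<le> mdeg (top_exponent m :: 'n \<Rightarrow>\<^sub>0 nat)"
    unfolding mdeg_UNIV
  proof (rule sum_mono)
    fix i :: 'n
    show "lookup \<alpha> i \<le> lookup (top_exponent m) i" using \<alpha>(2)[of i] m by simp
  qed
  then show e: "e \<le> CARD('n) * (m - 1)" using \<alpha>(1) f(1) by (simp add: homog_def mdeg_top_exponent)
  show "dual_functional (colon_ideal (powers_ideal m) f) (\<lambda>g. lookup (g * f) (top_exponent m)) (CARD('n) * (m - 1) - e)"
  proof
    show "\<exists>r. lookup (r * f) (top_exponent m) \<noteq> 0"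
      using f(2) powers_ideal_functional[OF m, of f] by auto
    show "colon_ideal (powers_ideal m) f = {g. \<forall>r. lookup (r * g * f) (top_exponent m) = 0}"
      unfolding colon_ideal_def powers_ideal_functional[OF m] by (simp add: mult.assoc)
    fix p q :: "('n,'k) mpoly" and c :: 'k
    show "lookup ((p + q) * f) (top_exponent m) = lookup (p * f) (top_exponent m) + lookup (q * f) (top_exponent m)"
      by (simp add: distrib_right lookup_add)
    show "lookup (Const c * p * f) (top_exponent m) = c * lookup (p * f) (top_exponent m)"
      by (simp add: mult.assoc)
    show "lookup (hcomp (CARD('n) * (m - 1) - e) p * f) (top_exponent m) = lookup (p * f) (top_exponent m)"
      using hcomp_mult[OF f(1), of "CARD('n) * (m - 1)" p] e
        lookup_hcomp[of "CARD('n) * (m - 1)" "p * f" "top_exponent m"]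
      by (simp add: mdeg_top_exponent)
  qed
qed

section \<open>Complexes of free modules\<close>

definition vecs :: "'i set \<Rightarrow> ('i \<Rightarrow> 'a::zero) set" where
  "vecs S = {v. \<forall>j. j \<notin> S \<longrightarrow> v j = 0}"

definition app :: "'i set \<Rightarrow> ('i \<Rightarrow> 'i \<Rightarrow> 'a) \<Rightarrow> ('i \<Rightarrow> 'a) \<Rightarrow> 'i \<Rightarrow> 'a::comm_ring_1" where
  "app S D v = (\<lambda>j. if j \<in> S then \<Sum>k\<in>S. D j k * v k else 0)"

definition cplx :: "'i set \<Rightarrow> ('i \<Rightarrow> int) \<Rightarrow> ('i \<Rightarrow> 'i \<Rightarrow> 'a::comm_ring_1) \<Rightarrow> bool" where
  "cplx S h D \<longleftrightarrow> finite S \<and> (\<forall>j\<in>S. 0 \<le> h j) \<and>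
     (\<forall>j\<in>S. \<forall>k\<in>S. D j k \<noteq> 0 \<longrightarrow> h k = h j + 1) \<and>
     (\<forall>i\<in>S. \<forall>j\<in>S. (\<Sum>k\<in>S. D i k * D k j) = 0)"

text \<open>
  A complex is given by one finite index set \<open>S\<close> for all its free modules together, the homological degree \<open>h\<close> of an
  index, and one matrix \<open>D\<close>, so that the dual complex is obtained by transposing \<open>D\<close> and replacing \<open>h\<close> by \<open>n - h\<close>.
  The homology in degree 0 is described by \<open>coker_gen\<close>: it is cyclic, generated by \<open>g\<close>, with annihilator \<open>I\<close>.
\<close>

definition acyclic_above :: "'i set \<Rightarrow> ('i \<Rightarrow> int) \<Rightarrow> ('i \<Rightarrow> 'i \<Rightarrow> 'a::comm_ring_1) \<Rightarrow> bool" where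
  "acyclic_above S h D \<longleftrightarrow>
     (\<forall>v\<in>vecs S. (\<forall>j\<in>S. h j = 0 \<longrightarrow> v j = 0) \<and> app S D v = (\<lambda>_. 0) \<longrightarrow> (\<exists>u\<in>vecs S. v = app S D u))"

definition coker_gen :: "'i set \<Rightarrow> ('i \<Rightarrow> int) \<Rightarrow> ('i \<Rightarrow> 'i \<Rightarrow> 'a::comm_ring_1) \<Rightarrow> 'a set \<Rightarrow> ('i \<Rightarrow> 'a) \<Rightarrow> bool" where
  "coker_gen S h D I g \<longleftrightarrow> g \<in> vecs {j\<in>S. h j = 0} \<and>
     (\<forall>w\<in>vecs {j\<in>S. h j = 0}. \<exists>r. \<exists>u\<in>vecs S. w = (\<lambda>j. r * g j + app S D u j)) \<and>
     (\<forall>r. (\<exists>u\<in>vecs S. (\<lambda>j. r * g j) = app S D u) \<longleftrightarrow> r \<in> I)"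

lemma vecsD: "v \<in> vecs S \<Longrightarrow> j \<notin> S \<Longrightarrow> v j = 0"
  by (simp add: vecs_def)

lemma app_vecs [simp]: "app S D v \<in> vecs S"
  by (simp add: vecs_def app_def)

lemma app_add: "app S D (\<lambda>j. u j + v j) = (\<lambda>j. app S D u j + app S D v j)"
  by (auto simp: app_def algebra_simps sum.distrib)

lemma app_scale: "app S D (\<lambda>j. r * v j) = (\<lambda>j. r * app S D v j)"
  by (auto simp: app_def sum_distrib_left algebra_simps)

lemma app_zero [simp]: "app S D (\<lambda>j. 0) = (\<lambda>j. 0)"
  by (auto simp: app_def)

lemma app_unit:
  assumes "finite S" "k \<in> S" "j \<in> S"
  shows "app S D (\<lambda>i. if i = k then 1 else 0) j = D j k"
proof -
  have "(\<Sum>i\<in>S. D j i * (if i = k then 1 else 0)) = (\<Sum>i\<in>S. if i = k then D j i else 0)"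
    by (rule sum.cong) auto
  then show ?thesis using assms by (simp add: app_def)
qed

lemma square_zero_iff:
  fixes D :: "'i \<Rightarrow> 'i \<Rightarrow> 'a::comm_ring_1"
  assumes "finite S"
  shows "(\<forall>i\<in>S. \<forall>j\<in>S. (\<Sum>k\<in>S. D i k * D k j) = 0) \<longleftrightarrow> (\<forall>v\<in>vecs S. app S D (app S D v) = (\<lambda>_. 0))"
proof (intro iffI ballI)
  fix v assume *: "\<forall>i\<in>S. \<forall>j\<in>S. (\<Sum>k\<in>S. D i k * D k j) = 0"
  show "app S D (app S D v) = (\<lambda>_. 0)"
  proof
    fix i
    have "(\<Sum>k\<in>S. D i k * (\<Sum>j\<in>S. D k j * v j)) = (\<Sum>j\<in>S. (\<Sum>k\<in>S. D i k * D k j) * v j)"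
      unfolding sum_distrib_left sum_distrib_right by (subst sum.swap) (simp add: mult.assoc)
    then show "app S D (app S D v) i = 0" using * by (simp add: app_def cong: sum.cong)
  qed
next
  fix i j assume *: "\<forall>v\<in>vecs S. app S D (app S D v) = (\<lambda>_. 0)" and ij: "i \<in> S" "j \<in> S"
  let ?e = "\<lambda>k. if k = j then 1 else 0 :: 'a"
  have "?e \<in> vecs S" using ij by (auto simp: vecs_def)
  then have "app S D (app S D ?e) i = 0" using * by simp
  moreover have "app S D (app S D ?e) i = (\<Sum>k\<in>S. D i k * app S D ?e k)"
    using ij by (simp add: app_def[of S D "app S D ?e"])
  moreover have "\<dots> = (\<Sum>k\<in>S. D i k * D k j)"
    using assms ij by (intro sum.cong refl) (simp add: app_unit)
  ultimately show "(\<Sum>k\<in>S. D i k * D k j) = 0" by simp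
qed

lemma cplx_app_app: "cplx S h D \<Longrightarrow> v \<in> vecs S \<Longrightarrow> app S D (app S D v) = (\<lambda>_. 0)"
  using square_zero_iff[of S D] by (auto simp: cplx_def)

text \<open>A nonzero entry would put its row in homological degree -1.\<close>

lemma cplx_bottom: "cplx S h D \<Longrightarrow> j \<in> S \<Longrightarrow> k \<in> S \<Longrightarrow> h k = 0 \<Longrightarrow> D j k = 0"
  unfolding cplx_def by (rule ccontr) fastforce

lemma cplx_app_bottom:
  assumes "cplx S h D" "g \<in> vecs {j\<in>S. h j = 0}"
  shows "app S D g = (\<lambda>_. 0)"
proof
  fix j
  have "D j k * g k = 0" if "j \<in> S" "k \<in> S" for k
    using cplx_bottom[OF assms(1) that] vecsD[OF assms(2), of k] that by (cases "h k = 0") auto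
  then show "app S D g j = 0" by (simp add: app_def)
qed

section \<open>Gaussian elimination of a unit entry of a complex\<close>

definition cancel :: "'i \<Rightarrow> 'i \<Rightarrow> 'a \<Rightarrow> ('i \<Rightarrow> 'i \<Rightarrow> 'a::comm_ring_1) \<Rightarrow> 'i \<Rightarrow> 'i \<Rightarrow> 'a" where
  "cancel j0 k0 ci D = (\<lambda>j k. D j k - D j k0 * ci * D j0 k)"

text \<open>\<open>cancel\<close> is the Schur complement of the unit entry \<open>D j0 k0\<close>
  with inverse \<open>ci\<close>. Its symmetry under transposition is what lets one elimination step
  act on a complex and its dual at once.\<close>

lemma cancel_transpose: "(\<lambda>j k. cancel j0 k0 ci D k j) = cancel k0 j0 ci (\<lambda>j k. D k j)"
  by (simp add: cancel_def fun_eq_iff algebra_simps)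

locale cancellation =
  fixes S :: "'i set" and h :: "'i \<Rightarrow> int" and D :: "'i \<Rightarrow> 'i \<Rightarrow> 'a::comm_ring_1"
    and j0 k0 :: 'i and ci :: 'a
  assumes cplx: "cplx S h D" and j0: "j0 \<in> S" and k0: "k0 \<in> S" and ci: "D j0 k0 * ci = 1"
begin

abbreviation "T \<equiv> S - {j0, k0}"
abbreviation "E \<equiv> cancel j0 k0 ci D"

text \<open>\<open>proj\<close>, \<open>incl\<close> and \<open>htpy\<close> form the deformation
  retraction of the complex onto its reduction: the first two are chain maps, \<open>proj\<close>
  undoes \<open>incl\<close>, and \<open>incl\<close> after \<open>proj\<close> is homotopic to the
  identity through \<open>htpy\<close>.\<close>

definition proj :: "('i \<Rightarrow> 'a) \<Rightarrow> 'i \<Rightarrow> 'a" where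
  "proj v = (\<lambda>j. if j \<in> T then v j - D j k0 * ci * v j0 else 0)"

definition incl :: "('i \<Rightarrow> 'a) \<Rightarrow> 'i \<Rightarrow> 'a" where
  "incl w = (\<lambda>k. if k = k0 then - ci * (\<Sum>i\<in>T. D j0 i * w i) else if k \<in> T then w k else 0)"

definition htpy :: "('i \<Rightarrow> 'a) \<Rightarrow> 'i \<Rightarrow> 'a" where
  "htpy v = (\<lambda>k. if k = k0 then ci * v j0 else 0)"

lemma fin: "finite S" using cplx by (simp add: cplx_def)

lemma nz: "D j0 k0 \<noteq> 0" using ci by auto

lemma h_rel: "j \<in> S \<Longrightarrow> k \<in> S \<Longrightarrow> D j k \<noteq> 0 \<Longrightarrow> h k = h j + 1"
  using cplx by (auto simp: cplx_def)

lemma diag: "j \<in> S \<Longrightarrow> D j j = 0"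
  using h_rel[of j j] by (cases "D j j = 0") auto

lemma ne: "j0 \<noteq> k0" using diag[OF j0] nz by auto

lemma sum_split: "(\<Sum>k\<in>S. F k) = F j0 + F k0 + (\<Sum>k\<in>T. F k)" for F :: "'i \<Rightarrow> 'a"
proof -
  have "S = insert j0 (insert k0 T)" using j0 k0 by auto
  then have "(\<Sum>k\<in>S. F k) = (\<Sum>k\<in>insert j0 (insert k0 T). F k)" by simp
  also have "\<dots> = F j0 + (\<Sum>k\<in>insert k0 T. F k)" using fin ne by (subst sum.insert) auto
  also have "(\<Sum>k\<in>insert k0 T. F k) = F k0 + (\<Sum>k\<in>T. F k)" using fin by (subst sum.insert) auto
  finally show ?thesis by (simp add: add.assoc)
qed

lemma ci': "ci * D j0 k0 = 1" "ci * (D j0 k0 * x) = x" "D j0 k0 * (ci * x) = x"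
  using ci by (simp_all add: mult.commute mult.assoc[symmetric])

lemma sq0: "i \<in> S \<Longrightarrow> j \<in> S \<Longrightarrow> (\<Sum>k\<in>T. D i k * D k j) = - (D i j0 * D j0 j) - D i k0 * D k0 j"
proof -
  assume "i \<in> S" "j \<in> S"
  then have "(\<Sum>k\<in>S. D i k * D k j) = 0" using cplx by (simp add: cplx_def)
  then show ?thesis unfolding sum_split by (simp add: algebra_simps eq_neg_iff_add_eq_0)
qed

lemma proj_vecs: "proj v \<in> vecs T" by (auto simp: proj_def vecs_def)
lemma incl_vecs: "incl v \<in> vecs S" using k0 by (auto simp: incl_def vecs_def)
lemma htpy_vecs: "htpy v \<in> vecs S" using k0 by (auto simp: htpy_def vecs_def)

lemma proj_0 [simp]: "proj (\<lambda>_. 0) = (\<lambda>_. 0)" by (auto simp: proj_def)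
lemma incl_0 [simp]: "incl (\<lambda>_. 0) = (\<lambda>_. 0)" by (auto simp: incl_def)

lemma proj_incl: "w \<in> vecs T \<Longrightarrow> proj (incl w) = w"
  using ne by (auto simp: proj_def incl_def vecs_def)

lemma app_incl_T:
  assumes "j \<in> S"
  shows "(\<Sum>k\<in>S. D j k * incl w k) = (\<Sum>k\<in>T. D j k * w k) - D j k0 * ci * (\<Sum>i\<in>T. D j0 i * w i)"
proof -
  have "(\<Sum>k\<in>T. D j k * incl w k) = (\<Sum>k\<in>T. D j k * w k)"
    by (rule sum.cong) (auto simp: incl_def)
  then show ?thesis unfolding sum_split using ne by (simp add: incl_def algebra_simps)
qed

lemma appE: "j \<in> T \<Longrightarrow> app T E w j = (\<Sum>k\<in>T. D j k * w k) - D j k0 * ci * (\<Sum>i\<in>T. D j0 i * w i)"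
  by (simp add: app_def cancel_def algebra_simps sum_subtractf sum_distrib_left)

lemma app_incl: "app S D (incl w) = incl (app T E w)"
proof
  fix j
  consider "j \<in> T" | "j = j0" | "j = k0" | "j \<notin> S" by auto
  then show "app S D (incl w) j = incl (app T E w) j"
  proof cases
    case 1
    have "app S D (incl w) j = (\<Sum>k\<in>S. D j k * incl w k)" using 1 by (simp add: app_def)
    also have "\<dots> = app T E w j" using 1 by (subst app_incl_T) (auto simp: appE)
    finally show ?thesis using 1 by (simp add: incl_def)
  next
    case 2
    \<comment> \<open>The \<open>k0\<close> coordinate of \<open>incl w\<close> is chosen precisely
      so that this component of the boundary vanishes.\<close>
    have "app S D (incl w) j0 = (\<Sum>k\<in>S. D j0 k * incl w k)" using j0 by (simp add: app_def)
    also have "\<dots> = 0" by (subst app_incl_T[OF j0]) (simp add: ci' ci)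
    finally show ?thesis using 2 ne by (simp add: incl_def)
  next
    case 3
    \<comment> \<open>The \<open>k0\<close> coordinate of the right-hand side is found from D^2 = 0
      in row \<open>j0\<close>; the unit left over then cancels against \<open>ci\<close>.\<close>
    have "(\<Sum>k\<in>T. D j0 k * app T E w k)
        = (\<Sum>k\<in>T. \<Sum>i\<in>T. D j0 k * D k i * w i) - (\<Sum>k\<in>T. D j0 k * D k k0) * (ci * (\<Sum>i\<in>T. D j0 i * w i))"
      unfolding sum_distrib_right sum_subtractf[symmetric]
      by (rule sum.cong) (auto simp: appE right_diff_distrib sum_distrib_left mult.assoc)
    also have "(\<Sum>k\<in>T. \<Sum>i\<in>T. D j0 k * D k i * w i) = (\<Sum>i\<in>T. (\<Sum>k\<in>T. D j0 k * D k i) * w i)"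
      by (subst sum.swap) (simp add: sum_distrib_right)
    also have "\<dots> = (\<Sum>i\<in>T. - (D j0 k0 * D k0 i * w i))"
      by (rule sum.cong) (auto simp: sq0[OF j0] diag[OF j0])
    also have "(\<Sum>k\<in>T. D j0 k * D k k0) = 0"
      by (simp add: sq0[OF j0 k0] diag[OF j0] diag[OF k0])
    finally have *: "(\<Sum>k\<in>T. D j0 k * app T E w k) = - (D j0 k0 * (\<Sum>i\<in>T. D k0 i * w i))"
      by (simp add: sum_negf sum_distrib_left mult.assoc)
    have "app S D (incl w) k0 = (\<Sum>k\<in>S. D k0 k * incl w k)" using k0 by (simp add: app_def)
    also have "\<dots> = (\<Sum>k\<in>T. D k0 k * w k)" by (subst app_incl_T[OF k0]) (simp add: diag[OF k0])
    finally show ?thesis using 3 by (simp add: incl_def * ci')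
  next
    case 4
    then show ?thesis using k0 by (auto simp: app_def incl_def)
  qed
qed

lemma proj_app: "proj (app S D v) = app T E (proj v)"
proof
  fix j
  show "proj (app S D v) j = app T E (proj v) j"
  proof (cases "j \<in> T")
    case True
    then have j: "j \<in> S" by auto
    have 1: "(\<Sum>k\<in>T. D i k * proj v k) = (\<Sum>k\<in>T. D i k * v k) + D i j0 * v j0 + D i k0 * D k0 k0 * ci * v j0" if i: "i \<in> S" for i
    proof -
      have "(\<Sum>k\<in>T. D i k * proj v k) = (\<Sum>k\<in>T. D i k * v k) - (\<Sum>k\<in>T. D i k * D k k0) * (ci * v j0)"
        unfolding sum_distrib_right sum_subtractf[symmetric]
        by (rule sum.cong) (auto simp: proj_def algebra_simps)
      also have "(\<Sum>k\<in>T. D i k * D k k0) = - (D i j0 * D j0 k0)"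
        using sq0[OF i k0] diag[OF k0] by simp
      finally show ?thesis using diag[OF k0] by (simp add: mult.assoc ci')
    qed
    have "app T E (proj v) j = (\<Sum>k\<in>T. D j k * v k) + D j j0 * v j0 - D j k0 * ci * (\<Sum>k\<in>T. D j0 k * v k)"
      by (simp add: appE[OF True] 1[OF j] 1[OF j0] diag[OF j0] diag[OF k0] algebra_simps)
    moreover have "proj (app S D v) j = (\<Sum>k\<in>S. D j k * v k) - D j k0 * ci * (\<Sum>k\<in>S. D j0 k * v k)"
      using True j0 by (simp add: proj_def app_def)
    moreover have "\<dots> = (\<Sum>k\<in>T. D j k * v k) + D j j0 * v j0 - D j k0 * ci * (\<Sum>k\<in>T. D j0 k * v k)"
      unfolding sum_split by (simp add: diag[OF j0] algebra_simps ci')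
    ultimately show ?thesis by simp
  qed (auto simp: proj_def app_def)
qed

lemma app_htpy: "j \<in> S \<Longrightarrow> app S D (htpy v) j = D j k0 * (ci * v j0)"
proof -
  assume j: "j \<in> S"
  have "(\<Sum>k\<in>T. D j k * htpy v k) = 0" by (rule sum.neutral) (auto simp: htpy_def)
  then show ?thesis using j ne by (simp add: app_def sum_split htpy_def)
qed

text \<open>The homotopy identity has one more term, \<open>htpy\<close> of the boundary of
  \<open>v\<close>, which vanishes on cycles.\<close>

lemma htpy:
  assumes "v \<in> vecs S" "app S D v = (\<lambda>_. 0)"
  shows "v = (\<lambda>j. incl (proj v) j + app S D (htpy v) j)"
proof
  fix j
  consider "j \<in> T" | "j = j0" | "j = k0" | "j \<notin> S" by auto
  then show "v j = incl (proj v) j + app S D (htpy v) j"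
  proof cases
    case 1
    then show ?thesis by (simp add: app_htpy) (auto simp: incl_def proj_def mult.assoc)
  next
    case 2
    then show ?thesis using ne j0 by (simp add: app_htpy incl_def ci')
  next
    case 3
    have "app S D v j0 = 0" using assms(2) by simp
    then have 0: "(\<Sum>k\<in>T. D j0 k * v k) = - (D j0 k0 * v k0)"
      using j0 by (simp add: app_def sum_split diag[OF j0] eq_neg_iff_add_eq_0 add.commute)
    have "(\<Sum>k\<in>T. D j0 k * proj v k) = (\<Sum>k\<in>T. D j0 k * v k) - (\<Sum>k\<in>T. D j0 k * D k k0) * (ci * v j0)"
      unfolding sum_distrib_right sum_subtractf[symmetric]
      by (rule sum.cong) (auto simp: proj_def algebra_simps)
    then have "(\<Sum>k\<in>T. D j0 k * proj v k) = - (D j0 k0 * v k0)"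
      by (simp add: sq0[OF j0 k0] diag[OF j0] diag[OF k0] 0)
    then show ?thesis using 3 k0 by (simp add: app_htpy incl_def diag ci')
  next
    case 4
    then show ?thesis using assms(1) k0 by (auto simp: vecs_def app_def incl_def)
  qed
qed

lemma cplx_cancel: "cplx T h E"
  unfolding cplx_def
proof (intro conjI)
  show "finite T" using fin by simp
  show "\<forall>j\<in>T. 0 \<le> h j" using cplx by (auto simp: cplx_def)
  show "\<forall>j\<in>T. \<forall>k\<in>T. E j k \<noteq> 0 \<longrightarrow> h k = h j + 1"
  proof (intro ballI impI)
    fix j k assume jk: "j \<in> T" "k \<in> T" "E j k \<noteq> 0"
    then have "D j k \<noteq> 0 \<or> (D j k0 \<noteq> 0 \<and> D j0 k \<noteq> 0)" by (auto simp: cancel_def)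
    then show "h k = h j + 1"
      using h_rel[of j k] h_rel[of j k0] h_rel[of j0 k] h_rel[OF j0 k0 nz] jk j0 k0 by auto
  qed
  have "app T E (app T E w) = (\<lambda>_. 0)" if w: "w \<in> vecs T" for w
  proof -
    have "app T E (app T E w) = proj (incl (app T E (app T E w)))" by (simp add: proj_incl)
    also have "incl (app T E (app T E w)) = app S D (app S D (incl w))" by (simp add: app_incl)
    also have "\<dots> = (\<lambda>_. 0)" by (rule cplx_app_app[OF cplx incl_vecs])
    finally show ?thesis by simp
  qed
  then show "\<forall>i\<in>T. \<forall>j\<in>T. (\<Sum>k\<in>T. E i k * E k j) = 0"
    using square_zero_iff[of T E] fin by blast
qed

lemma h_k0: "h k0 \<noteq> 0"
  using cplx_bottom[OF cplx j0 k0] nz by auto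

lemma acyclic_cancel:
  assumes "acyclic_above S h D"
  shows "acyclic_above T h E"
  unfolding acyclic_above_def
proof (intro ballI impI)
  fix v assume v: "v \<in> vecs T" and 0: "(\<forall>j\<in>T. h j = 0 \<longrightarrow> v j = 0) \<and> app T E v = (\<lambda>_. 0)"
  have "app S D (incl v) = (\<lambda>_. 0)" using 0 by (simp add: app_incl)
  \<comment> \<open>\<open>incl\<close> may create a component at \<open>k0\<close>, but
    \<open>k0\<close> is never in homological degree 0.\<close>
  moreover have "\<forall>j\<in>S. h j = 0 \<longrightarrow> incl v j = 0" using 0 h_k0 by (auto simp: incl_def)
  ultimately obtain u where "u \<in> vecs S" "incl v = app S D u"
    using assms incl_vecs unfolding acyclic_above_def by blast
  then have "v = app T E (proj u)" using proj_incl[OF v] proj_app[of u] by simp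
  then show "\<exists>u\<in>vecs T. v = app T E u" using proj_vecs by blast
qed

lemma proj_bottom:
  assumes "g \<in> vecs {j\<in>S. h j = 0}" shows "proj g \<in> vecs {j\<in>T. h j = 0}"
  unfolding vecs_def
proof (intro CollectI allI impI)
  fix j assume j: "j \<notin> {j\<in>T. h j = 0}"
  show "proj g j = 0"
  proof (cases "j \<in> T")
    case True
    then have hj: "h j \<noteq> 0" using j by auto
    have "g j = 0" using vecsD[OF assms, of j] hj by auto
    \<comment> \<open>A nonzero entry in column \<open>k0\<close> would give \<open>j\<close> the
      homological degree of \<open>j0\<close>, whereas \<open>g\<close> is supported in degree
      0.\<close>
    moreover have "D j k0 * g j0 = 0"
      using vecsD[OF assms, of j0] h_rel[of j k0] h_rel[OF j0 k0 nz] True k0 hj by (cases "D j k0 = 0") auto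
    ultimately show ?thesis using True by (simp add: proj_def mult.assoc mult.left_commute)
  qed (auto simp: proj_def)
qed

text \<open>Relations on \<open>g\<close> project to relations on \<open>proj g\<close>. Conversely
  they lift, because \<open>g\<close> and \<open>incl (proj g)\<close> differ by a boundary.\<close>

lemma coker_gen_cancel:
  assumes g: "coker_gen S h D I g"
  shows "coker_gen T h E I (proj g)"
proof -
  have gv: "g \<in> vecs {j\<in>S. h j = 0}" using g by (simp add: coker_gen_def)
  then have gS: "g \<in> vecs S" by (auto simp: vecs_def)
  have lin: "proj (\<lambda>j. r * v j) = (\<lambda>j. r * proj v j)" for r v
    by (auto simp: proj_def algebra_simps)
  have lin2: "proj (\<lambda>j. v j + w j) = (\<lambda>j. proj v j + proj w j)" for v w
    by (auto simp: proj_def algebra_simps)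
  have hg: "g = (\<lambda>j. incl (proj g) j + app S D (htpy g) j)"
    by (rule htpy[OF gS cplx_app_bottom[OF cplx gv]])
  have ilin: "incl (\<lambda>j. r * v j) = (\<lambda>j. r * incl v j)" for r v
  proof -
    have "(\<Sum>i\<in>T. D j0 i * (r * v i)) = r * (\<Sum>i\<in>T. D j0 i * v i)"
      unfolding sum_distrib_left by (rule sum.cong) (auto simp: algebra_simps)
    then show ?thesis by (auto simp: incl_def algebra_simps)
  qed
  show ?thesis unfolding coker_gen_def
  proof (intro conjI ballI allI)
    show "proj g \<in> vecs {j\<in>T. h j = 0}" by (rule proj_bottom[OF gv])
  next
    fix w :: "'i \<Rightarrow> 'a" assume w: "w \<in> vecs {j\<in>T. h j = 0}"
    then have "w \<in> vecs {j\<in>S. h j = 0}" by (auto simp: vecs_def)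
    then obtain r u where u: "u \<in> vecs S" "w = (\<lambda>j. r * g j + app S D u j)"
      using g unfolding coker_gen_def by blast
    \<comment> \<open>On \<open>T\<close>, \<open>proj\<close> alters \<open>w\<close> only by
      multiples of \<open>w j0\<close>, so it fixes \<open>w\<close>.\<close>
    have "w j0 = 0" using vecsD[OF w, of j0] by simp
    then have "w = proj w" using w by (auto simp: proj_def vecs_def fun_eq_iff)
    also have "\<dots> = (\<lambda>j. r * proj g j + app T E (proj u) j)"
      by (subst u(2)) (simp add: lin2 lin proj_app)
    finally show "\<exists>r. \<exists>u\<in>vecs T. w = (\<lambda>j. r * proj g j + app T E u j)" using proj_vecs by blast
  next
    fix r
    show "(\<exists>u\<in>vecs T. (\<lambda>j. r * proj g j) = app T E u) \<longleftrightarrow> r \<in> I"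
    proof
      assume "\<exists>u\<in>vecs T. (\<lambda>j. r * proj g j) = app T E u"
      then obtain u where u: "u \<in> vecs T" "(\<lambda>j. r * proj g j) = app T E u" by blast
      have "(\<lambda>j. r * g j) = (\<lambda>j. r * incl (proj g) j + r * app S D (htpy g) j)"
        by (subst hg) (simp add: distrib_left)
      also have "(\<lambda>j. r * incl (proj g) j) = app S D (incl u)" by (simp add: app_incl u(2)[symmetric] ilin)
      then have "(\<lambda>j. r * incl (proj g) j + r * app S D (htpy g) j) = app S D (\<lambda>j. incl u j + r * htpy g j)"
        by (simp add: app_add app_scale fun_eq_iff)
      finally have "(\<lambda>j. r * g j) = app S D (\<lambda>j. incl u j + r * htpy g j)" .
      moreover have "(\<lambda>j. incl u j + r * htpy g j) \<in> vecs S"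
        using incl_vecs[of u] htpy_vecs[of g] by (auto simp: vecs_def)
      ultimately show "r \<in> I" using g unfolding coker_gen_def by blast
    next
      assume "r \<in> I"
      then obtain u where u: "u \<in> vecs S" "(\<lambda>j. r * g j) = app S D u" using g unfolding coker_gen_def by blast
      have "proj (\<lambda>j. r * g j) = proj (app S D u)" using u(2) by simp
      then have "(\<lambda>j. r * proj g j) = app T E (proj u)" by (simp only: lin proj_app)
      then show "\<exists>u\<in>vecs T. (\<lambda>j. r * proj g j) = app T E u" using proj_vecs by blast
    qed
  qed
qed

end

section \<open>Minimal self-dual resolutions\<close>

text \<open>Twists are integers so that the dual complex, with twists \<open>- a\<close>, falls
  under the same notion; a negative difference of twists forces the entry to be 0.\<close>

definition graded :: "'i set \<Rightarrow> ('i \<Rightarrow> int) \<Rightarrow> ('i \<Rightarrow> 'i \<Rightarrow> ('n::finite, 'k::field) mpoly) \<Rightarrow> bool" where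
  "graded S a D \<longleftrightarrow> (\<forall>j\<in>S. \<forall>k\<in>S. \<forall>\<alpha>\<in>keys (D j k). int (mdeg \<alpha>) + a j = a k)"

definition graded_vec :: "'i set \<Rightarrow> ('i \<Rightarrow> int) \<Rightarrow> int \<Rightarrow> ('i \<Rightarrow> ('n::finite, 'k::field) mpoly) \<Rightarrow> bool" where
  "graded_vec S a \<delta> g \<longleftrightarrow> (\<forall>j\<in>S. \<forall>\<alpha>\<in>keys (g j). int (mdeg \<alpha>) + a j = \<delta>)"

definition cyclic_resolution ::
  "'i set \<Rightarrow> ('i \<Rightarrow> int) \<Rightarrow> ('i \<Rightarrow> int) \<Rightarrow> ('i \<Rightarrow> 'i \<Rightarrow> ('n::finite, 'k::field) mpoly) \<Rightarrow> ('n, 'k) mpoly set \<Rightarrow> int \<Rightarrow> bool" where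
  "cyclic_resolution S h a D I \<delta> \<longleftrightarrow> cplx S h D \<and> graded S a D \<and> acyclic_above S h D \<and>
     (\<exists>g. coker_gen S h D I g \<and> graded_vec S a \<delta> g)"

text \<open>In terms of Ext, the second clause says that Ext^n(R/I, R) is R/I generated in degree
  \<open>- N\<close> and that the other Ext modules vanish. In a minimal resolution \<open>N\<close>
  is the twist of the last module.\<close>

definition dual_resolutions ::
  "'i set \<Rightarrow> ('i \<Rightarrow> int) \<Rightarrow> ('i \<Rightarrow> int) \<Rightarrow> ('i \<Rightarrow> 'i \<Rightarrow> ('n::finite, 'k::field) mpoly) \<Rightarrow> ('n, 'k) mpoly set \<Rightarrow> int \<Rightarrow> bool" where
  "dual_resolutions S h a D I N \<longleftrightarrow> cyclic_resolution S h a D I 0 \<and>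
     cyclic_resolution S (\<lambda>j. int CARD('n) - h j) (\<lambda>j. - a j) (\<lambda>j k. D k j) I (- N)"

definition minimal :: "'i set \<Rightarrow> ('i \<Rightarrow> 'i \<Rightarrow> ('n, 'k::zero) mpoly) \<Rightarrow> bool" where
  "minimal S D \<longleftrightarrow> (\<forall>j\<in>S. \<forall>k\<in>S. ccoeff (D j k) = 0)"

lemma keys_diff_cases: "\<alpha> \<in> keys (p - q) \<Longrightarrow> \<alpha> \<in> keys p \<or> \<alpha> \<in> keys (q :: 'a \<Rightarrow>\<^sub>0 'k::ab_group_add)"
  by (auto simp: in_keys_iff lookup_minus)

lemma keys_mult_Const_mult:
  fixes p q :: "('n::finite, 'k::field) mpoly"
  assumes "\<alpha> \<in> keys (p * Const c * q)"
  shows "\<exists>\<beta>\<in>keys p. \<exists>\<gamma>\<in>keys q. \<alpha> = \<beta> + \<gamma>"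
proof -
  have "p * Const c * q = Const c * (p * q)" by (simp add: mult.commute mult.left_commute)
  then have "lookup (p * Const c * q) \<alpha> = c * lookup (p * q) \<alpha>" by (simp only: lookup_Const_mult)
  then have "\<alpha> \<in> keys (p * q)" using assms by (auto simp: in_keys_iff)
  then show ?thesis using keys_mult[of p q] by blast
qed

lemma cyclic_resolution_cancel:
  fixes D :: "'i \<Rightarrow> 'i \<Rightarrow> ('n::finite, 'k::field) mpoly"
  assumes r: "cyclic_resolution S h a D I \<delta>" and jk: "j0 \<in> S" "k0 \<in> S"
    and c: "D j0 k0 = Const c" "c \<noteq> 0"
  shows "cyclic_resolution (S - {j0, k0}) h a (cancel j0 k0 (Const (inverse c)) D) I \<delta>"
proof -
  obtain g where g: "coker_gen S h D I g" "graded_vec S a \<delta> g" using r by (auto simp: cyclic_resolution_def)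
  have gr: "\<And>j k \<alpha>. j \<in> S \<Longrightarrow> k \<in> S \<Longrightarrow> \<alpha> \<in> keys (D j k) \<Longrightarrow> int (mdeg \<alpha>) + a j = a k"
    using r by (auto simp: cyclic_resolution_def graded_def)
  interpret cancellation S h D j0 k0 "Const (inverse c)"
    using r jk c by unfold_locales (auto simp: cyclic_resolution_def Const_mult)
  \<comment> \<open>A nonzero constant entry has equal twists on both sides; this keeps the Schur
    complement homogeneous.\<close>
  have a0: "a j0 = a k0" using gr[OF jk, of 0] c by simp
  have "graded T a E"
    unfolding graded_def
  proof (intro ballI)
    fix j k \<alpha> assume j: "j \<in> T" and k: "k \<in> T" and "\<alpha> \<in> keys (E j k)"
    then have "\<alpha> \<in> keys (D j k) \<or> \<alpha> \<in> keys (D j k0 * Const (inverse c) * D j0 k)"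
      unfolding cancel_def by (intro keys_diff_cases)
    then show "int (mdeg \<alpha>) + a j = a k"
    proof
      assume "\<alpha> \<in> keys (D j k)" then show ?thesis using gr j k by auto
    next
      assume "\<alpha> \<in> keys (D j k0 * Const (inverse c) * D j0 k)"
      then obtain \<beta> \<gamma> where "\<beta> \<in> keys (D j k0)" "\<gamma> \<in> keys (D j0 k)" "\<alpha> = \<beta> + \<gamma>"
        using keys_mult_Const_mult by blast
      then show ?thesis using gr[of j k0 \<beta>] gr[of j0 k \<gamma>] a0 j k jk by auto
    qed
  qed
  moreover have "graded_vec T a \<delta> (proj g)"
    unfolding graded_vec_def
  proof (intro ballI)
    fix j \<alpha> assume j: "j \<in> T" and "\<alpha> \<in> keys (proj g j)"
    then have "\<alpha> \<in> keys (g j) \<or> \<alpha> \<in> keys (D j k0 * Const (inverse c) * g j0)"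
      unfolding proj_def by (intro keys_diff_cases) simp
    then show "int (mdeg \<alpha>) + a j = \<delta>"
    proof
      assume "\<alpha> \<in> keys (g j)" then show ?thesis using g(2) j by (auto simp: graded_vec_def)
    next
      assume "\<alpha> \<in> keys (D j k0 * Const (inverse c) * g j0)"
      then obtain \<beta> \<gamma> where b: "\<beta> \<in> keys (D j k0)" "\<gamma> \<in> keys (g j0)" "\<alpha> = \<beta> + \<gamma>"
        using keys_mult_Const_mult by blast
      then have "int (mdeg \<gamma>) + a j0 = \<delta>" using g(2) jk by (auto simp: graded_vec_def)
      then show ?thesis using gr[of j k0 \<beta>] b a0 j jk by auto
    qed
  qed
  ultimately show ?thesis
    using coker_gen_cancel[OF g(1)] cplx_cancel acyclic_cancel r unfolding cyclic_resolution_def by blast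
qed

text \<open>A homogeneous entry with nonzero constant term is a constant, hence a unit, and can be
  cancelled. On the transpose this is the cancellation with \<open>j0\<close> and \<open>k0\<close>
  exchanged, so both resolutions shrink together, and \<open>card S\<close> drops each time.\<close>

lemma minimal_dual_resolutions:
  fixes D :: "'i \<Rightarrow> 'i \<Rightarrow> ('n::finite, 'k::field) mpoly"
  assumes "dual_resolutions S h a D I N"
  shows "\<exists>S' D'. dual_resolutions S' h a D' I N \<and> minimal S' D'"
  using assms
proof (induction "card S" arbitrary: S D rule: less_induct)
  case less
  show ?case
  proof (cases "minimal S D")
    case False
    then obtain j0 k0 where jk: "j0 \<in> S" "k0 \<in> S" and cc: "ccoeff (D j0 k0) \<noteq> 0" by (auto simp: minimal_def)
    have r: "cyclic_resolution S h a D I 0"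
      "cyclic_resolution S (\<lambda>j. int CARD('n) - h j) (\<lambda>j. - a j) (\<lambda>j k. D k j) I (- N)"
      using less.prems by (auto simp: dual_resolutions_def)
    have gr: "\<alpha> \<in> keys (D j0 k0) \<Longrightarrow> int (mdeg \<alpha>) + a j0 = a k0" for \<alpha>
      using r(1) jk by (auto simp: cyclic_resolution_def graded_def)
    from gr[of 0] cc have "a j0 = a k0" by (auto simp: ccoeff_def in_keys_iff)
    then have "homog 0 (D j0 k0)" using gr by (auto simp: homog_def)
    then have c: "D j0 k0 = Const (ccoeff (D j0 k0))" by (rule homog_0_Const)
    let ?i = "Const (inverse (ccoeff (D j0 k0)))"
    let ?T = "S - {j0, k0}" and ?E = "cancel j0 k0 ?i D"
    have "cyclic_resolution ?T h a ?E I 0" by (rule cyclic_resolution_cancel[OF r(1) jk c cc])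
    moreover have "cyclic_resolution ?T (\<lambda>j. int CARD('n) - h j) (\<lambda>j. - a j) (\<lambda>j k. ?E k j) I (- N)"
      using cyclic_resolution_cancel[OF r(2) jk(2,1) c cc]
      by (simp add: cancel_transpose insert_commute)
    ultimately have "dual_resolutions ?T h a ?E I N" by (simp add: dual_resolutions_def)
    moreover have "finite S" using r(1) by (simp add: cyclic_resolution_def cplx_def)
    then have "card ?T < card S" using jk by (intro psubset_card_mono) auto
    ultimately show ?thesis using less.hyps by blast
  qed (use less.prems in blast)
qed

section \<open>Minimal resolutions: one generator at the bottom, growth of the twists\<close>

locale minimal_resolution =
  fixes S :: "'i set" and h a :: "'i \<Rightarrow> int" and D :: "'i \<Rightarrow> 'i \<Rightarrow> ('n::finite, 'k::field) mpoly"
    and I :: "('n, 'k) mpoly set" and \<delta> :: int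
  assumes res: "cyclic_resolution S h a D I \<delta>" and min: "minimal S D" and proper: "1 \<notin> I"
begin

lemma cx: "cplx S h D" and gr: "graded S a D" and ac: "acyclic_above S h D"
  using res by (auto simp: cyclic_resolution_def)

lemma fin: "finite S" and h_nonneg: "j \<in> S \<Longrightarrow> 0 \<le> h j"
  and h_rel: "j \<in> S \<Longrightarrow> k \<in> S \<Longrightarrow> D j k \<noteq> 0 \<Longrightarrow> h k = h j + 1"
  using cx by (auto simp: cplx_def)

lemma ccoeff_app [simp]: "ccoeff (app S D u j) = 0"
  using min by (simp add: app_def ccoeff_sum minimal_def)

text \<open>A zero column would make the unit vector at \<open>k\<close> a cycle, hence a boundary;
  but boundaries have no constant terms.\<close>

lemma column_nonzero:
  assumes "k \<in> S" "h k \<ge> 1" shows "\<exists>j\<in>S. D j k \<noteq> 0"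
proof (rule ccontr)
  assume 0: "\<not> ?thesis"
  define e where "e = (\<lambda>i. if i = k then 1 else 0 :: ('n, 'k) mpoly)"
  have "e \<in> vecs S" using assms by (auto simp: vecs_def e_def)
  moreover have "app S D e j = 0" for j
  proof (cases "j \<in> S")
    case True
    then show ?thesis using 0 assms fin by (simp add: app_unit e_def)
  qed (simp add: app_def)
  then have "app S D e = (\<lambda>_. 0)" by auto
  moreover have "\<forall>j\<in>S. h j = 0 \<longrightarrow> e j = 0" using assms by (auto simp: e_def)
  ultimately obtain u where "e = app S D u" using ac unfolding acyclic_above_def by blast
  then have "ccoeff (e k) = ccoeff (app S D u k)" by simp
  then show False by (simp add: e_def)
qed

text \<open>All homological degrees share one index set, so a preimage may carry components in
  irrelevant degrees; these are dropped.\<close>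

lemma app_restrict:
  assumes u: "u \<in> vecs S" and w: "app S D u \<in> vecs {j\<in>S. h j = i}"
  shows "\<exists>u'\<in>vecs {k\<in>S. h k = i + 1}. app S D u' = app S D u"
proof (intro bexI ext)
  let ?u = "\<lambda>k. if h k = i + 1 then u k else 0"
  show "?u \<in> vecs {k\<in>S. h k = i + 1}" using u by (auto simp: vecs_def)
  fix j
  show "app S D ?u j = app S D u j"
  proof (cases "j \<in> S \<and> h j = i")
    case True
    have "(\<Sum>k\<in>S. D j k * ?u k) = (\<Sum>k\<in>S. D j k * u k)"
    proof (rule sum.cong)
      fix k assume "k \<in> S"
      then show "D j k * ?u k = D j k * u k" using h_rel[of j k] True by (cases "D j k = 0") auto
    qed simp
    then show ?thesis by (simp add: app_def)
  next
    case False
    then have "app S D u j = 0" using vecsD[OF w, of j] by blast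
    moreover have "app S D ?u j = 0"
    proof (cases "j \<in> S")
      case True
      then have "D j k * ?u k = 0" if "k \<in> S" for k using h_rel[of j k] False that by (cases "D j k = 0") auto
      then show ?thesis by (simp add: app_def)
    qed (simp add: app_def)
    ultimately show ?thesis by simp
  qed
qed

lemma app_degree: "w \<in> vecs {j\<in>S. h j = i} \<Longrightarrow> app S D w \<in> vecs {j\<in>S. h j = i - 1}"
proof -
  assume w: "w \<in> vecs {j\<in>S. h j = i}"
  have "app S D w j = 0" if "\<not> (j \<in> S \<and> h j = i - 1)" for j
  proof (cases "j \<in> S")
    case True
    then have "D j k * w k = 0" if "k \<in> S" for k
      using h_rel[of j k] that \<open>\<not> (j \<in> S \<and> h j = i - 1)\<close> vecsD[OF w, of k] by (cases "D j k = 0") auto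
    then show ?thesis by (simp add: app_def)
  qed (simp add: app_def)
  then show ?thesis by (auto simp: vecs_def)
qed

text \<open>Nakayama's argument: modulo the variables the boundaries vanish, so the residues of
  \<open>g\<close> alone span the part of homological degree 0. Hence there is exactly one index,
  \<open>g\<close> is a nonzero constant there, and after rescaling the relations on
  \<open>g\<close> are the image of the first differential.\<close>

lemma bottom:
  obtains j0 where "{j\<in>S. h j = 0} = {j0}" "a j0 = \<delta>"
    "I = (\<lambda>u. app S D u j0) ` vecs {k\<in>S. h k = 1}"
proof -
  obtain g where g: "coker_gen S h D I g" and gg: "graded_vec S a \<delta> g" using res by (auto simp: cyclic_resolution_def)
  have gv: "g \<in> vecs {j\<in>S. h j = 0}" using g by (simp add: coker_gen_def)
  have gen: "\<exists>r::('n, 'k) mpoly. \<forall>i'. ccoeff r * ccoeff (g i') = (if i' = j then 1 else 0)" if j: "j \<in> S" "h j = 0" for j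
  proof -
    define e where "e = (\<lambda>i. if i = j then 1 else 0 :: ('n, 'k) mpoly)"
    have "e \<in> vecs {j\<in>S. h j = 0}" using j by (auto simp: vecs_def e_def)
    then obtain r u where "e = (\<lambda>i. r * g i + app S D u i)" using g unfolding coker_gen_def by blast
    then have "ccoeff (e i') = ccoeff r * ccoeff (g i')" for i' by simp
    moreover have "ccoeff (e i') = (if i' = j then 1 else 0)" for i' by (simp add: e_def)
    ultimately have e: "ccoeff r * ccoeff (g i') = (if i' = j then 1 else 0)" for i' by metis
    show ?thesis by (intro exI[of _ r] allI e)
  qed
  have "{j\<in>S. h j = 0} \<noteq> {}"
  proof
    assume "{j\<in>S. h j = 0} = {}"
    then have "g = (\<lambda>_. 0)" using gv by (auto simp: vecs_def)
    then have "(\<lambda>j. 1 * g j) = app S D (\<lambda>_. 0)" by simp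
    moreover have "(\<lambda>_. 0) \<in> vecs S" by (simp add: vecs_def)
    ultimately have "1 \<in> I" using g unfolding coker_gen_def by blast
    then show False using proper by simp
  qed
  then obtain j0 where j0: "j0 \<in> S" "h j0 = 0" by blast
  have uniq: "j = j0" if j: "j \<in> S" "h j = 0" for j
  proof (rule ccontr)
    assume ne: "j \<noteq> j0"
    obtain r :: "('n, 'k) mpoly" where "\<forall>i'. ccoeff r * ccoeff (g i') = (if i' = j0 then 1 else 0)" using gen[OF j0] by blast
    then have r: "ccoeff r * ccoeff (g j0) = 1" "ccoeff r * ccoeff (g j) = 0" using ne by simp_all
    obtain r' :: "('n, 'k) mpoly" where "\<forall>i'. ccoeff r' * ccoeff (g i') = (if i' = j then 1 else 0)" using gen[OF j] by blast
    then have r': "ccoeff r' * ccoeff (g j) = 1" by simp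
    from r have "ccoeff (g j) = 0" by auto
    with r' show False by simp
  qed
  have set: "{j\<in>S. h j = 0} = {j0}" using uniq j0 by blast
  obtain r :: "('n, 'k) mpoly" where "\<forall>i'. ccoeff r * ccoeff (g i') = (if i' = j0 then 1 else 0)"
    using gen[OF j0] by blast
  then have r: "ccoeff r * ccoeff (g j0) = 1" by simp
  let ?c = "ccoeff (g j0)"
  have c: "?c \<noteq> 0" using r by auto
  then have "0 \<in> keys (g j0)" by (simp add: ccoeff_def in_keys_iff)
  then have a: "a j0 = \<delta>" using gg j0 by (force simp: graded_vec_def)
  then have "homog 0 (g j0)" using gg j0 by (auto simp: graded_vec_def homog_def)
  then have gc: "g j0 = Const ?c" by (rule homog_0_Const)
  have g0: "g j = 0" if "j \<noteq> j0" for j using gv set that by (auto simp: vecs_def)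
  have I_iff: "p \<in> I \<longleftrightarrow> (\<exists>u\<in>vecs S. (\<lambda>j. p * g j) = app S D u)" for p
    using g unfolding coker_gen_def by blast
  have "I = (\<lambda>u. app S D u j0) ` vecs {k\<in>S. h k = 1}"
  proof (intro equalityI subsetI)
    fix p assume "p \<in> I"
    then obtain u where u: "u \<in> vecs S" "(\<lambda>j. p * g j) = app S D u" using I_iff by blast
    have "app S D u \<in> vecs {j\<in>S. h j = 0}" unfolding u(2)[symmetric] set using g0 by (auto simp: vecs_def)
    then obtain u' where u': "u' \<in> vecs {k\<in>S. h k = 1}" "app S D u' = app S D u"
      using app_restrict[OF u(1), of 0] by auto
    have "p * Const ?c = app S D u' j0" using u(2) u'(2) gc by metis
    then have "app S D (\<lambda>k. Const (inverse ?c) * u' k) j0 = Const (inverse ?c) * (p * Const ?c)"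
      by (simp add: app_scale)
    also have "\<dots> = Const (inverse ?c) * Const ?c * p" by (simp add: mult.commute mult.left_commute)
    also have "\<dots> = p" using c by (simp add: Const_mult)
    finally have "p = app S D (\<lambda>k. Const (inverse ?c) * u' k) j0" by simp
    moreover have "(\<lambda>k. Const (inverse ?c) * u' k) \<in> vecs {k\<in>S. h k = 1}"
      using u'(1) by (auto simp: vecs_def)
    ultimately show "p \<in> (\<lambda>u. app S D u j0) ` vecs {k\<in>S. h k = 1}" by blast
  next
    fix p assume "p \<in> (\<lambda>u. app S D u j0) ` vecs {k\<in>S. h k = 1}"
    then obtain u where u: "u \<in> vecs {k\<in>S. h k = 1}" "p = app S D u j0" by blast
    have "app S D u \<in> vecs {j\<in>S. h j = 0}" using app_degree[OF u(1)] by simp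
    then have 0: "app S D u j = 0" if "j \<noteq> j0" for j using that set by (auto simp: vecs_def)
    have "(\<lambda>j. p * g j) = app S D (\<lambda>k. Const ?c * u k)"
    proof
      fix j show "p * g j = app S D (\<lambda>k. Const ?c * u k) j"
        by (cases "j = j0") (use u(2) gc g0 0 in \<open>auto simp: app_scale mult.commute\<close>)
    qed
    moreover have "(\<lambda>k. Const ?c * u k) \<in> vecs S" using u(1) by (auto simp: vecs_def)
    ultimately show "p \<in> I" using I_iff by blast
  qed
  then show thesis using that[OF set a] by blast
qed

text \<open>Follow nonzero entries down to the bottom. An entry of the first differential lies in
  \<open>I\<close> and so has degree at least t + 1; each later entry has degree at least 1 by
  minimality.\<close>

lemma degree_lower_bound:
  assumes t: "\<And>p \<alpha>. p \<in> I \<Longrightarrow> \<alpha> \<in> keys p \<Longrightarrow> t < mdeg \<alpha>"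
    and k: "k \<in> S" "h k \<ge> 1"
  shows "a k \<ge> \<delta> + int t + h k"
  using k
proof (induction "nat (h k)" arbitrary: k rule: less_induct)
  case (less k)
  obtain j where j: "j \<in> S" "D j k \<noteq> 0" using column_nonzero less.prems by blast
  then have hj: "h k = h j + 1" using h_rel less.prems by blast
  obtain \<alpha> where \<alpha>: "\<alpha> \<in> keys (D j k)" using j(2) by (metis ex_in_conv keys_eq_empty)
  then have eq: "int (mdeg \<alpha>) + a j = a k" using gr j less.prems unfolding graded_def by blast
  show ?case
  proof (cases "h j = 0")
    case True
    obtain j0 where j0: "{j\<in>S. h j = 0} = {j0}" "a j0 = \<delta>"
      "I = (\<lambda>u. app S D u j0) ` vecs {k\<in>S. h k = 1}" using bottom .
    then have "j = j0" using True j by blast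
    \<comment> \<open>The entry is the image of a unit vector under the first differential, hence an
      element of \<open>I\<close>.\<close>
    define e where "e = (\<lambda>i. if i = k then 1 else 0 :: ('n, 'k) mpoly)"
    have "e \<in> vecs {k\<in>S. h k = 1}" using less.prems hj True by (auto simp: vecs_def e_def)
    moreover have "app S D e j = D j k" using less.prems fin j by (simp add: app_unit e_def)
    ultimately have "D j k \<in> I" unfolding j0(3) \<open>j = j0\<close>[symmetric] by (intro image_eqI[of _ _ e]) auto
    then have "t < mdeg \<alpha>" using t \<alpha> by blast
    then show ?thesis using eq hj True j0(2) \<open>j = j0\<close> by simp
  next
    case False
    then have "h j \<ge> 1" using h_nonneg[OF j(1)] by simp
    then have "a j \<ge> \<delta> + int t + h j" using less.hyps[of j] j hj by simp
    moreover have "\<alpha> \<noteq> 0" using \<alpha> min j less.prems by (auto simp: minimal_def ccoeff_def in_keys_iff)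
    then have "mdeg \<alpha> \<ge> 1" using mdeg_eq_0_iff[of \<alpha>] by simp
    ultimately show ?thesis using eq hj by simp
  qed
qed

end

text \<open>A change of format. For each homological degree \<open>i\<close>, \<open>en i\<close>
  enumerates the indices of that degree, and \<open>up i\<close>, \<open>down i\<close> carry
  vectors between the two descriptions, under which \<open>M i\<close> becomes the restriction of
  \<open>D\<close>.\<close>

lemma linear_resolution_from_graded:
  fixes D :: "'i \<Rightarrow> 'i \<Rightarrow> ('n::finite, 'k::field) mpoly"
  assumes mr: "minimal_resolution S h a D I 0"
    and n2: "CARD('n) \<ge> 2"
    and top: "{k\<in>S. h k = int CARD('n)} = {k1}"
    and le: "\<And>k. k \<in> S \<Longrightarrow> h k \<le> int CARD('n)"
    and shift: "\<And>k. k \<in> S \<Longrightarrow> a k = int (res_shift (CARD('n)) d (nat (h k)))"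
  shows "linear_gorenstein_resolution I d"
proof -
  interpret minimal_resolution S h a D I 0 by (rule mr)
  let ?n = "CARD('n)"
  define L where "L i = {k\<in>S. h k = int i}" for i
  have finL: "finite (L i)" for i using fin by (simp add: L_def)
  define b where "b i = card (L i)" for i
  have "\<exists>e. bij_betw e {..<b i} (L i)" for i
    using ex_bij_betw_nat_finite[OF finL[of i]] by (simp add: b_def atLeast0LessThan)
  then obtain en where en: "\<And>i. bij_betw (en i) {..<b i} (L i)" by metis
  obtain j0 where j0: "L 0 = {j0}" "a j0 = 0" "I = (\<lambda>u. app S D u j0) ` vecs {k\<in>S. h k = 1}"
    using bottom by (auto simp: L_def)
  define up where "up i v = (\<lambda>k. if k \<in> L i then v (inv_into {..<b i} (en i) k) else 0)"
    for i and v :: "nat \<Rightarrow> ('n, 'k) mpoly"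
  define down where "down i w = (\<lambda>k. if k < b i then w (en i k) else 0)"
    for i and w :: "'i \<Rightarrow> ('n, 'k) mpoly"
  define M where "M i j k = D (en (i - 1) j) (en i k)" for i j k
  have enL: "k < b i \<Longrightarrow> en i k \<in> L i" for i k using en[of i] by (auto simp: bij_betw_def)
  have up_en: "k < b i \<Longrightarrow> up i v (en i k) = v k" for i k v
    using en[of i] enL[of k i] by (simp add: up_def bij_betw_inv_into_left)
  have upL: "up i v \<in> vecs (L i)" for i v by (auto simp: up_def vecs_def)
  have downF: "down i w \<in> fvecs (b i)" for i w by (auto simp: down_def fvecs_def)
  have down_up: "v \<in> fvecs (b i) \<Longrightarrow> down i (up i v) = v" for i v
    by (auto simp: down_def up_en fvecs_def fun_eq_iff)
  have up_down: "up i (down i w) = w" if w: "w \<in> vecs (L i)" for i w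
  proof
    fix k
    show "up i (down i w) k = w k"
    proof (cases "k \<in> L i")
      case True
      then obtain x where "x < b i" "k = en i x" using en[of i] by (auto simp: bij_betw_def)
      then show ?thesis by (simp add: up_en down_def)
    qed (use w in \<open>auto simp: up_def vecs_def\<close>)
  qed
  have LS: "L i \<subseteq> S" for i by (auto simp: L_def)
  have vS: "w \<in> vecs (L i) \<Longrightarrow> w \<in> vecs S" for w i using LS[of i] by (auto simp: vecs_def)
  have mat: "matvec (M i) (b (i - 1)) (b i) v = down (i - 1) (app S D (up i v))" for i v
  proof
    fix j
    show "matvec (M i) (b (i - 1)) (b i) v j = down (i - 1) (app S D (up i v)) j"
    proof (cases "j < b (i - 1)")
      case True
      let ?j = "en (i - 1) j"
      have "?j \<in> S" using enL[OF True] LS by blast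
      then have "app S D (up i v) ?j = (\<Sum>k\<in>S. D ?j k * up i v k)" by (simp add: app_def)
      also have "\<dots> = (\<Sum>k\<in>L i. D ?j k * up i v k)"
        by (rule sum.mono_neutral_right) (use fin LS in \<open>auto simp: up_def\<close>)
      also have "\<dots> = (\<Sum>k<b i. D ?j (en i k) * up i v (en i k))"
        by (rule sum.reindex_bij_betw[OF en, symmetric])
      also have "\<dots> = (\<Sum>k<b i. M i j k * v k)"
        by (rule sum.cong) (auto simp: up_en M_def)
      finally show ?thesis using True by (simp add: matvec_def down_def)
    qed (simp add: matvec_def down_def)
  qed
  have down0: "down i w = (\<lambda>_. 0) \<longleftrightarrow> w = (\<lambda>_. 0)" if "w \<in> vecs (L i)" for i w
  proof
    assume "down i w = (\<lambda>_. 0)"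
    then have "w = up i (\<lambda>_. 0)" using up_down[OF that] by simp
    then show "w = (\<lambda>_. 0)" by (auto simp: up_def)
  qed (auto simp: down_def)
  have appL: "app S D w \<in> vecs (L (i - 1))" if "i \<ge> 1" "w \<in> vecs (L i)" for i w
    using app_degree[of w "int i"] that by (simp add: L_def of_nat_diff)
  have mat0: "matvec (M i) (b (i - 1)) (b i) v = (\<lambda>_. 0) \<longleftrightarrow> app S D (up i v) = (\<lambda>_. 0)" if "i \<ge> 1" for i v
    unfolding mat by (rule down0[OF appL[OF that upL]])
  have exact: "\<exists>u\<in>vecs (L (i + 1)). w = app S D u"
    if "i \<ge> 1" and w: "w \<in> vecs (L i)" and 0: "app S D w = (\<lambda>_. 0)" for i w
  proof -
    have "\<forall>j\<in>S. h j = 0 \<longrightarrow> w j = 0" using w that(1) by (auto simp: vecs_def L_def)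
    then obtain u where u: "u \<in> vecs S" "w = app S D u"
      using ac vS[OF w] 0 unfolding acyclic_above_def by blast
    then obtain u' where "u' \<in> vecs {k\<in>S. h k = int i + 1}" "app S D u' = app S D u"
      using app_restrict[OF u(1), of "int i"] w by (auto simp: L_def)
    then show ?thesis using u(2) by (intro bexI[of _ u']) (auto simp: L_def add.commute)
  qed
  have b0: "b 0 = 1" by (simp add: b_def j0)
  have en0: "en 0 0 = j0" using enL[of 0 0] b0 j0 by simp
  have bn: "b ?n = 1" using top by (simp add: b_def L_def)
  show ?thesis unfolding linear_gorenstein_resolution_def Let_def
  proof (rule exI[of _ b], rule exI[of _ M], intro conjI ballI allI impI)
    show "b 0 = 1" by (rule b0)
    show "b ?n = 1" by (rule bn)
  next
    fix i j k assume i: "i \<in> {1..?n}" and j: "j < b (i - 1)" and k: "k < b i"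
    have jj: "en (i - 1) j \<in> S" "h (en (i - 1) j) = int (i - 1)" using enL[OF j] by (auto simp: L_def)
    have kk: "en i k \<in> S" "h (en i k) = int i" using enL[OF k] by (auto simp: L_def)
    show "homog (res_shift ?n d i - res_shift ?n d (i - 1)) (M i j k)"
      unfolding homog_def
    proof
      fix \<alpha> assume "\<alpha> \<in> keys (M i j k)"
      then have "int (mdeg \<alpha>) + a (en (i - 1) j) = a (en i k)"
        using gr jj kk by (auto simp: graded_def M_def)
      then show "mdeg \<alpha> = res_shift ?n d i - res_shift ?n d (i - 1)"
        using shift[OF jj(1)] shift[OF kk(1)] jj(2) kk(2) by simp
    qed
  next
    have "(\<lambda>v. matvec (M 1) 1 (b 1) v 0) ` fvecs (b 1) = (\<lambda>u. app S D u j0) ` vecs (L 1)"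
    proof (intro equalityI subsetI)
      fix p assume "p \<in> (\<lambda>v. matvec (M 1) 1 (b 1) v 0) ` fvecs (b 1)"
      then obtain v where "p = matvec (M 1) 1 (b 1) v 0" by blast
      then have "p = app S D (up 1 v) j0" using mat[of 1 v] b0 en0 by (simp add: down_def)
      then show "p \<in> (\<lambda>u. app S D u j0) ` vecs (L 1)" using upL by blast
    next
      fix p assume "p \<in> (\<lambda>u. app S D u j0) ` vecs (L 1)"
      then obtain u where u: "u \<in> vecs (L 1)" "p = app S D u j0" by blast
      then have "p = matvec (M 1) 1 (b 1) (down 1 u) 0"
        using mat[of 1 "down 1 u"] b0 en0 up_down[OF u(1)] by (simp add: down_def)
      then show "p \<in> (\<lambda>v. matvec (M 1) 1 (b 1) v 0) ` fvecs (b 1)" using downF by blast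
    qed
    then show "(\<lambda>v. matvec (M 1) 1 (b 1) v 0) ` fvecs (b 1) = I" using j0(3) by (simp add: L_def)
  next
    fix i assume "i \<in> {1..<?n}"
    then have i: "i \<ge> 1" by simp
    show "{v \<in> fvecs (b i). matvec (M i) (b (i - 1)) (b i) v = (\<lambda>_. 0)} = matvec (M (i + 1)) (b i) (b (i + 1)) ` fvecs (b (i + 1))"
    proof (intro equalityI subsetI)
      fix v assume "v \<in> {v \<in> fvecs (b i). matvec (M i) (b (i - 1)) (b i) v = (\<lambda>_. 0)}"
      then have v: "v \<in> fvecs (b i)" "app S D (up i v) = (\<lambda>_. 0)" using mat0[OF i] by auto
      obtain u where u: "u \<in> vecs (L (i + 1))" "up i v = app S D u" using exact[OF i upL v(2)] by blast
      have "v = down i (app S D (up (i + 1) (down (i + 1) u)))"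
        using down_up[OF v(1)] u by (simp add: up_down)
      then have "v = matvec (M (i + 1)) (b i) (b (i + 1)) (down (i + 1) u)" using mat[of "i + 1"] by simp
      then show "v \<in> matvec (M (i + 1)) (b i) (b (i + 1)) ` fvecs (b (i + 1))" using downF by blast
    next
      fix v assume "v \<in> matvec (M (i + 1)) (b i) (b (i + 1)) ` fvecs (b (i + 1))"
      then obtain u where u: "v = down i (app S D (up (i + 1) u))" using mat[of "i + 1"] by auto
      have "app S D (up (i + 1) u) \<in> vecs (L i)" using appL[of "i + 1"] upL[of "i + 1"] by simp
      then have "up i v = app S D (up (i + 1) u)" using up_down u by simp
      then have "app S D (up i v) = (\<lambda>_. 0)" using cplx_app_app[OF cx vS[OF upL]] by simp
      then show "v \<in> {v \<in> fvecs (b i). matvec (M i) (b (i - 1)) (b i) v = (\<lambda>_. 0)}"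
        using mat0[OF i] u downF by auto
    qed
  next
    fix v assume v: "v \<in> fvecs (b ?n)" "matvec (M ?n) (b (?n - 1)) (b ?n) v = (\<lambda>_. 0)"
    then have "app S D (up ?n v) = (\<lambda>_. 0)" using mat0[of ?n] n2 by simp
    then obtain u where u: "u \<in> vecs (L (?n + 1))" "up ?n v = app S D u"
      using exact[of ?n, OF _ upL] n2 by auto
    \<comment> \<open>Nothing maps into the last module, so exactness there is injectivity.\<close>
    have "L (?n + 1) = {}" using le by (force simp: L_def)
    then have "u = (\<lambda>_. 0)" using u(1) by (auto simp: vecs_def)
    then have "up ?n v = (\<lambda>_. 0)" using u(2) by simp
    then have "down ?n (up ?n v) = (\<lambda>_. 0)" by (simp add: down_def)
    then show "v = (\<lambda>_. 0)" using down_up[OF v(1)] by simp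
  qed
qed

lemma linear_resolution_of_dual_resolutions:
  fixes D :: "'i \<Rightarrow> 'i \<Rightarrow> ('n::finite, 'k::field) mpoly"
  assumes dr: "dual_resolutions S h a D I (2 * int t + int CARD('n))"
    and n2: "CARD('n) \<ge> 2" and proper: "1 \<notin> I"
    and t: "\<And>p \<alpha>. p \<in> I \<Longrightarrow> \<alpha> \<in> keys p \<Longrightarrow> t < mdeg \<alpha>"
  shows "linear_gorenstein_resolution I (t + 1)"
proof -
  let ?n = "CARD('n)"
  obtain T E where dr': "dual_resolutions T h a E I (2 * int t + int ?n)" and min: "minimal T E"
    using minimal_dual_resolutions[OF dr] by blast
  interpret F: minimal_resolution T h a E I 0
    using dr' min proper by unfold_locales (auto simp: dual_resolutions_def)
  interpret G: minimal_resolution T "\<lambda>j. int ?n - h j" "\<lambda>j. - a j" "\<lambda>j k. E k j" I "- (2 * int t + int ?n)"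
    using dr' min proper by unfold_locales (auto simp: dual_resolutions_def minimal_def)
  obtain j0 where j0: "{j\<in>T. h j = 0} = {j0}" "a j0 = 0" using F.bottom by metis
  obtain k1 where k1: "{j\<in>T. int ?n - h j = 0} = {k1}" "- a k1 = - (2 * int t + int ?n)" using G.bottom by metis
  have le: "k \<in> T \<Longrightarrow> h k \<le> int ?n" for k using G.h_nonneg[of k] by simp
  show ?thesis
  proof (rule linear_resolution_from_graded[OF F.minimal_resolution_axioms n2 _ le])
    show "{k\<in>T. h k = int ?n} = {k1}" unfolding k1(1)[symmetric] by (rule Collect_cong) linarith
    fix k assume k: "k \<in> T"
    consider "h k = 0" | "h k = int ?n" | "1 \<le> h k" "h k < int ?n"
      using F.h_nonneg[OF k] le[OF k] by force
    then show "a k = int (res_shift ?n (t + 1) (nat (h k)))"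
    proof cases
      case 1
      then have "k = j0" using j0 k by blast
      then show ?thesis using 1 j0(2) by (simp add: res_shift_def)
    next
      case 2
      then have "k \<in> {j\<in>T. int ?n - h j = 0}" using k by simp
      then have "k = k1" unfolding k1(1) by simp
      \<comment> \<open>For d = t + 1 the last shift 2d + n - 2 equals 2t + n, the twist at
        \<open>k1\<close>.\<close>
      then show ?thesis using 2 k1(2) n2 by (simp add: res_shift_def)
    next
      case 3
      have "a k \<ge> int t + h k" using F.degree_lower_bound[OF t k] 3 by simp
      \<comment> \<open>Seen from the other end, \<open>k\<close> has homological degree n -
        \<open>h k\<close>; the bound amounts to \<open>a k \<le> t + h k\<close>.\<close>
      moreover have "- a k \<ge> - (2 * int t + int ?n) + int t + (int ?n - h k)"
        using G.degree_lower_bound[OF t k] 3 by simp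
      ultimately have "a k = int t + h k" by simp
      then show ?thesis using 3 by (auto simp: res_shift_def)
    qed
  qed
qed

section \<open>Koszul complexes of commuting operators\<close>

definition sgn_if :: "bool \<Rightarrow> 'a::group_add \<Rightarrow> 'a" where
  "sgn_if e x = (if e then x else - x)"

text \<open>The arguments are the parts of a chain on the subsets without and with the first
  operator, the two summands of the mapping cone. The value 0 at the empty list keeps chains
  supported on lists of full length.\<close>

definition join :: "(bool list \<Rightarrow> 'm) \<Rightarrow> (bool list \<Rightarrow> 'm) \<Rightarrow> bool list \<Rightarrow> 'm::zero" where
  "join a b = (\<lambda>bs. case bs of [] \<Rightarrow> 0 | x # xs \<Rightarrow> if x then b xs else a xs)"

definition lo :: "(bool list \<Rightarrow> 'm) \<Rightarrow> bool list \<Rightarrow> 'm" where "lo u = (\<lambda>xs. u (False # xs))"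
definition hi :: "(bool list \<Rightarrow> 'm) \<Rightarrow> bool list \<Rightarrow> 'm" where "hi u = (\<lambda>xs. u (True # xs))"

lemma lo_hi_join [simp]: "lo (join a b) = a" "hi (join a b) = b"
  by (auto simp: lo_def hi_def join_def)

lemma join_lo_hi: "u [] = 0 \<Longrightarrow> join (lo u) (hi u) = u"
  by (auto simp: lo_def hi_def join_def fun_eq_iff split: list.splits)

lemma lo_hi_add [simp]: "lo (u + w) = lo u + lo w" "hi (u + w) = hi u + hi w"
  by (auto simp: lo_def hi_def fun_eq_iff)

lemma lo_hi_uminus [simp]: "lo (- u) = - lo u" "hi (- u) = - hi (u :: _ \<Rightarrow> 'm::ab_group_add)"
  by (auto simp: lo_def hi_def fun_eq_iff)

lemma lo_hi_0 [simp]: "lo 0 = 0" "hi 0 = 0"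
  by (auto simp: lo_def hi_def fun_eq_iff)

lemma join_add: "join (a + c) (b + d) = join a b + (join c d :: _ \<Rightarrow> 'm::ab_group_add)"
  by (auto simp: join_def fun_eq_iff split: list.splits)

lemma join_uminus: "join (- a) (- b) = - (join a b :: _ \<Rightarrow> 'm::ab_group_add)"
  by (auto simp: join_def fun_eq_iff split: list.splits)

lemma join_0 [simp]: "join 0 0 = 0"
  by (auto simp: join_def fun_eq_iff split: list.splits)

lemma join_const_0 [simp]: "join (\<lambda>_. 0) (\<lambda>_. 0) = (\<lambda>_. 0)"
  using join_0 by (simp add: zero_fun_def)

lemma join_eq_0_iff: "join a b = 0 \<longleftrightarrow> a = 0 \<and> b = 0"
  by (metis lo_hi_join lo_hi_0 join_0)

lemma sgn_if_simps [simp]: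
  "sgn_if e 0 = 0" "sgn_if e (sgn_if e x) = x" "sgn_if (\<not> e) x = - sgn_if e x" "sgn_if e x = 0 \<longleftrightarrow> x = 0"
  "sgn_if e (x + y) = sgn_if e x + sgn_if e y" "sgn_if e (- x) = - sgn_if e (x :: 'a::ab_group_add)"
  by (auto simp: sgn_if_def)

abbreviation bottom_idx :: "'v list \<Rightarrow> bool list" where
  "bottom_idx vs \<equiv> replicate (length vs) False"

text \<open>A chain carried by the empty subset, that is, in homological degree 0.\<close>

definition at_bottom :: "'v list \<Rightarrow> 'm \<Rightarrow> bool list \<Rightarrow> 'm::zero" where
  "at_bottom vs x = (\<lambda>bs. if bs = bottom_idx vs then x else 0)"

lemma at_bottom_Cons: "at_bottom (v # vs) x = join (at_bottom vs x) 0"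
  by (auto simp: at_bottom_def join_def fun_eq_iff split: list.splits)

locale commuting_operators =
  fixes M :: "'m::ab_group_add set" and \<phi> :: "'v \<Rightarrow> 'm \<Rightarrow> 'm"
  assumes M_0: "0 \<in> M" and M_add: "x \<in> M \<Longrightarrow> y \<in> M \<Longrightarrow> x + y \<in> M"
    and M_uminus: "x \<in> M \<Longrightarrow> - x \<in> M" and M_phi: "x \<in> M \<Longrightarrow> \<phi> v x \<in> M"
    and phi_add: "\<phi> v (x + y) = \<phi> v x + \<phi> v y"
    and phi_comm: "x \<in> M \<Longrightarrow> \<phi> v (\<phi> w x) = \<phi> w (\<phi> v x)"
begin

lemma phi_0 [simp]: "\<phi> v 0 = 0"
  using phi_add[of v 0 0] by simp

lemma phi_uminus: "\<phi> v (- x) = - \<phi> v x"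
  using phi_add[of v x "- x"] by (simp add: eq_neg_iff_add_eq_0 add.commute)

lemma M_diff: "x \<in> M \<Longrightarrow> y \<in> M \<Longrightarrow> x - y \<in> M"
  using M_add[of x "- y"] M_uminus by simp

definition phis :: "'v \<Rightarrow> (bool list \<Rightarrow> 'm) \<Rightarrow> bool list \<Rightarrow> 'm" where
  "phis v u = (\<lambda>bs. \<phi> v (u bs))"

lemma phis_add: "phis v (u + w) = phis v u + phis v w"
  by (auto simp: fun_eq_iff phis_def phi_add)

lemma phis_uminus: "phis v (- u) = - phis v u"
  by (auto simp: fun_eq_iff phis_def phi_uminus)

lemma phis_sgn_if: "phis v (sgn_if e u) = sgn_if e (phis v u)"
  by (cases e) (auto simp: sgn_if_def phis_uminus)

lemma lo_hi_phis [simp]: "lo (phis v u) = phis v (lo u)" "hi (phis v u) = phis v (hi u)"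
  by (auto simp: lo_def hi_def phis_def)

lemma phis_0 [simp]: "phis v 0 = 0"
  by (auto simp: phis_def fun_eq_iff)

lemma phis_join: "phis v (join a b) = join (phis v a) (phis v b)"
  by (auto simp: join_def phis_def fun_eq_iff split: list.splits)

text \<open>A list of n operators gives the Koszul complex as an n-fold iterated mapping cone; a
  subset of the operators is encoded by a boolean list. The flag \<open>e\<close> chooses between two sign
  conventions, which are exchanged by transposition.\<close>

primrec kd :: "bool \<Rightarrow> 'v list \<Rightarrow> (bool list \<Rightarrow> 'm) \<Rightarrow> bool list \<Rightarrow> 'm" where
  "kd e [] u = 0"
| "kd e (v # vs) u = join (sgn_if e (kd e vs (lo u)) + phis v (hi u)) (sgn_if (\<not> e) (kd e vs (hi u)))"

definition chains :: "'v list \<Rightarrow> (bool list \<Rightarrow> 'm) set" where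
  "chains vs = {u. (\<forall>bs. u bs \<in> M) \<and> (\<forall>bs. length bs \<noteq> length vs \<longrightarrow> u bs = 0)}"

text \<open>\<open>M\<close> modulo this sum of images is the homology of the Koszul complex in
  degree 0.\<close>

primrec imgs :: "'v list \<Rightarrow> 'm set" where
  "imgs [] = {0}"
| "imgs (v # vs) = {\<phi> v x + y | x y. x \<in> M \<and> y \<in> imgs vs}"

text \<open>A regular sequence read from the end of the list: each operator is injective modulo the
  images of those after it.\<close>

primrec regular :: "'v list \<Rightarrow> bool" where
  "regular [] = True"
| "regular (v # vs) = (regular vs \<and> (\<forall>x\<in>M. \<phi> v x \<in> imgs vs \<longrightarrow> x \<in> imgs vs))"

lemma kd_add: "kd e vs (u + w) = kd e vs u + kd e vs w"
  by (induction vs arbitrary: u w) (simp_all add: phis_add join_add[symmetric] algebra_simps)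

lemma kd_uminus: "kd e vs (- u) = - kd e vs u"
  by (induction vs arbitrary: u) (simp_all add: phis_uminus join_uminus[symmetric] algebra_simps)

lemma kd_sgn_if: "kd e vs (sgn_if e' u) = sgn_if e' (kd e vs u)"
  by (cases e') (auto simp: sgn_if_def kd_uminus)

lemma kd_0 [simp]: "kd e vs 0 = 0"
  using kd_add[of e vs 0 0] by simp

lemma kd_diff: "kd e vs (u - w) = kd e vs u - kd e vs w"
  using kd_add[of e vs u "- w"] by (simp add: kd_uminus)

lemma chains_join: "join a b \<in> chains (v # vs) \<longleftrightarrow> a \<in> chains vs \<and> b \<in> chains vs"
proof
  assume *: "join a b \<in> chains (v # vs)"
  have 0: "join a b (False # xs) = a xs" "join a b (True # xs) = b xs" for xs by (auto simp: join_def)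
  have 1: "join a b bs \<in> M" "length bs \<noteq> Suc (length vs) \<Longrightarrow> join a b bs = 0" for bs
    using * by (simp_all add: chains_def)
  show "a \<in> chains vs \<and> b \<in> chains vs"
    unfolding chains_def using 1[of "False # _"] 1[of "True # _"] by (simp add: 0)
next
  assume "a \<in> chains vs \<and> b \<in> chains vs"
  then show "join a b \<in> chains (v # vs)" by (auto simp: chains_def join_def M_0 split: list.splits)
qed

lemma chains_ConsD:
  assumes "u \<in> chains (v # vs)"
  shows "lo u \<in> chains vs" "hi u \<in> chains vs" "u = join (lo u) (hi u)"
proof -
  have "u [] = 0" using assms by (auto simp: chains_def)
  then show 1: "u = join (lo u) (hi u)" by (simp add: join_lo_hi)
  then show "lo u \<in> chains vs" "hi u \<in> chains vs" using assms chains_join by metis+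
qed

lemma chains_add: "u \<in> chains vs \<Longrightarrow> w \<in> chains vs \<Longrightarrow> u + w \<in> chains vs"
  by (auto simp: chains_def M_add)

lemma chains_uminus: "u \<in> chains vs \<Longrightarrow> - u \<in> chains vs"
  by (auto simp: chains_def M_uminus)

lemma chains_diff: "u \<in> chains vs \<Longrightarrow> w \<in> chains vs \<Longrightarrow> u - w \<in> chains vs"
  by (auto simp: chains_def M_diff)

lemma chains_0: "0 \<in> chains vs" by (auto simp: chains_def M_0)

lemma chains_sgn_if: "u \<in> chains vs \<Longrightarrow> sgn_if e u \<in> chains vs"
  by (auto simp: sgn_if_def chains_uminus)

lemma chains_phis: "u \<in> chains vs \<Longrightarrow> phis v u \<in> chains vs"
  by (auto simp: chains_def phis_def M_phi)

lemma chains_at_bottom: "x \<in> M \<Longrightarrow> at_bottom vs x \<in> chains vs"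
  by (auto simp: chains_def at_bottom_def M_0)

lemma kd_chains: "u \<in> chains vs \<Longrightarrow> kd e vs u \<in> chains vs"
  by (induction vs arbitrary: u)
    (simp_all add: chains_0 chains_join chains_add chains_uminus chains_sgn_if chains_phis chains_ConsD)

lemma kd_phis: "u \<in> chains vs \<Longrightarrow> kd e vs (phis w u) = phis w (kd e vs u)"
proof (induction vs arbitrary: u)
  case (Cons v vs)
  have u: "lo u \<in> chains vs" "hi u \<in> chains vs" using chains_ConsD[OF Cons.prems] by auto
  have "phis v (phis w (hi u)) = phis w (phis v (hi u))"
    unfolding phis_def using u(2) by (intro ext phi_comm) (auto simp: chains_def)
  then show ?case
    by (simp add: Cons.IH[OF u(1)] Cons.IH[OF u(2)] phis_join phis_add phis_sgn_if phis_uminus)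
qed simp

lemma kd_kd: "u \<in> chains vs \<Longrightarrow> kd e vs (kd e vs u) = 0"
proof (induction vs arbitrary: u)
  case (Cons v vs)
  have u: "lo u \<in> chains vs" "hi u \<in> chains vs" using chains_ConsD[OF Cons.prems] by auto
  show ?case
    by (simp add: kd_add kd_sgn_if kd_uminus Cons.IH[OF u(1)] Cons.IH[OF u(2)] kd_phis[OF u(2)]
        phis_sgn_if phis_uminus)
qed simp

lemma kd_at_bottom: "kd e vs (at_bottom vs x) = 0"
proof (induction vs)
  case (Cons v vs)
  then show ?case
    by (simp only: kd.simps at_bottom_Cons lo_hi_join phis_0 sgn_if_simps add_0 join_0 kd_0 minus_zero)
qed simp

lemma imgs_ConsI: "x \<in> M \<Longrightarrow> y \<in> imgs vs \<Longrightarrow> \<phi> v x + y \<in> imgs (v # vs)"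
  by auto

lemma imgs_add: "x \<in> imgs vs \<Longrightarrow> y \<in> imgs vs \<Longrightarrow> x + y \<in> imgs vs"
proof (induction vs arbitrary: x y)
  case (Cons v vs)
  then obtain a b c d where 1: "x = \<phi> v a + b" "a \<in> M" "b \<in> imgs vs" "y = \<phi> v c + d" "c \<in> M" "d \<in> imgs vs"
    by auto
  then have "x + y = \<phi> v (a + c) + (b + d)" by (simp add: phi_add algebra_simps)
  then show ?case using 1 Cons.IH[of b d] M_add[of a c] imgs_ConsI[of "a + c" "b + d" vs v] by (metis (no_types))
qed simp

lemma imgs_uminus: "x \<in> imgs vs \<Longrightarrow> - x \<in> imgs vs"
proof (induction vs arbitrary: x)
  case (Cons v vs)
  then obtain a b where 1: "x = \<phi> v a + b" "a \<in> M" "b \<in> imgs vs" by auto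
  then have "- x = \<phi> v (- a) + (- b)" by (simp add: phi_uminus)
  then show ?case using 1 Cons.IH[of b] M_uminus[of a] imgs_ConsI[of "- a" "- b" vs v] by (metis (no_types))
qed simp

lemma imgs_phi: "x \<in> imgs vs \<Longrightarrow> \<phi> w x \<in> imgs vs"
proof (induction vs arbitrary: x)
  case (Cons v vs)
  then obtain a b where 1: "x = \<phi> v a + b" "a \<in> M" "b \<in> imgs vs" by auto
  then have "\<phi> w x = \<phi> v (\<phi> w a) + \<phi> w b" by (simp add: phi_add phi_comm)
  then show ?case using 1 Cons.IH[of b] M_phi[of a] imgs_ConsI[of "\<phi> w a" "\<phi> w b" vs v] by (metis (no_types))
qed simp

lemma kd_bottom_in_imgs: "u \<in> chains vs \<Longrightarrow> kd e vs u (bottom_idx vs) \<in> imgs vs"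
proof (induction vs arbitrary: u)
  case (Cons v vs)
  have u: "lo u \<in> chains vs" "hi u \<in> chains vs" using chains_ConsD[OF Cons.prems] by auto
  have "kd e (v # vs) u (bottom_idx (v # vs))
      = \<phi> v (hi u (bottom_idx vs)) + sgn_if e (kd e vs (lo u) (bottom_idx vs))"
    by (simp add: join_def sgn_if_def phis_def add.commute)
  moreover have "sgn_if e (kd e vs (lo u) (bottom_idx vs)) \<in> imgs vs"
    using Cons.IH[OF u(1)] imgs_uminus by (auto simp: sgn_if_def)
  moreover have "hi u (bottom_idx vs) \<in> M" using u(2) by (simp add: chains_def)
  ultimately show ?case using imgs_ConsI by metis
qed simp

lemma imgs_kd: "x \<in> imgs vs \<Longrightarrow> \<exists>u\<in>chains vs. kd e vs u = at_bottom vs x"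
proof (induction vs arbitrary: x)
  case Nil
  then show ?case by (intro bexI[OF _ chains_0]) (auto simp: at_bottom_def fun_eq_iff)
next
  case (Cons v vs)
  then obtain a b where 1: "x = \<phi> v a + b" "a \<in> M" "b \<in> imgs vs" by auto
  then obtain w where w: "w \<in> chains vs" "kd e vs w = at_bottom vs b" using Cons.IH by blast
  let ?u = "join (sgn_if e w) (at_bottom vs a)"
  have "phis v (at_bottom vs a) = at_bottom vs (\<phi> v a)" by (auto simp: at_bottom_def phis_def)
  then have "kd e (v # vs) ?u = join (at_bottom vs b + at_bottom vs (\<phi> v a)) 0"
    by (simp only: kd.simps lo_hi_join kd_sgn_if w(2) kd_at_bottom sgn_if_simps minus_zero)
  also have "at_bottom vs b + at_bottom vs (\<phi> v a) = at_bottom vs x"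
    by (auto simp: at_bottom_def 1 fun_eq_iff)
  finally have "kd e (v # vs) ?u = at_bottom (v # vs) x" by (simp only: at_bottom_Cons)
  moreover have "?u \<in> chains (v # vs)"
    using w(1) 1(2) by (simp add: chains_join chains_sgn_if chains_at_bottom)
  ultimately show ?case by blast
qed

text \<open>Exactness of the mapping cone, by hand. In u = (a, b) the part \<open>b\<close> is a
  cycle, and the operator of \<open>v\<close> sends it to a boundary. Regularity puts the bottom
  coordinate of \<open>b\<close> into the images of the other operators, so \<open>b\<close> is the
  boundary of some \<open>W\<close>; then \<open>a\<close>, corrected by the operator of
  \<open>v\<close> applied to \<open>W\<close>, is a cycle of the shorter complex and bounds as
  well.\<close>

theorem koszul_exact:
  "regular vs \<Longrightarrow> u \<in> chains vs \<Longrightarrow> u (bottom_idx vs) = 0 \<Longrightarrow> kd e vs u = 0 \<Longrightarrow> \<exists>w\<in>chains vs. u = kd e vs w"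
proof (induction vs arbitrary: u)
  case Nil
  have "u = 0"
  proof
    fix bs show "u bs = 0 bs" using Nil by (cases bs) (auto simp: chains_def)
  qed
  then show ?case by (intro bexI[OF _ chains_0]) simp
next
  case (Cons v vs)
  define a b where "a = lo u" and "b = hi u"
  have ab: "a \<in> chains vs" "b \<in> chains vs" "u = join a b" using chains_ConsD[OF Cons.prems(2)] by (auto simp: a_def b_def)
  have abot: "a (bottom_idx vs) = 0" using Cons.prems(3) by (simp add: a_def lo_def)
  have d: "sgn_if e (kd e vs a) + phis v b = 0" "kd e vs b = 0"
    using Cons.prems(4) unfolding kd.simps join_eq_0_iff a_def b_def by (simp_all only: sgn_if_simps neg_equal_0_iff_equal)
  have reg: "regular vs" "\<And>x. x \<in> M \<Longrightarrow> \<phi> v x \<in> imgs vs \<Longrightarrow> x \<in> imgs vs" using Cons.prems(1) by auto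
  have "(sgn_if e (kd e vs a) + phis v b) (bottom_idx vs) = 0" using d(1) by simp
  then have "\<phi> v (b (bottom_idx vs)) = - sgn_if e (kd e vs a (bottom_idx vs))"
    by (auto simp: sgn_if_def phis_def eq_neg_iff_add_eq_0 add.commute)
  moreover have "kd e vs a (bottom_idx vs) \<in> imgs vs" by (rule kd_bottom_in_imgs[OF ab(1)])
  ultimately have "\<phi> v (b (bottom_idx vs)) \<in> imgs vs" using imgs_uminus by (auto simp: sgn_if_def)
  moreover have "b (bottom_idx vs) \<in> M" using ab(2) by (simp add: chains_def)
  ultimately have "b (bottom_idx vs) \<in> imgs vs" using reg(2) by blast
  then obtain c where c: "c \<in> chains vs" "kd e vs c = at_bottom vs (b (bottom_idx vs))" using imgs_kd by blast
  have "\<exists>w\<in>chains vs. b - kd e vs c = kd e vs w"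
  proof (rule Cons.IH[OF reg(1)])
    show "b - kd e vs c \<in> chains vs" by (rule chains_diff[OF ab(2) kd_chains[OF c(1)]])
    show "(b - kd e vs c) (bottom_idx vs) = 0" by (simp add: c(2) at_bottom_def)
    show "kd e vs (b - kd e vs c) = 0" unfolding kd_diff d(2) c(2) kd_at_bottom by (rule diff_zero)
  qed
  then obtain c' where c': "c' \<in> chains vs" "b - kd e vs c = kd e vs c'" by blast
  \<comment> \<open>Removing the bottom coordinate does not change the boundary, and it makes the
    induction hypothesis applicable to the corrected \<open>a\<close>.\<close>
  define W where "W = (c + c') - at_bottom vs ((c + c') (bottom_idx vs))"
  have cc: "c + c' \<in> chains vs" by (rule chains_add[OF c(1) c'(1)])
  have W: "W \<in> chains vs" unfolding W_def
    by (intro chains_diff cc chains_at_bottom) (use cc in \<open>simp add: chains_def\<close>)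
  have Wbot: "W (bottom_idx vs) = 0" by (simp add: W_def at_bottom_def)
  have bW: "kd e vs W = b" 
    unfolding W_def kd_diff kd_at_bottom kd_add c'(2)[symmetric] by (simp only: diff_zero add_diff_cancel_left' add_diff_eq)
  have "kd e vs (sgn_if e a + phis v W) = 0"
    unfolding kd_add kd_sgn_if kd_phis[OF W] bW by (rule d(1))
  moreover have "sgn_if e a + phis v W \<in> chains vs" by (intro chains_add chains_sgn_if chains_phis ab W)
  moreover have "(sgn_if e a + phis v W) (bottom_idx vs) = 0"
    using abot Wbot by (simp add: sgn_if_def phis_def)
  ultimately obtain Y where Y: "Y \<in> chains vs" "sgn_if e a + phis v W = kd e vs Y"
    using Cons.IH[OF reg(1), of "sgn_if e a + phis v W"] by blast
  let ?w = "join Y (sgn_if (\<not> e) W)"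
  have "a = sgn_if e (sgn_if e a + phis v W) - sgn_if e (phis v W)" by simp
  also have "\<dots> = sgn_if e (kd e vs Y) + phis v (sgn_if (\<not> e) W)"
    unfolding Y(2) by (simp add: phis_sgn_if phis_uminus)
  finally have "u = kd e (v # vs) ?w" unfolding ab(3) by (simp add: kd_sgn_if kd_uminus bW)
  moreover have "?w \<in> chains (v # vs)" using Y(1) W chains_sgn_if by (simp only: chains_join)
  ultimately show ?case by blast
qed

end

text \<open>
  If \<open>N v\<close> is a complement of the image of the injective operator \<open>\<phi> v\<close>, compatibly for the different \<open>v\<close>,
  then the operators form a regular sequence. For \<open>\<phi> v = x\<^sub>v - X\<^sub>v\<close> the complement consists of the
  vectors that do not involve the variable \<open>x\<^sub>v\<close>.
\<close>

locale splitting_operators = commuting_operators M \<phi>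
  for M :: "'m::ab_group_add set" and \<phi> :: "'v \<Rightarrow> 'm \<Rightarrow> 'm" +
  fixes N :: "'v \<Rightarrow> 'm set"
  assumes N_M: "N v \<subseteq> M" and N_0: "0 \<in> N v" and N_diff: "x \<in> N v \<Longrightarrow> y \<in> N v \<Longrightarrow> x - y \<in> N v"
    and N_phi: "v \<noteq> w \<Longrightarrow> x \<in> N v \<Longrightarrow> \<phi> w x \<in> N v"
    and split: "x \<in> M \<Longrightarrow> \<exists>r\<in>N v. \<exists>q\<in>M. x = r + \<phi> v q \<and> (\<forall>w. x \<in> N w \<longrightarrow> r \<in> N w)"
    and direct: "q \<in> M \<Longrightarrow> \<phi> v q \<in> N v \<Longrightarrow> q = 0"
begin

lemma N_add: "x \<in> N v \<Longrightarrow> y \<in> N v \<Longrightarrow> x + y \<in> N v"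
  using N_diff[of x v "0 - y"] N_diff[OF N_0, of y v] by simp

text \<open>The operators are divided out one after another; the last clause of \<open>split\<close>
  keeps the remainder in the complements reached before.\<close>

lemma split_list: "x \<in> M \<Longrightarrow> \<exists>r\<in>M. \<exists>y\<in>imgs vs. x = r + y \<and> (\<forall>v\<in>set vs. r \<in> N v)"
proof (induction vs)
  case Nil
  then show ?case by auto
next
  case (Cons v vs)
  then obtain r y where r: "r \<in> M" "y \<in> imgs vs" "x = r + y" "\<forall>v\<in>set vs. r \<in> N v" by blast
  then obtain r' q where q: "r' \<in> N v" "q \<in> M" "r = r' + \<phi> v q" "\<forall>w. r \<in> N w \<longrightarrow> r' \<in> N w"
    using split[of r v] by blast
  have "x = r' + (\<phi> v q + y)" using r q by (simp add: algebra_simps)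
  moreover have "\<phi> v q + y \<in> imgs (v # vs)" using q r by (intro imgs_ConsI)
  moreover have "\<forall>v\<in>set (v # vs). r' \<in> N v" using q r by auto
  moreover have "r' \<in> M" using q N_M by auto
  ultimately show ?case by blast
qed

text \<open>Dividing by the operator of \<open>v\<close> can be done inside \<open>imgs vs\<close>:
  split the argument of each other operator, and use that the operators commute and preserve
  \<open>N v\<close>.\<close>

lemma imgs_split:
  "v \<notin> set vs \<Longrightarrow> z \<in> imgs vs \<Longrightarrow> \<exists>z'\<in>imgs vs. \<exists>p\<in>M. z' \<in> N v \<and> z = z' + \<phi> v p"
proof (induction vs arbitrary: z)
  case Nil
  then show ?case by (auto simp: N_0 intro!: bexI[OF _ M_0])
next
  case (Cons w vs)
  then obtain q z1 where z: "z = \<phi> w q + z1" "q \<in> M" "z1 \<in> imgs vs" by auto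
  have "v \<notin> set vs" using Cons.prems(1) by simp
  from Cons.IH[OF this z(3)] obtain z1' p1
    where 1: "z1' \<in> imgs vs" "p1 \<in> M" "z1' \<in> N v" "z1 = z1' + \<phi> v p1" by blast
  obtain r p where 2: "r \<in> N v" "p \<in> M" "q = r + \<phi> v p" using split[OF z(2), of v] by blast
  have "z = (\<phi> w r + z1') + \<phi> v (\<phi> w p + p1)"
    using z 1 2 by (simp add: phi_add phi_comm[OF 2(2), of w v] algebra_simps)
  moreover have "\<phi> w r + z1' \<in> imgs (w # vs)" using 1 2 N_M by (intro imgs_ConsI) auto
  moreover have "\<phi> w r + z1' \<in> N v" using 1 2 Cons.prems by (auto intro!: N_add N_phi)
  moreover have "\<phi> w p + p1 \<in> M" using 1 2 by (intro M_add M_phi)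
  ultimately show ?case by blast
qed

text \<open>Write y as the operator of \<open>v\<close> applied to q, plus z, and split z by
  \<open>imgs_split\<close>. Both \<open>y\<close> and the remainder \<open>z'\<close> lie in
  \<open>N v\<close>, so directness leaves y = z', an element of the shorter sum.\<close>

lemma imgs_direct: "distinct vs \<Longrightarrow> y \<in> imgs vs \<Longrightarrow> \<forall>v\<in>set vs. y \<in> N v \<Longrightarrow> y = 0"
proof (induction vs arbitrary: y)
  case (Cons v vs)
  then obtain q z where z: "y = \<phi> v q + z" "q \<in> M" "z \<in> imgs vs" by auto
  obtain z' p where 1: "z' \<in> imgs vs" "p \<in> M" "z' \<in> N v" "z = z' + \<phi> v p"
    using imgs_split[of v vs z] z Cons.prems(1) by auto
  have "\<phi> v (q + p) = y - z'" using z 1 by (simp add: phi_add algebra_simps)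
  moreover have "y - z' \<in> N v" using Cons.prems(3) 1(3) by (intro N_diff) auto
  ultimately have "q + p = 0" using direct[of "q + p" v] M_add z 1 by simp
  then have "y = z'" using \<open>\<phi> v (q + p) = y - z'\<close> by simp
  then show ?case using Cons.IH[of y] Cons.prems 1 by simp
qed simp

text \<open>Modulo \<open>imgs vs\<close> the element \<open>x\<close> may be replaced by
  \<open>r\<close>, which lies in every complement of \<open>vs\<close>. Its image under the
  operator of \<open>v\<close> stays in these complements and lies in \<open>imgs vs\<close>, so it
  is 0; then \<open>r\<close> is 0 by injectivity.\<close>

lemma regular_distinct: "distinct vs \<Longrightarrow> regular vs"
proof (induction vs)
  case (Cons v vs)
  have "x \<in> imgs vs" if x: "x \<in> M" "\<phi> v x \<in> imgs vs" for x
  proof -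
    obtain r y where r: "r \<in> M" "y \<in> imgs vs" "x = r + y" "\<forall>v\<in>set vs. r \<in> N v"
      using split_list[OF x(1)] by blast
    have "\<phi> v r = \<phi> v x + - \<phi> v y" using r(3) by (simp add: phi_add)
    then have "\<phi> v r \<in> imgs vs" using x(2) r(2) imgs_phi imgs_add imgs_uminus by metis
    moreover have "\<forall>w\<in>set vs. \<phi> v r \<in> N w" using r(4) Cons.prems N_phi by force
    ultimately have "\<phi> v r = 0" using imgs_direct Cons.prems by auto
    then have "r = 0" using direct[OF r(1), of v] N_0 by simp
    then show ?thesis using r by simp
  qed
  then show ?case using Cons by auto
qed simp

end

section \<open>The operators x_v - X_v on vectors of polynomials\<close>

lemma poly_split_var:
  fixes p :: "('n::finite, 'k::field) mpoly"
  shows "\<exists>p0 p1. p = p0 + Xvar v * p1 \<and> (\<forall>\<alpha>\<in>keys p0. \<alpha> \<in> keys p \<and> lookup \<alpha> v = 0) \<and>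
    (\<forall>\<alpha>\<in>keys p1. \<alpha> + single v 1 \<in> keys p)"
proof (intro exI conjI)
  let ?A = "{\<alpha>\<in>keys p. lookup \<alpha> v = 0}" and ?B = "{\<alpha>\<in>keys p. lookup \<alpha> v \<noteq> 0}"
  define p0 where "p0 = (\<Sum>\<alpha>\<in>?A. single \<alpha> (lookup p \<alpha>))"
  define p1 where "p1 = (\<Sum>\<alpha>\<in>?B. single (\<alpha> - single v 1) (lookup p \<alpha>))"
  have shift: "(\<alpha> - single v 1) + single v 1 = \<alpha>" if "lookup \<alpha> v \<noteq> 0" for \<alpha> :: "'n \<Rightarrow>\<^sub>0 nat"
    by (rule poly_mapping_eqI) (use that in \<open>auto simp: lookup_add lookup_minus lookup_single when_def\<close>)
  have "p = (\<Sum>\<alpha>\<in>?A \<union> ?B. single \<alpha> (lookup p \<alpha>))"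
  proof -
    have "?A \<union> ?B = keys p" by auto
    then show ?thesis using monomial_expansion[of p] by simp
  qed
  also have "\<dots> = p0 + (\<Sum>\<alpha>\<in>?B. single \<alpha> (lookup p \<alpha>))"
    unfolding p0_def by (rule sum.union_disjoint) auto
  also have "(\<Sum>\<alpha>\<in>?B. single \<alpha> (lookup p \<alpha>)) = Xvar v * p1"
    unfolding p1_def sum_distrib_left
  proof (rule sum.cong)
    fix \<alpha> assume "\<alpha> \<in> ?B"
    then have "single v 1 + (\<alpha> - single v 1) = \<alpha>" using shift[of \<alpha>] by (simp add: add.commute)
    then show "single \<alpha> (lookup p \<alpha>) = Xvar v * single (\<alpha> - single v 1) (lookup p \<alpha>)"
      by (simp add: Xvar_def mult_single)
  qed simp
  finally show "p = p0 + Xvar v * p1" .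
  show "\<forall>\<alpha>\<in>keys p0. \<alpha> \<in> keys p \<and> lookup \<alpha> v = 0"
    unfolding p0_def using keys_sum[of "\<lambda>\<alpha>. single \<alpha> (lookup p \<alpha>)" ?A] by (auto split: if_splits)
  show "\<forall>\<alpha>\<in>keys p1. \<alpha> + single v 1 \<in> keys p"
  proof
    fix \<alpha> assume "\<alpha> \<in> keys p1"
    then obtain \<beta> where "\<beta> \<in> ?B" "\<alpha> = \<beta> - single v 1"
      unfolding p1_def using keys_sum[of "\<lambda>\<alpha>. single (\<alpha> - single v 1) (lookup p \<alpha>)" ?B]
      by (auto split: if_splits)
    then show "\<alpha> + single v 1 \<in> keys p" using shift[of \<beta>] by simp
  qed
qed

lemma keys_Const_sum:
  fixes p :: "('n::finite, 'k::field) mpoly"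
  assumes "\<alpha> \<in> keys (p + (\<Sum>b\<in>B. Const (c b) * q b))"
  shows "\<alpha> \<in> keys p \<or> (\<exists>b\<in>B. \<alpha> \<in> keys (q b))"
proof (rule ccontr)
  assume "\<not> ?thesis"
  then have "lookup p \<alpha> = 0" "\<And>b. b \<in> B \<Longrightarrow> lookup (q b) \<alpha> = 0" by (auto simp: in_keys_iff)
  then have "lookup (p + (\<Sum>b\<in>B. Const (c b) * q b)) \<alpha> = 0" by (simp add: lookup_add lookup_sum)
  then show False using assms by (simp add: in_keys_iff)
qed

text \<open>Intended reading: \<open>B\<close> indexes a basis of A over the field, and column
  \<open>b\<close> of \<open>X v\<close> expands x_v times the basis element \<open>b\<close>.
  Vectors over \<open>B\<close> then form R tensor A.\<close>

locale commuting_matrices =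
  fixes B :: "'b set" and X :: "'n::finite \<Rightarrow> 'b \<Rightarrow> 'b \<Rightarrow> 'k::field"
  assumes finB: "finite B"
    and comm: "b \<in> B \<Longrightarrow> b' \<in> B \<Longrightarrow> (\<Sum>c\<in>B. X v b c * X w c b') = (\<Sum>c\<in>B. X w b c * X v c b')"
begin

definition Phi :: "'n \<Rightarrow> 'b \<Rightarrow> 'b \<Rightarrow> ('n, 'k) mpoly" where
  "Phi v b b' = (if b = b' then Xvar v else 0) - Const (X v b b')"

abbreviation "act v \<equiv> app B (Phi v)"

definition free_of :: "'n \<Rightarrow> ('b \<Rightarrow> ('n, 'k) mpoly) set" where
  "free_of v = {u\<in>vecs B. \<forall>b\<in>B. \<forall>\<alpha>\<in>keys (u b). lookup \<alpha> v = 0}"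

lemma act_eq: "b \<in> B \<Longrightarrow> act v u b = Xvar v * u b - (\<Sum>c\<in>B. Const (X v b c) * u c)"
proof -
  assume b: "b \<in> B"
  have "act v u b = (\<Sum>c\<in>B. (if b = c then Xvar v * u c else 0) - Const (X v b c) * u c)"
    using b unfolding app_def by (simp add: Phi_def) (rule sum.cong, auto simp: algebra_simps)
  then show ?thesis using b finB by (simp add: sum_subtractf)
qed

lemma act_notin: "b \<notin> B \<Longrightarrow> act v u b = 0" by (simp add: app_def)

lemma act_act:
  assumes b: "b \<in> B"
  shows "act v (act w u) b = Xvar v * (Xvar w * u b) - (\<Sum>c\<in>B. Const (X w b c) * (Xvar v * u c))
    - (\<Sum>c\<in>B. Const (X v b c) * (Xvar w * u c)) + (\<Sum>d\<in>B. Const (\<Sum>c\<in>B. X v b c * X w c d) * u d)"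
proof -
  have "(\<Sum>c\<in>B. Const (X v b c) * act w u c)
      = (\<Sum>c\<in>B. Const (X v b c) * (Xvar w * u c)) - (\<Sum>c\<in>B. \<Sum>d\<in>B. Const (X v b c * X w c d) * u d)"
    unfolding sum_subtractf[symmetric]
    by (rule sum.cong) (auto simp: act_eq right_diff_distrib sum_distrib_left mult.assoc[symmetric] Const_mult)
  also have "(\<Sum>c\<in>B. \<Sum>d\<in>B. Const (X v b c * X w c d) * u d) = (\<Sum>d\<in>B. Const (\<Sum>c\<in>B. X v b c * X w c d) * u d)"
    by (subst sum.swap) (simp add: Const_sum sum_distrib_right)
  finally have 1: "(\<Sum>c\<in>B. Const (X v b c) * act w u c)
     = (\<Sum>c\<in>B. Const (X v b c) * (Xvar w * u c)) - (\<Sum>d\<in>B. Const (\<Sum>c\<in>B. X v b c * X w c d) * u d)" .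
  have 2: "Xvar v * act w u b = Xvar v * (Xvar w * u b) - (\<Sum>c\<in>B. Const (X w b c) * (Xvar v * u c))"
    using b by (simp add: act_eq right_diff_distrib sum_distrib_left mult.left_commute)
  show ?thesis unfolding act_eq[OF b, of v "act w u"] 1 2 by (simp add: algebra_simps)
qed

lemma act_comm: "act v (act w u) = act w (act v u)"
proof
  fix b
  show "act v (act w u) b = act w (act v u) b"
  proof (cases "b \<in> B")
    case True
    have "(\<Sum>d\<in>B. Const (\<Sum>c\<in>B. X v b c * X w c d) * u d) = (\<Sum>d\<in>B. Const (\<Sum>c\<in>B. X w b c * X v c d) * u d)"
      by (rule sum.cong) (auto simp: comm[OF True])
    then show ?thesis unfolding act_act[OF True] by (simp add: mult.left_commute)
  qed (simp add: act_notin)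
qed

text \<open>Induction on the degree in x_v: if u = p0 + x_v p1, then p0 + X_v p1 differs from u by
  the operator applied to p1, and its degree bound in x_v is smaller by one. No new variables enter,
  since X_v has constant entries.\<close>

lemma free_split:
  "u \<in> vecs B \<Longrightarrow> (\<And>b \<alpha>. b \<in> B \<Longrightarrow> \<alpha> \<in> keys (u b) \<Longrightarrow> lookup \<alpha> v \<le> k) \<Longrightarrow>
    \<exists>r\<in>free_of v. \<exists>q\<in>vecs B. u = r + act v q \<and> (\<forall>w. u \<in> free_of w \<longrightarrow> r \<in> free_of w)"
proof (induction k arbitrary: u)
  case 0
  have "u \<in> free_of v" using 0 by (auto simp: free_of_def)
  moreover have "u = u + act v (\<lambda>_. 0)" by (auto simp: fun_eq_iff)
  moreover have "(\<lambda>_. 0) \<in> vecs B" by (simp add: vecs_def)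
  ultimately show ?case by blast
next
  case (Suc k)
  have "\<forall>b. \<exists>p0 p1. u b = p0 + Xvar v * p1 \<and> (\<forall>\<alpha>\<in>keys p0. \<alpha> \<in> keys (u b) \<and> lookup \<alpha> v = 0) \<and>
      (\<forall>\<alpha>\<in>keys p1. \<alpha> + single v 1 \<in> keys (u b))"
    by (rule allI, rule poly_split_var)
  from choice[OF this] obtain p0 where
    "\<forall>b. \<exists>p1. u b = p0 b + Xvar v * p1 \<and> (\<forall>\<alpha>\<in>keys (p0 b). \<alpha> \<in> keys (u b) \<and> lookup \<alpha> v = 0) \<and>
      (\<forall>\<alpha>\<in>keys p1. \<alpha> + single v 1 \<in> keys (u b))" ..
  from choice[OF this] obtain p1 where
    "\<forall>b. u b = p0 b + Xvar v * p1 b \<and> (\<forall>\<alpha>\<in>keys (p0 b). \<alpha> \<in> keys (u b) \<and> lookup \<alpha> v = 0) \<and>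
      (\<forall>\<alpha>\<in>keys (p1 b). \<alpha> + single v 1 \<in> keys (u b))" ..
  then have p: "\<And>b. u b = p0 b + Xvar v * p1 b"
    "\<And>b \<alpha>. \<alpha> \<in> keys (p0 b) \<Longrightarrow> \<alpha> \<in> keys (u b) \<and> lookup \<alpha> v = 0"
    "\<And>b \<alpha>. \<alpha> \<in> keys (p1 b) \<Longrightarrow> \<alpha> + single v 1 \<in> keys (u b)"
    by blast+
  define q where "q = (\<lambda>b. if b \<in> B then p1 b else 0)"
  define u' where "u' = (\<lambda>b. if b \<in> B then p0 b + (\<Sum>c\<in>B. Const (X v b c) * p1 c) else 0)"
  have qv: "q \<in> vecs B" "u' \<in> vecs B" by (auto simp: q_def u'_def vecs_def)
  have eq: "u = u' + act v q"
  proof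
    fix b show "u b = (u' + act v q) b"
    proof (cases "b \<in> B")
      case True
      have "(\<Sum>c\<in>B. Const (X v b c) * q c) = (\<Sum>c\<in>B. Const (X v b c) * p1 c)"
        by (rule sum.cong) (auto simp: q_def)
      then show ?thesis using True p(1)[of b] by (simp add: act_eq u'_def) (simp add: q_def)
    qed (use Suc.prems in \<open>simp add: act_notin u'_def vecs_def\<close>)
  qed
  have keys': "\<alpha> \<in> keys (p0 b) \<or> (\<exists>c\<in>B. \<alpha> \<in> keys (p1 c))" if "b \<in> B" "\<alpha> \<in> keys (u' b)" for b \<alpha>
    using that keys_Const_sum[of \<alpha> "p0 b" "X v b" p1 B] by (simp add: u'_def)
  have bd: "lookup \<alpha> v \<le> k" if b: "b \<in> B" "\<alpha> \<in> keys (u' b)" for b \<alpha>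
    using keys'[OF b]
  proof
    assume "\<exists>c\<in>B. \<alpha> \<in> keys (p1 c)"
    then obtain c where "c \<in> B" "\<alpha> + single v 1 \<in> keys (u c)" using p(3) by blast
    then have "lookup (\<alpha> + single v 1) v \<le> Suc k" using Suc.prems(2) by blast
    then show ?thesis by (simp add: lookup_add)
  qed (use p(2) in simp)
  have fr: "u' \<in> free_of w" if w: "u \<in> free_of w" for w
    unfolding free_of_def
  proof (intro CollectI conjI ballI qv)
    fix b \<alpha> assume b: "b \<in> B" "\<alpha> \<in> keys (u' b)"
    have wf: "\<And>c \<beta>. c \<in> B \<Longrightarrow> \<beta> \<in> keys (u c) \<Longrightarrow> lookup \<beta> w = 0" using w by (auto simp: free_of_def)
    from keys'[OF b] show "lookup \<alpha> w = 0"
    proof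
      assume "\<exists>c\<in>B. \<alpha> \<in> keys (p1 c)"
      then obtain c where "c \<in> B" "\<alpha> + single v 1 \<in> keys (u c)" using p(3) by blast
      then have "lookup (\<alpha> + single v 1) w = 0" using wf by blast
      then show ?thesis by (simp add: lookup_add)
    qed (use p(2) wf b in blast)
  qed
  have "\<exists>r\<in>free_of v. \<exists>q\<in>vecs B. u' = r + act v q \<and> (\<forall>w. u' \<in> free_of w \<longrightarrow> r \<in> free_of w)"
    by (rule Suc.IH[OF qv(2)]) (rule bd)
  then obtain r q' where r: "r \<in> free_of v" "q' \<in> vecs B" "u' = r + act v q'" "\<forall>w. u' \<in> free_of w \<longrightarrow> r \<in> free_of w"
    by blast
  have "act v (\<lambda>j. q' j + q j) = act v q' + act v q" unfolding app_add by (simp add: fun_eq_iff)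
  then have "u = r + act v (\<lambda>j. q' j + q j)" using eq r(3) by (simp add: add.assoc)
  moreover have "(\<lambda>j. q' j + q j) \<in> vecs B" using r(2) qv(1) by (auto simp: vecs_def)
  ultimately show ?case using r(1,4) fr by blast
qed

text \<open>Take a monomial of \<open>q\<close> of maximal degree in x_v. Its product with x_v
  cannot be cancelled by the constant matrix \<open>X v\<close> applied to \<open>q\<close>, so it
  survives in \<open>act v q\<close>.\<close>

lemma free_direct:
  assumes q: "q \<in> vecs B" "act v q \<in> free_of v"
  shows "q = 0"
proof (rule ccontr)
  assume "q \<noteq> 0"
  then obtain b1 where "q b1 \<noteq> 0" by (auto simp: fun_eq_iff)
  then have b1: "b1 \<in> B" "keys (q b1) \<noteq> {}" using q(1) by (auto simp: vecs_def)
  define Q where "Q = (SIGMA b:B. keys (q b))"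
  have finQ: "finite Q" unfolding Q_def using finB by auto
  obtain \<alpha>1 where "\<alpha>1 \<in> keys (q b1)" using b1(2) by blast
  then have "(b1, \<alpha>1) \<in> Q" using b1(1) by (simp add: Q_def)
  then have "Q \<noteq> {}" by blast
  define d where "d = Max ((\<lambda>(b, \<alpha>). lookup \<alpha> v) ` Q)"
  have "d \<in> (\<lambda>(b, \<alpha>). lookup \<alpha> v) ` Q" unfolding d_def using finQ \<open>Q \<noteq> {}\<close> by (intro Max_in) auto
  then obtain b \<alpha> where b: "b \<in> B" "\<alpha> \<in> keys (q b)" "lookup \<alpha> v = d" by (auto simp: Q_def)
  have le: "lookup \<beta> v \<le> d" if "c \<in> B" "\<beta> \<in> keys (q c)" for c \<beta>
    unfolding d_def by (rule Max_ge) (use finQ that in \<open>auto simp: Q_def intro!: image_eqI[of _ _ "(c, \<beta>)"]\<close>)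
  let ?\<gamma> = "single v 1 + \<alpha>"
  have "lookup (q c) ?\<gamma> = 0" if "c \<in> B" for c
  proof (rule ccontr)
    assume "lookup (q c) ?\<gamma> \<noteq> 0"
    then have "lookup ?\<gamma> v \<le> d" using le that by (simp add: in_keys_iff)
    then show False using b(3) by (simp add: lookup_add)
  qed
  then have "lookup (act v q b) ?\<gamma> = lookup (q b) \<alpha>"
    using b(1) by (simp add: act_eq lookup_minus lookup_sum Xvar_def lookup_single_mult_add)
  then have "?\<gamma> \<in> keys (act v q b)" using b(2) by (simp add: in_keys_iff)
  then have "lookup ?\<gamma> v = 0" using q(2) b(1) by (auto simp: free_of_def)
  then show False by (simp add: lookup_add)
qed

lemma splitting: "splitting_operators (vecs B) act free_of"
proof
  show "0 \<in> vecs B" by (simp add: vecs_def)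
  fix x y :: "'b \<Rightarrow> ('n, 'k) mpoly" and v w :: 'n
  show "x \<in> vecs B \<Longrightarrow> y \<in> vecs B \<Longrightarrow> x + y \<in> vecs B" by (simp add: vecs_def)
  show "x \<in> vecs B \<Longrightarrow> - x \<in> vecs B" by (simp add: vecs_def)
  show "act v x \<in> vecs B" by simp
  show "act v (x + y) = act v x + act v y" using app_add[of B "Phi v" x y] by (simp add: plus_fun_def)
  show "act v (act w x) = act w (act v x)" by (rule act_comm)
  show "free_of v \<subseteq> vecs B" by (auto simp: free_of_def)
  show "0 \<in> free_of v" by (simp add: free_of_def vecs_def)
  show "x - y \<in> free_of v" if "x \<in> free_of v" "y \<in> free_of v"
    using that keys_diff_cases by (fastforce simp: free_of_def vecs_def)
  show "act w x \<in> free_of v" if "v \<noteq> w" "x \<in> free_of v"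
    unfolding free_of_def
  proof (intro CollectI conjI ballI)
    fix b \<alpha> assume b: "b \<in> B" and "\<alpha> \<in> keys (act w x b)"
    then have "\<alpha> \<in> keys (Xvar w * x b + (\<Sum>c\<in>B. Const (- X w b c) * x c))"
      by (simp add: act_eq single_uminus sum_negf)
    then have "\<alpha> \<in> keys (Xvar w * x b) \<or> (\<exists>c\<in>B. \<alpha> \<in> keys (x c))" by (rule keys_Const_sum)
    then show "lookup \<alpha> v = 0"
    proof
      assume "\<alpha> \<in> keys (Xvar w * x b)"
      then obtain \<beta> where "\<beta> \<in> keys (x b)" "\<alpha> = single w 1 + \<beta>"
        using keys_mult[of "Xvar w" "x b"] by (auto simp: Xvar_def)
      then show ?thesis using that b by (simp add: free_of_def lookup_add lookup_single_not_eq)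
    qed (use that in \<open>auto simp: free_of_def\<close>)
  qed simp
  show "\<exists>r\<in>free_of v. \<exists>q\<in>vecs B. x = r + act v q \<and> (\<forall>w. x \<in> free_of w \<longrightarrow> r \<in> free_of w)" if "x \<in> vecs B"
  proof -
    define k where "k = Max (insert 0 ((\<lambda>(b, \<alpha>). lookup \<alpha> v) ` (SIGMA b:B. keys (x b))))"
    have "lookup \<alpha> v \<le> k" if "b \<in> B" "\<alpha> \<in> keys (x b)" for b \<alpha>
      unfolding k_def by (rule Max_ge) (use finB that in \<open>auto intro!: image_eqI[of _ _ "(b, \<alpha>)"]\<close>)
    then show ?thesis using free_split[OF that, of v k] by blast
  qed
  show "act v x \<in> free_of v \<Longrightarrow> x = 0" if "x \<in> vecs B" using free_direct that by blast
qed

end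

section \<open>Matrix form of the Koszul differential\<close>

primrec kmat :: "('v \<Rightarrow> 'b \<Rightarrow> 'b \<Rightarrow> 'a::ab_group_add) \<Rightarrow> bool \<Rightarrow> 'v list \<Rightarrow> bool list \<Rightarrow> bool list \<Rightarrow> 'b \<Rightarrow> 'b \<Rightarrow> 'a" where
  "kmat P e [] = (\<lambda>xs ys b b'. 0)"
| "kmat P e (v # vs) = (\<lambda>xs ys b b'.
     if hd xs = hd ys then sgn_if (e \<noteq> hd xs) (kmat P e vs (tl xs) (tl ys) b b')
     else if hd ys \<and> tl xs = tl ys then P v b b' else 0)"

definition count_True :: "bool list \<Rightarrow> nat" where "count_True xs = length (filter id xs)"

lemma count_True_simps [simp]: "count_True [] = 0" "count_True (x # xs) = (if x then 1 else 0) + count_True xs"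
  by (auto simp: count_True_def)

lemma count_True_Not: "count_True (map Not xs) + count_True xs = length xs"
  by (induction xs) auto

lemma count_True_0: "count_True xs = 0 \<longleftrightarrow> xs = replicate (length xs) False"
  by (induction xs) auto

lemma sgn_if_apply: "sgn_if e f x = sgn_if e (f x :: 'a::ab_group_add)"
  by (simp add: sgn_if_def)

lemma sgn_if_sum: "(\<Sum>x\<in>A. sgn_if e (f x)) = sgn_if e (\<Sum>x\<in>A. f x :: 'a::ab_group_add)"
  by (simp add: sgn_if_def sum_negf)

lemma sgn_if_mult: "sgn_if e x * y = sgn_if e (x * y :: 'a::ring)"
  by (simp add: sgn_if_def)

text \<open>Self-duality of the Koszul complex: complementing subsets reverses the arrows. On the
  diagonal blocks, where \<open>hd xs = hd ys\<close>, the flag \<open>e \<noteq> hd xs\<close>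
  equals the flag formed with both \<open>e\<close> and the head negated; hence the conventions
  \<open>e\<close> and \<open>\<not> e\<close> correspond.\<close>

lemma kmat_transpose:
  "length xs = length vs \<Longrightarrow> length ys = length vs \<Longrightarrow>
    kmat P e vs xs ys b b' = kmat (\<lambda>v b b'. P v b' b) (\<not> e) vs (map Not ys) (map Not xs) b' b"
proof (induction vs arbitrary: xs ys)
  case (Cons v vs)
  then obtain x xs' y ys' where xy: "xs = x # xs'" "ys = y # ys'" "length xs' = length vs" "length ys' = length vs"
    by (metis length_Suc_conv list.size(4) length_Cons)
  have "inj Not" by (auto simp: inj_def)
  then have "map Not ys' = map Not xs' \<longleftrightarrow> xs' = ys'" by (auto simp: inj_map_eq_map)
  moreover have "((\<not> e) \<noteq> (\<not> y)) = (e \<noteq> y)" by auto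
  ultimately show ?case using Cons.IH[OF xy(3,4)] by (auto simp: xy)
qed simp

lemma kmat_count:
  "length xs = length vs \<Longrightarrow> length ys = length vs \<Longrightarrow> kmat P e vs xs ys b b' \<noteq> 0 \<Longrightarrow>
    count_True ys = count_True xs + 1"
proof (induction vs arbitrary: xs ys)
  case (Cons v vs)
  then obtain x xs' y ys' where xy: "xs = x # xs'" "ys = y # ys'" "length xs' = length vs" "length ys' = length vs"
    by (metis length_Suc_conv list.size(4) length_Cons)
  show ?case
  proof (cases "x = y")
    case True
    then show ?thesis using Cons.prems(3) Cons.IH[OF xy(3,4)] by (simp add: xy)
  qed (use Cons.prems(3) in \<open>auto simp: xy split: if_splits\<close>)
qed simp

lemma keys_sgn_if [simp]: "keys (sgn_if e p) = keys (p :: 'a \<Rightarrow>\<^sub>0 'k::ab_group_add)"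
  by (auto simp: sgn_if_def in_keys_iff)

lemma kmat_keys: "\<alpha> \<in> keys (kmat P e vs xs ys b b') \<Longrightarrow> \<exists>v. \<alpha> \<in> keys (P v b b')"
  for P :: "'v \<Rightarrow> 'b \<Rightarrow> 'b \<Rightarrow> ('a \<Rightarrow>\<^sub>0 'k::ab_group_add)"
  by (induction vs arbitrary: xs ys) (auto split: if_splits)

definition koszul_idx :: "'b set \<Rightarrow> nat \<Rightarrow> ('b \<times> bool list) set" where
  "koszul_idx B n = B \<times> {xs. length xs = n}"

definition kmatrix :: "('v \<Rightarrow> 'b \<Rightarrow> 'b \<Rightarrow> 'a::ab_group_add) \<Rightarrow> bool \<Rightarrow> 'v list \<Rightarrow> 'b \<times> bool list \<Rightarrow> 'b \<times> bool list \<Rightarrow> 'a" where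
  "kmatrix P e vs = (\<lambda>(b, xs) (b', ys). kmat P e vs xs ys b b')"

lemma finite_bool_lists: "finite {xs :: bool list. length xs = n}"
  using finite_lists_length_eq[of "UNIV :: bool set" n] by simp

lemma finite_koszul_idx: "finite B \<Longrightarrow> finite (koszul_idx B n)"
  by (simp add: koszul_idx_def finite_bool_lists)

lemma sum_bool_lists_Suc:
  "(\<Sum>ys | length ys = Suc n. F ys) = (\<Sum>ys | length ys = n. F (False # ys)) + (\<Sum>ys | length ys = n. F (True # ys))"
proof -
  have "{ys :: bool list. length ys = Suc n} = (Cons False ` {ys. length ys = n}) \<union> (Cons True ` {ys. length ys = n})"
    by (auto simp: length_Suc_conv)
  then have "(\<Sum>ys | length ys = Suc n. F ys) = (\<Sum>ys\<in>(Cons False ` {ys. length ys = n}) \<union> (Cons True ` {ys. length ys = n}). F ys)"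
    by simp
  also have "\<dots> = (\<Sum>ys\<in>Cons False ` {ys. length ys = n}. F ys) + (\<Sum>ys\<in>Cons True ` {ys. length ys = n}. F ys)"
    by (rule sum.union_disjoint) (auto simp: finite_bool_lists)
  finally show ?thesis by (simp add: sum.reindex)
qed

text \<open>Intended for the involution that complements subsets, which matches the transposed
  Koszul complex with the Koszul complex of the dual basis.\<close>

lemma cyclic_resolution_relabel:
  fixes D :: "'i \<Rightarrow> 'i \<Rightarrow> ('n::finite, 'k::field) mpoly"
  assumes res: "cyclic_resolution S h a D I \<delta>"
    and \<sigma>: "\<And>j. \<sigma> (\<sigma> j) = j" "\<And>j. j \<in> S \<Longrightarrow> \<sigma> j \<in> S"
    and h': "\<And>j. j \<in> S \<Longrightarrow> h' j = h (\<sigma> j)" and a': "\<And>j. j \<in> S \<Longrightarrow> a' j = a (\<sigma> j)"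
    and D': "\<And>j k. j \<in> S \<Longrightarrow> k \<in> S \<Longrightarrow> D' j k = D (\<sigma> j) (\<sigma> k)"
  shows "cyclic_resolution S h' a' D' I \<delta>"
proof -
  have S: "\<sigma> j \<in> S \<longleftrightarrow> j \<in> S" for j using \<sigma> by metis
  have bij: "bij_betw \<sigma> S S" by (rule bij_betw_byWitness[of _ \<sigma>]) (use \<sigma> in auto)
  have appD: "app S D' v = (\<lambda>j. app S D (\<lambda>i. v (\<sigma> i)) (\<sigma> j))" for v
  proof
    fix j
    show "app S D' v j = app S D (\<lambda>i. v (\<sigma> i)) (\<sigma> j)"
    proof (cases "j \<in> S")
      case True
      have "(\<Sum>k\<in>S. D' j k * v k) = (\<Sum>k\<in>S. D' j (\<sigma> k) * v (\<sigma> k))"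
        by (rule sum.reindex_bij_betw[OF bij, symmetric])
      also have "\<dots> = (\<Sum>k\<in>S. D (\<sigma> j) k * v (\<sigma> k))"
        by (rule sum.cong) (use True S D' \<sigma>(1) in auto)
      finally show ?thesis using True S by (simp add: app_def)
    qed (simp add: app_def S)
  qed
  have appD2: "app S D w = (\<lambda>j. app S D' (\<lambda>i. w (\<sigma> i)) (\<sigma> j))" for w
    unfolding appD by (simp add: \<sigma>)
  have vecsS: "(\<lambda>i. v (\<sigma> i)) \<in> vecs S" if "v \<in> vecs S" for v :: "'i \<Rightarrow> ('n, 'k) mpoly"
    using that S by (auto simp: vecs_def)
  have vecs0: "(\<lambda>i. v (\<sigma> i)) \<in> vecs {j\<in>S. h' j = 0} \<longleftrightarrow> v \<in> vecs {j\<in>S. h j = 0}" for v :: "'i \<Rightarrow> ('n, 'k) mpoly"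
  proof -
    have "v \<in> vecs {j\<in>S. h j = 0} \<longleftrightarrow> (\<forall>j. \<not> (\<sigma> j \<in> S \<and> h (\<sigma> j) = 0) \<longrightarrow> v (\<sigma> j) = 0)"
      unfolding vecs_def using \<sigma>(1) by (auto) metis+
    then show ?thesis unfolding vecs_def using h' S by auto
  qed
  have cx: "cplx S h D" and gr: "graded S a D" and ac: "acyclic_above S h D"
    using res by (auto simp: cyclic_resolution_def)
  obtain g where g: "coker_gen S h D I g" "graded_vec S a \<delta> g" using res by (auto simp: cyclic_resolution_def)
  have "cplx S h' D'"
    unfolding cplx_def
  proof (intro conjI ballI impI)
    show "finite S" using cx by (simp add: cplx_def)
    show "0 \<le> h' j" if "j \<in> S" for j using that cx h' S by (simp add: cplx_def)
    show "h' k = h' j + 1" if "j \<in> S" "k \<in> S" "D' j k \<noteq> 0" for j k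
      using that cx S by (simp add: cplx_def h' D')
    show "(\<Sum>k\<in>S. D' i k * D' k j) = 0" if "i \<in> S" "j \<in> S" for i j
    proof -
      have "(\<Sum>k\<in>S. D' i k * D' k j) = (\<Sum>k\<in>S. D (\<sigma> i) (\<sigma> k) * D (\<sigma> k) (\<sigma> j))"
        by (rule sum.cong) (use that D' in auto)
      also have "\<dots> = (\<Sum>k\<in>S. D (\<sigma> i) k * D k (\<sigma> j))" by (rule sum.reindex_bij_betw[OF bij])
      finally show ?thesis using cx that S by (simp add: cplx_def)
    qed
  qed
  moreover have "graded S a' D'" using gr S unfolding graded_def by (auto simp: a' D')
  moreover have "acyclic_above S h' D'"
    unfolding acyclic_above_def
  proof (intro ballI impI)
    fix v assume v: "v \<in> vecs S" and 0: "(\<forall>j\<in>S. h' j = 0 \<longrightarrow> v j = 0) \<and> app S D' v = (\<lambda>_. 0)"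
    define w where "w = (\<lambda>i. v (\<sigma> i))"
    have "app S D w j = 0" for j using 0 appD2[of w] by (simp add: w_def \<sigma>)
    then have "app S D w = (\<lambda>_. 0)" by auto
    moreover have "w \<in> vecs S" using vecsS[OF v] by (simp add: w_def)
    moreover have "\<forall>j\<in>S. h j = 0 \<longrightarrow> w j = 0"
    proof (intro ballI impI)
      fix j assume "j \<in> S" "h j = 0"
      then have "h' (\<sigma> j) = 0" using h' S \<sigma>(1) by simp
      then show "w j = 0" using 0 \<open>j \<in> S\<close> S by (simp add: w_def)
    qed
    ultimately obtain u where u: "u \<in> vecs S" "w = app S D u" using ac unfolding acyclic_above_def by blast
    have "v = app S D' (\<lambda>i. u (\<sigma> i))"
    proof
      fix j
      have "v j = w (\<sigma> j)" by (simp add: w_def \<sigma>)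
      then show "v j = app S D' (\<lambda>i. u (\<sigma> i)) j" unfolding u(2) appD by (simp add: \<sigma>)
    qed
    then show "\<exists>u\<in>vecs S. v = app S D' u" using vecsS[OF u(1)] by blast
  qed
  moreover have "coker_gen S h' D' I (\<lambda>i. g (\<sigma> i))"
    unfolding coker_gen_def
  proof (intro conjI ballI allI)
    show "(\<lambda>i. g (\<sigma> i)) \<in> vecs {j\<in>S. h' j = 0}" using g(1) by (simp add: vecs0 coker_gen_def)
  next
    fix w :: "'i \<Rightarrow> ('n, 'k) mpoly" assume w: "w \<in> vecs {j\<in>S. h' j = 0}"
    define w' where "w' = (\<lambda>i. w (\<sigma> i))"
    have "w' \<in> vecs {j\<in>S. h j = 0}" using w by (subst vecs0[symmetric]) (simp add: w'_def \<sigma>)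
    then obtain r u where u: "u \<in> vecs S" "w' = (\<lambda>j. r * g j + app S D u j)"
      using g(1) unfolding coker_gen_def by blast
    have "w j = r * g (\<sigma> j) + app S D' (\<lambda>i. u (\<sigma> i)) j" for j
      using fun_cong[OF u(2), of "\<sigma> j"] unfolding appD by (simp add: w'_def \<sigma>)
    then show "\<exists>r. \<exists>u\<in>vecs S. w = (\<lambda>j. r * g (\<sigma> j) + app S D' u j)" using vecsS[OF u(1)] by blast
  next
    fix r
    have "(\<exists>u\<in>vecs S. (\<lambda>j. r * g (\<sigma> j)) = app S D' u) \<longleftrightarrow> (\<exists>u\<in>vecs S. (\<lambda>j. r * g j) = app S D u)"
    proof
      assume "\<exists>u\<in>vecs S. (\<lambda>j. r * g (\<sigma> j)) = app S D' u"
      then obtain u where u: "u \<in> vecs S" "(\<lambda>j. r * g (\<sigma> j)) = app S D' u" by blast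
      have "r * g j = app S D (\<lambda>i. u (\<sigma> i)) j" for j
        using fun_cong[OF u(2), of "\<sigma> j"] unfolding appD by (simp add: \<sigma>)
      then show "\<exists>u\<in>vecs S. (\<lambda>j. r * g j) = app S D u" using vecsS[OF u(1)] by blast
    next
      assume "\<exists>u\<in>vecs S. (\<lambda>j. r * g j) = app S D u"
      then obtain u where u: "u \<in> vecs S" "(\<lambda>j. r * g j) = app S D u" by blast
      have "r * g (\<sigma> j) = app S D' (\<lambda>i. u (\<sigma> i)) j" for j
        using fun_cong[OF u(2), of "\<sigma> j"] unfolding appD by (simp add: \<sigma>)
      then show "\<exists>u\<in>vecs S. (\<lambda>j. r * g (\<sigma> j)) = app S D' u" using vecsS[OF u(1)] by blast
    qed
    then show "(\<exists>u\<in>vecs S. (\<lambda>j. r * g (\<sigma> j)) = app S D' u) \<longleftrightarrow> r \<in> I" using g(1) unfolding coker_gen_def by simp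
  qed
  moreover have "graded_vec S a' \<delta> (\<lambda>i. g (\<sigma> i))" using g(2) S by (auto simp: graded_vec_def a')
  ultimately show ?thesis unfolding cyclic_resolution_def by blast
qed

section \<open>The Koszul complex as a resolution of the quotient algebra\<close>

context commuting_matrices
begin

interpretation K: splitting_operators "vecs B" act free_of by (rule splitting)

lemma chains_iff: "w \<in> K.chains vs \<longleftrightarrow> (\<forall>bs. w bs \<in> vecs B) \<and> (\<forall>bs. length bs \<noteq> length vs \<longrightarrow> w bs = 0)"
  by (simp add: K.chains_def)

lemma kmat_kd:
  "length xs = length vs \<Longrightarrow> b \<in> B \<Longrightarrow>
    (\<Sum>ys | length ys = length vs. \<Sum>b'\<in>B. kmat Phi e vs xs ys b b' * c ys b') = K.kd e vs c xs b"
proof (induction vs arbitrary: xs c)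
  case Nil
  then show ?case by simp
next
  case (Cons v vs)
  then obtain x xs' where x: "xs = x # xs'" "length xs' = length vs" by (cases xs) auto
  let ?L = "{ys :: bool list. length ys = length vs}"
  have IH: "(\<Sum>ys\<in>?L. \<Sum>b'\<in>B. kmat Phi e vs xs' ys b b' * d ys b') = K.kd e vs d xs' b" for d
    by (rule Cons.IH[OF x(2) Cons.prems(2)])
  have "(\<Sum>ys | length ys = length (v # vs). \<Sum>b'\<in>B. kmat Phi e (v # vs) xs ys b b' * c ys b')
    = (\<Sum>ys\<in>?L. \<Sum>b'\<in>B. kmat Phi e (v # vs) xs (False # ys) b b' * lo c ys b')
    + (\<Sum>ys\<in>?L. \<Sum>b'\<in>B. kmat Phi e (v # vs) xs (True # ys) b b' * hi c ys b')"
    by (simp add: sum_bool_lists_Suc lo_def hi_def)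
  also have "\<dots> = K.kd e (v # vs) c xs b"
  proof (cases x)
    case True
    have "(\<Sum>ys\<in>?L. \<Sum>b'\<in>B. kmat Phi e (v # vs) xs (False # ys) b b' * lo c ys b') = 0"
      using True x by simp
    moreover have "(\<Sum>ys\<in>?L. \<Sum>b'\<in>B. kmat Phi e (v # vs) xs (True # ys) b b' * hi c ys b')
        = sgn_if (\<not> e) (K.kd e vs (hi c) xs' b)"
      using True x IH[of "hi c"] by (simp add: sgn_if_mult sgn_if_sum sum_negf)
    ultimately show ?thesis using True x by (simp add: join_def sgn_if_apply)
  next
    case False
    have 1: "(\<Sum>ys\<in>?L. \<Sum>b'\<in>B. kmat Phi e (v # vs) xs (False # ys) b b' * lo c ys b')
        = sgn_if e (K.kd e vs (lo c) xs' b)"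
      using False x IH[of "lo c"] by (simp add: sgn_if_mult sgn_if_sum)
    have "(\<Sum>ys\<in>?L. \<Sum>b'\<in>B. kmat Phi e (v # vs) xs (True # ys) b b' * hi c ys b')
        = (\<Sum>ys\<in>?L. if ys = xs' then \<Sum>b'\<in>B. Phi v b b' * hi c xs' b' else 0)"
      by (rule sum.cong) (use False x in auto)
    also have "\<dots> = (\<Sum>b'\<in>B. Phi v b b' * hi c xs' b')"
      using x(2) finite_bool_lists by simp
    also have "\<dots> = act v (hi c xs') b" using Cons.prems(2) by (simp add: app_def)
    finally show ?thesis using 1 False x by (simp add: join_def sgn_if_apply K.phis_def)
  qed
  finally show ?case .
qed

definition curry_chain :: "('b \<times> bool list \<Rightarrow> ('n, 'k) mpoly) \<Rightarrow> bool list \<Rightarrow> 'b \<Rightarrow> ('n, 'k) mpoly" where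
  "curry_chain u = (\<lambda>ys b. u (b, ys))"

abbreviation "idx vs \<equiv> koszul_idx B (length vs)"

lemma app_kmatrix:
  assumes u: "u \<in> vecs (idx vs)"
  shows "curry_chain (app (idx vs) (kmatrix Phi e vs) u) = K.kd e vs (curry_chain u)"
proof (intro ext)
  fix xs b
  have uc: "curry_chain u \<in> K.chains vs"
    using u unfolding chains_iff by (auto simp: curry_chain_def vecs_def koszul_idx_def fun_eq_iff)
  show "curry_chain (app (idx vs) (kmatrix Phi e vs) u) xs b = K.kd e vs (curry_chain u) xs b"
  proof (cases "b \<in> B \<and> length xs = length vs")
    case True
    have "curry_chain (app (idx vs) (kmatrix Phi e vs) u) xs b
        = (\<Sum>b'\<in>B. \<Sum>ys | length ys = length vs. kmat Phi e vs xs ys b b' * u (b', ys))"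
      using True finB finite_bool_lists unfolding curry_chain_def app_def koszul_idx_def kmatrix_def
      by (simp add: sum.cartesian_product split_def)
    also have "\<dots> = (\<Sum>ys | length ys = length vs. \<Sum>b'\<in>B. kmat Phi e vs xs ys b b' * curry_chain u ys b')"
      by (subst sum.swap) (simp add: curry_chain_def)
    also have "\<dots> = K.kd e vs (curry_chain u) xs b" by (rule kmat_kd) (use True in auto)
    finally show ?thesis .
  next
    case False
    have "K.kd e vs (curry_chain u) \<in> K.chains vs" by (rule K.kd_chains[OF uc])
    then have "K.kd e vs (curry_chain u) xs b = 0"
      using False unfolding chains_iff by (auto simp: vecs_def)
    moreover have "curry_chain (app (idx vs) (kmatrix Phi e vs) u) xs b = 0"
      using False by (auto simp: curry_chain_def app_def koszul_idx_def)
    ultimately show ?thesis by simp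
  qed
qed

lemma curry_chain_chains: "u \<in> vecs (idx vs) \<Longrightarrow> curry_chain u \<in> K.chains vs"
  unfolding chains_iff by (auto simp: curry_chain_def vecs_def koszul_idx_def fun_eq_iff)

lemma chains_curry: "w \<in> K.chains vs \<Longrightarrow> \<exists>u\<in>vecs (idx vs). curry_chain u = w"
proof (intro bexI)
  show "curry_chain (\<lambda>(b, ys). w ys b) = w" by (simp add: curry_chain_def)
  assume "w \<in> K.chains vs"
  then show "(\<lambda>(b, ys). w ys b) \<in> vecs (idx vs)"
    unfolding chains_iff by (auto simp: vecs_def koszul_idx_def)
qed

lemma curry_chain_eq_iff: "curry_chain u = curry_chain u' \<longleftrightarrow> u = u'"
  by (auto simp: curry_chain_def fun_eq_iff)

lemma Phi_keys:
  assumes "\<alpha> \<in> keys (Phi v b b')"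
    and "X v b b' \<noteq> 0 \<Longrightarrow> dg b = dg b' + 1"
  shows "int (mdeg \<alpha>) + dg b = dg b' + (1::int)"
proof -
  from assms(1) have "\<alpha> \<in> keys (if b = b' then Xvar v else 0 :: ('n, 'k) mpoly) \<or> \<alpha> \<in> keys (Const (X v b b'))"
    unfolding Phi_def by (rule keys_diff_cases)
  then show ?thesis using assms(2) by (auto simp: Xvar_def split: if_splits)
qed

text \<open>\<open>\<beta>\<close> represents a basis of A, \<open>dg\<close> gives its degrees and
  \<open>c0\<close> the coordinates of 1. They are kept general, rather than monomials with
  \<open>mdeg\<close>, so that the theorem also covers the dual basis, whose degrees are
  negative.\<close>

theorem koszul_cyclic_resolution:
  fixes \<beta> :: "'b \<Rightarrow> ('n, 'k) mpoly" and dg :: "'b \<Rightarrow> int"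
  assumes vs: "distinct vs" "set vs = UNIV" and I: "is_ideal I"
    and mult: "\<And>v b. b \<in> B \<Longrightarrow> Xvar v * \<beta> b - (\<Sum>b'\<in>B. Const (X v b' b) * \<beta> b') \<in> I"
    and indep: "\<And>c b. (\<Sum>b\<in>B. Const (c b) * \<beta> b) \<in> I \<Longrightarrow> b \<in> B \<Longrightarrow> c b = 0"
    and dg: "\<And>v b b'. b \<in> B \<Longrightarrow> b' \<in> B \<Longrightarrow> X v b b' \<noteq> 0 \<Longrightarrow> dg b = dg b' + 1"
    and unit: "1 - (\<Sum>b\<in>B. Const (c0 b) * \<beta> b) \<in> I" "\<And>b. b \<in> B \<Longrightarrow> c0 b \<noteq> 0 \<Longrightarrow> dg b = \<delta>"
  shows "cyclic_resolution (koszul_idx B CARD('n)) (\<lambda>(b, xs). int (count_True xs))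
     (\<lambda>(b, xs). dg b + int (count_True xs)) (kmatrix Phi e vs) I \<delta>"
proof -
  let ?S = "koszul_idx B CARD('n)" and ?h = "\<lambda>(b::'b, xs). int (count_True xs)"
    and ?a = "\<lambda>(b, xs). dg b + int (count_True xs)" and ?D = "kmatrix Phi e vs"
  have len: "length vs = CARD('n)" using distinct_card[OF vs(1)] vs(2) by simp
  have S: "?S = idx vs" by (simp add: len)
  \<comment> \<open>The multiplication map from R tensor A to A. Its kernel modulo \<open>I\<close>
    turns out to be \<open>K.imgs vs\<close>, which identifies the homology in degree 0.\<close>
  define \<theta> where "\<theta> u = (\<Sum>b\<in>B. u b * \<beta> b)" for u
  have \<theta>_add: "\<theta> (\<lambda>j. u j + w j) = \<theta> u + \<theta> w" for u w by (simp add: \<theta>_def algebra_simps sum.distrib)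
  have \<theta>_act: "\<theta> (act v u) \<in> I" for v u
  proof -
    have "\<theta> (act v u) = (\<Sum>b\<in>B. u b * (Xvar v * \<beta> b)) - (\<Sum>b\<in>B. \<Sum>c\<in>B. Const (X v b c) * u c * \<beta> b)"
      unfolding \<theta>_def sum_subtractf[symmetric]
      by (rule sum.cong) (auto simp: act_eq algebra_simps sum_distrib_left)
    also have "(\<Sum>b\<in>B. \<Sum>c\<in>B. Const (X v b c) * u c * \<beta> b) = (\<Sum>c\<in>B. u c * (\<Sum>b\<in>B. Const (X v b c) * \<beta> b))"
      by (subst sum.swap) (simp add: sum_distrib_left mult.assoc mult.left_commute)
    also have "(\<Sum>b\<in>B. u b * (Xvar v * \<beta> b)) - \<dots> = (\<Sum>b\<in>B. u b * (Xvar v * \<beta> b - (\<Sum>b'\<in>B. Const (X v b' b) * \<beta> b')))"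
      by (simp add: sum_subtractf right_diff_distrib)
    also have "\<dots> \<in> I" by (intro is_ideal_sum[OF I] is_idealD(3)[OF I] mult)
    finally show ?thesis .
  qed
  have imgs_\<theta>: "x \<in> K.imgs ws \<Longrightarrow> \<theta> x \<in> I" for x ws
  proof (induction ws arbitrary: x)
    case Nil
    then show ?case using is_idealD(1)[OF I] by (simp add: \<theta>_def)
  next
    case (Cons w ws)
    then obtain y z where "x = act w y + z" "z \<in> K.imgs ws" by auto
    then have "\<theta> x = \<theta> (act w y) + \<theta> z" using \<theta>_add[of "act w y" z] by (simp add: plus_fun_def)
    then show ?case using Cons.IH[OF \<open>z \<in> K.imgs ws\<close>] \<theta>_act is_idealD(2)[OF I] by metis
  qed
  \<comment> \<open>Modulo the images a vector is free of all variables, hence constant;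
    independence of the basis then makes it 0.\<close>
  have \<theta>_imgs: "x \<in> K.imgs vs" if x: "x \<in> vecs B" "\<theta> x \<in> I" for x
  proof -
    obtain r y where r: "r \<in> vecs B" "y \<in> K.imgs vs" "x = r + y" "\<forall>v\<in>set vs. r \<in> free_of v"
      using K.split_list[OF x(1), of vs] by blast
    have "\<theta> x = \<theta> r + \<theta> y" using \<theta>_add[of r y] r(3) by (simp add: plus_fun_def)
    then have "\<theta> r = \<theta> x - \<theta> y" by simp
    then have \<theta>r: "\<theta> r \<in> I" using is_idealD(5)[OF I x(2) imgs_\<theta>[OF r(2)]] by simp
    have rc: "r b = Const (ccoeff (r b))" if b: "b \<in> B" for b
    proof (rule homog_0_Const)
      have "lookup \<alpha> v = 0" if "\<alpha> \<in> keys (r b)" for \<alpha> v using r(4) vs(2) that b by (auto simp: free_of_def)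
      then show "homog 0 (r b)" by (auto simp: homog_def mdeg_UNIV)
    qed
    have "\<theta> r = (\<Sum>b\<in>B. Const (ccoeff (r b)) * \<beta> b)" unfolding \<theta>_def by (rule sum.cong) (simp_all add: rc[symmetric])
    then have "ccoeff (r b) = 0" if "b \<in> B" for b using indep[of "\<lambda>b. ccoeff (r b)"] \<theta>r that by simp
    then have "r b = 0" for b using rc[of b] r(1) by (cases "b \<in> B") (auto simp: vecs_def)
    then have "r = 0" by (simp add: fun_eq_iff)
    then show ?thesis using r by simp
  qed
  have kd: "curry_chain (app ?S ?D u) = K.kd e vs (curry_chain u)" if "u \<in> vecs ?S" for u
    using app_kmatrix that unfolding S by blast
  have bot: "j \<in> ?S \<Longrightarrow> ?h j = 0 \<longleftrightarrow> snd j = bottom_idx vs" for j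
    using count_True_0[of "snd j"] by (auto simp: koszul_idx_def len split_def)
  have bot_set: "{j\<in>?S. ?h j = 0} = B \<times> {bottom_idx vs}"
    using bot by (auto simp: koszul_idx_def len)
  have at_bot: "curry_chain w = at_bottom vs (\<lambda>b. w (b, bottom_idx vs))" "(\<lambda>b. w (b, bottom_idx vs)) \<in> vecs B"
    if "w \<in> vecs {j\<in>?S. ?h j = 0}" for w
    using that unfolding bot_set by (auto simp: curry_chain_def at_bottom_def vecs_def fun_eq_iff)
  have in_im: "(\<exists>u\<in>vecs ?S. w = app ?S ?D u) \<longleftrightarrow> \<theta> (\<lambda>b. w (b, bottom_idx vs)) \<in> I"
    if w: "w \<in> vecs {j\<in>?S. ?h j = 0}" for w
  proof
    assume "\<exists>u\<in>vecs ?S. w = app ?S ?D u"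
    then obtain u where u: "u \<in> vecs ?S" "w = app ?S ?D u" by blast
    have "K.kd e vs (curry_chain u) (bottom_idx vs) \<in> K.imgs vs"
      by (rule K.kd_bottom_in_imgs) (use curry_chain_chains u(1) in \<open>simp add: S\<close>)
    then have "curry_chain w (bottom_idx vs) \<in> K.imgs vs" using kd[OF u(1)] u(2) by simp
    then have "\<theta> (curry_chain w (bottom_idx vs)) \<in> I" by (rule imgs_\<theta>)
    then show "\<theta> (\<lambda>b. w (b, bottom_idx vs)) \<in> I" by (simp add: curry_chain_def)
  next
    assume "\<theta> (\<lambda>b. w (b, bottom_idx vs)) \<in> I"
    then have "(\<lambda>b. w (b, bottom_idx vs)) \<in> K.imgs vs" using \<theta>_imgs at_bot(2)[OF w] by blast
    then obtain c where c: "c \<in> K.chains vs" "K.kd e vs c = curry_chain w"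
      using K.imgs_kd[of _ vs e] at_bot(1)[OF w] by metis
    then obtain u where u: "u \<in> vecs ?S" "curry_chain u = c" using chains_curry S by metis
    then have "curry_chain w = curry_chain (app ?S ?D u)" using kd c(2) by simp
    then show "\<exists>u\<in>vecs ?S. w = app ?S ?D u" using u(1) by (auto simp: curry_chain_eq_iff)
  qed
  have cx: "cplx ?S ?h ?D"
    unfolding cplx_def
  proof (intro conjI)
    show fin: "finite ?S" by (rule finite_koszul_idx[OF finB])
    show "\<forall>j\<in>?S. 0 \<le> ?h j" by auto
    show "\<forall>j\<in>?S. \<forall>k\<in>?S. ?D j k \<noteq> 0 \<longrightarrow> ?h k = ?h j + 1"
      by (auto simp: koszul_idx_def kmatrix_def len dest!: kmat_count[rotated 2])
    have "app ?S ?D (app ?S ?D v) = (\<lambda>_. 0)" if v: "v \<in> vecs ?S" for v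
    proof -
      have "curry_chain (app ?S ?D (app ?S ?D v)) = K.kd e vs (K.kd e vs (curry_chain v))"
        using kd[OF app_vecs] kd[OF v] by simp
      also have "\<dots> = 0" by (rule K.kd_kd) (use v curry_chain_chains in \<open>simp add: S\<close>)
      also have "\<dots> = curry_chain (\<lambda>_. 0)" by (auto simp: curry_chain_def fun_eq_iff)
      finally show ?thesis by (simp only: curry_chain_eq_iff)
    qed
    then show "\<forall>i\<in>?S. \<forall>j\<in>?S. (\<Sum>k\<in>?S. ?D i k * ?D k j) = 0" using square_zero_iff[OF fin] by blast
  qed
  moreover have "graded ?S ?a ?D"
    unfolding graded_def
  proof (intro ballI)
    fix j k \<alpha> assume jk: "j \<in> ?S" "k \<in> ?S" and \<alpha>: "\<alpha> \<in> keys (?D j k)"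
    obtain b xs b' ys where bx: "j = (b, xs)" "k = (b', ys)" by (metis surj_pair)
    then have B: "b \<in> B" "b' \<in> B" "length xs = length vs" "length ys = length vs" using jk by (auto simp: koszul_idx_def len)
    have \<alpha>': "\<alpha> \<in> keys (kmat Phi e vs xs ys b b')" using \<alpha> bx by (simp add: kmatrix_def)
    then have "kmat Phi e vs xs ys b b' \<noteq> 0" by auto
    then have cnt: "count_True ys = count_True xs + 1" using kmat_count B by metis
    obtain v where "\<alpha> \<in> keys (Phi v b b')" using kmat_keys[OF \<alpha>'] by blast
    then have "int (mdeg \<alpha>) + dg b = dg b' + 1" using Phi_keys dg B by metis
    then show "int (mdeg \<alpha>) + ?a j = ?a k" using cnt bx by simp
  qed
  moreover have "acyclic_above ?S ?h ?D"
    unfolding acyclic_above_def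
  proof (intro ballI impI)
    fix v assume v: "v \<in> vecs ?S" and 0: "(\<forall>j\<in>?S. ?h j = 0 \<longrightarrow> v j = 0) \<and> app ?S ?D v = (\<lambda>_. 0)"
    have "\<exists>w\<in>K.chains vs. curry_chain v = K.kd e vs w"
    proof (rule K.koszul_exact[OF K.regular_distinct[OF vs(1)]])
      show "curry_chain v \<in> K.chains vs" using v curry_chain_chains by (simp add: S)
      have "v (b, bottom_idx vs) = 0" for b
      proof (cases "b \<in> B")
        case True
        then show ?thesis using 0 bot_set by blast
      qed (use v in \<open>simp add: vecs_def koszul_idx_def\<close>)
      then show "curry_chain v (bottom_idx vs) = 0" by (simp add: curry_chain_def fun_eq_iff)
      show "K.kd e vs (curry_chain v) = 0" using kd[OF v] 0 by (simp add: curry_chain_def fun_eq_iff)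
    qed
    then obtain w where w: "w \<in> K.chains vs" "curry_chain v = K.kd e vs w" by blast
    then obtain u where u: "u \<in> vecs ?S" "curry_chain u = w" using chains_curry S by metis
    then have "curry_chain v = curry_chain (app ?S ?D u)" using kd w(2) by simp
    then show "\<exists>u\<in>vecs ?S. v = app ?S ?D u" using u(1) by (auto simp: curry_chain_eq_iff)
  qed
  moreover define g where "g = (\<lambda>(b, xs). if b \<in> B \<and> xs = bottom_idx vs then Const (c0 b) else (0 :: ('n, 'k) mpoly))"
  have g_bot: "g \<in> vecs {j\<in>?S. ?h j = 0}" unfolding bot_set by (auto simp: vecs_def g_def)
  have \<theta>g: "\<theta> (\<lambda>b. r * g (b, bottom_idx vs)) = r * (\<Sum>b\<in>B. Const (c0 b) * \<beta> b)" for r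
    unfolding \<theta>_def sum_distrib_left by (rule sum.cong) (auto simp: g_def mult.assoc)
  have rI: "r - r * (\<Sum>b\<in>B. Const (c0 b) * \<beta> b) \<in> I" for r
    using is_idealD(3)[OF I unit(1), of r] by (simp add: right_diff_distrib)
  have "coker_gen ?S ?h ?D I g"
    unfolding coker_gen_def
  proof (intro conjI ballI allI)
    show "g \<in> vecs {j\<in>?S. ?h j = 0}" by (rule g_bot)
  next
    fix w :: "'b \<times> bool list \<Rightarrow> ('n, 'k) mpoly" assume w: "w \<in> vecs {j\<in>?S. ?h j = 0}"
    define r where "r = \<theta> (\<lambda>b. w (b, bottom_idx vs))"
    define w' where "w' = (\<lambda>j. w j - r * g j)"
    have w': "w' \<in> vecs {j\<in>?S. ?h j = 0}" using w g_bot by (auto simp: vecs_def w'_def)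
    have "\<theta> (\<lambda>b. w' (b, bottom_idx vs)) = r - \<theta> (\<lambda>b. r * g (b, bottom_idx vs))"
      by (simp add: w'_def r_def \<theta>_def left_diff_distrib sum_subtractf)
    then have "\<theta> (\<lambda>b. w' (b, bottom_idx vs)) \<in> I" using rI[of r] \<theta>g by simp
    then obtain u where u: "u \<in> vecs ?S" "w' = app ?S ?D u" using in_im[OF w'] by blast
    have "w = (\<lambda>j. r * g j + app ?S ?D u j)"
    proof
      fix j
      have "w' j = app ?S ?D u j" using u(2) by simp
      then show "w j = r * g j + app ?S ?D u j" by (simp add: w'_def algebra_simps)
    qed
    then show "\<exists>r. \<exists>u\<in>vecs ?S. w = (\<lambda>j. r * g j + app ?S ?D u j)" using u(1) by blast
  next
    fix r
    have rg: "(\<lambda>j. r * g j) \<in> vecs {j\<in>?S. ?h j = 0}" using g_bot by (auto simp: vecs_def)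
    have "(\<exists>u\<in>vecs ?S. (\<lambda>j. r * g j) = app ?S ?D u) \<longleftrightarrow> r * (\<Sum>b\<in>B. Const (c0 b) * \<beta> b) \<in> I"
      using in_im[OF rg] \<theta>g by simp
    also have "\<dots> \<longleftrightarrow> r \<in> I"
    proof
      assume *: "r * (\<Sum>b\<in>B. Const (c0 b) * \<beta> b) \<in> I"
      show "r \<in> I" using is_idealD(2)[OF I rI[of r] *] by simp
    qed (rule is_idealD(4)[OF I])
    finally show "(\<exists>u\<in>vecs ?S. (\<lambda>j. r * g j) = app ?S ?D u) \<longleftrightarrow> r \<in> I" .
  qed
  moreover have "graded_vec ?S ?a \<delta> g"
    unfolding graded_vec_def
  proof (intro ballI)
    fix j \<alpha> assume "j \<in> ?S" and \<alpha>: "\<alpha> \<in> keys (g j)"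
    obtain b xs where j: "j = (b, xs)" by (metis surj_pair)
    with \<alpha> have b: "b \<in> B" "xs = bottom_idx vs" "\<alpha> \<in> keys (Const (c0 b))" by (auto simp: g_def split: if_splits)
    then have "c0 b \<noteq> 0" "\<alpha> = 0" by (auto split: if_splits)
    moreover have "count_True xs = 0" using b(2) by (simp add: count_True_0)
    ultimately show "int (mdeg \<alpha>) + ?a j = \<delta>" using unit(2)[OF b(1)] j by simp
  qed
  ultimately show ?thesis unfolding cyclic_resolution_def by blast
qed

end

section \<open>A self-dual resolution of a graded Gorenstein algebra\<close>

lemma homogeneous_system_nontrivial:
  fixes A :: "'r \<Rightarrow> 'c \<Rightarrow> 'k::field"
  assumes "finite R" "finite C" "card R < card C"
  shows "\<exists>c. (\<exists>j\<in>C. c j \<noteq> 0) \<and> (\<forall>i\<in>R. (\<Sum>j\<in>C. A i j * c j) = 0)"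
  using assms
proof (induction R arbitrary: C A rule: finite_induct)
  case empty
  then obtain j where "j \<in> C" by fastforce
  then show ?case by (intro exI[of _ "\<lambda>_. 1"]) auto
next
  case (insert i R)
  show ?case
  proof (cases "\<forall>j\<in>C. A i j = 0")
    case True
    obtain c where "\<exists>j\<in>C. c j \<noteq> 0" "\<forall>i\<in>R. (\<Sum>j\<in>C. A i j * c j) = 0"
      using insert.IH[of C A] insert.prems insert.hyps by auto
    then show ?thesis using True by (intro exI[of _ c]) auto
  next
    case False
    \<comment> \<open>Pivot: equation \<open>i\<close> is solved for the unknown \<open>j0\<close>,
      which is eliminated from the other equations.\<close>
    then obtain j0 where j0: "j0 \<in> C" "A i j0 \<noteq> 0" by blast
    let ?C = "C - {j0}"
    have cC: "card R < card ?C" using insert.prems insert.hyps j0 by simp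
    obtain c where c: "\<exists>j\<in>?C. c j \<noteq> 0" "\<forall>k\<in>R. (\<Sum>j\<in>?C. (A k j - A k j0 * A i j / A i j0) * c j) = 0"
      using insert.IH[of ?C "\<lambda>k j. A k j - A k j0 * A i j / A i j0"] insert.prems(1) cC by blast
    define T where "T = (\<Sum>j\<in>?C. A i j * c j)"
    define c' where "c' = (\<lambda>j. if j = j0 then - T / A i j0 else c j)"
    have sum': "(\<Sum>j\<in>C. A k j * c' j) = (\<Sum>j\<in>?C. A k j * c j) - A k j0 * T / A i j0" for k
    proof -
      have "(\<Sum>j\<in>C. A k j * c' j) = A k j0 * c' j0 + (\<Sum>j\<in>?C. A k j * c' j)"
        by (rule sum.remove) (use insert.prems j0 in auto)
      also have "(\<Sum>j\<in>?C. A k j * c' j) = (\<Sum>j\<in>?C. A k j * c j)"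
        by (rule sum.cong) (auto simp: c'_def)
      finally show ?thesis by (simp add: c'_def)
    qed
    have "(\<Sum>j\<in>C. A k j * c' j) = 0" if "k \<in> insert i R" for k
    proof (cases "k = i")
      case True
      then show ?thesis using j0(2) by (simp add: sum' T_def)
    next
      case False
      then have "(\<Sum>j\<in>?C. (A k j - A k j0 * A i j / A i j0) * c j) = 0" using c(2) that by blast
      moreover have "(\<Sum>j\<in>?C. (A k j - A k j0 * A i j / A i j0) * c j) = (\<Sum>j\<in>?C. A k j * c j) - A k j0 * T / A i j0"
        by (simp add: T_def left_diff_distrib sum_subtractf sum_distrib_left sum_divide_distrib mult.assoc)
      ultimately show ?thesis by (simp add: sum')
    qed
    moreover have "\<exists>j\<in>C. c' j \<noteq> 0" using c(1) by (auto simp: c'_def)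
    ultimately show ?thesis by blast
  qed
qed

text \<open>The extra unknown \<open>None\<close> carries the right-hand side as a column. Now there
  are more unknowns than equations, and injectivity forces the \<open>None\<close> coordinate of a
  nontrivial solution to be nonzero, so it can be scaled to 1.\<close>

lemma square_system_solvable:
  fixes Q :: "'b \<Rightarrow> 'b \<Rightarrow> 'k::field"
  assumes fin: "finite B"
    and inj: "\<And>c b. (\<And>i. i \<in> B \<Longrightarrow> (\<Sum>j\<in>B. Q i j * c j) = 0) \<Longrightarrow> b \<in> B \<Longrightarrow> c b = 0"
  shows "\<exists>c. \<forall>i\<in>B. (\<Sum>j\<in>B. Q i j * c j) = y i"
proof -
  let ?C = "insert None (Some ` B)"
  let ?A = "\<lambda>i j. case j of None \<Rightarrow> - y i | Some j \<Rightarrow> Q i j"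
  have "card ?C = card B + 1" using fin by (subst card_insert_disjoint) (auto simp: card_image)
  then have "\<exists>c. (\<exists>j\<in>?C. c j \<noteq> 0) \<and> (\<forall>i\<in>B. (\<Sum>j\<in>?C. ?A i j * c j) = 0)"
    using fin by (intro homogeneous_system_nontrivial) auto
  then obtain c where c: "\<exists>j\<in>?C. c j \<noteq> 0" "\<forall>i\<in>B. (\<Sum>j\<in>?C. ?A i j * c j) = 0" by blast
  have eq: "(\<Sum>j\<in>B. Q i j * c (Some j)) = y i * c None" if "i \<in> B" for i
  proof -
    have "(\<Sum>j\<in>?C. ?A i j * c j) = - y i * c None + (\<Sum>j\<in>B. Q i j * c (Some j))"
      using fin by (subst sum.insert) (auto simp: sum.reindex)
    then show ?thesis using c(2) that by (simp add: eq_neg_iff_add_eq_0 add.commute)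
  qed
  have "c None \<noteq> 0"
  proof
    assume 0: "c None = 0"
    then have "c (Some b) = 0" if "b \<in> B" for b using inj[of "\<lambda>j. c (Some j)" b] eq that by simp
    then show False using 0 c(1) by auto
  qed
  then have "(\<Sum>j\<in>B. Q i j * (c (Some j) / c None)) = y i" if "i \<in> B" for i
    using eq[OF that] by (simp add: sum_divide_distrib[symmetric])
  then show ?thesis by (intro exI[of _ "\<lambda>j. c (Some j) / c None"] ballI)
qed

text \<open>Both sides are coordinates of x_v x_w \<open>\<beta> b'\<close> modulo \<open>I\<close>,
  and coordinates are unique.\<close>

lemma multiplication_matrices_commute:
  fixes \<beta> :: "'b \<Rightarrow> ('n::finite, 'k::field) mpoly"
  assumes I: "is_ideal I" and fin: "finite B"
    and mult: "\<And>v b. b \<in> B \<Longrightarrow> Xvar v * \<beta> b - (\<Sum>b'\<in>B. Const (X v b' b) * \<beta> b') \<in> I"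
    and indep: "\<And>c b. (\<Sum>b\<in>B. Const (c b) * \<beta> b) \<in> I \<Longrightarrow> b \<in> B \<Longrightarrow> c b = 0"
    and b: "b \<in> B" "b' \<in> B"
  shows "(\<Sum>c\<in>B. X v b c * X w c b') = (\<Sum>c\<in>B. X w b c * X v c b')"
proof -
  have prod: "Xvar v * (Xvar w * \<beta> b') - (\<Sum>d\<in>B. Const (\<Sum>c\<in>B. X v d c * X w c b') * \<beta> d) \<in> I" for v w
  proof -
    have 1: "Xvar v * (Xvar w * \<beta> b' - (\<Sum>c\<in>B. Const (X w c b') * \<beta> c)) \<in> I"
      using mult[OF b(2)] is_idealD(3)[OF I] by blast
    have 2: "(\<Sum>c\<in>B. Const (X w c b') * (Xvar v * \<beta> c - (\<Sum>d\<in>B. Const (X v d c) * \<beta> d))) \<in> I"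
      by (intro is_ideal_sum[OF I] is_idealD(3)[OF I] mult)
    have "(\<Sum>c\<in>B. Const (X w c b') * (\<Sum>d\<in>B. Const (X v d c) * \<beta> d))
        = (\<Sum>d\<in>B. Const (\<Sum>c\<in>B. X v d c * X w c b') * \<beta> d)"
      unfolding sum_distrib_left Const_sum sum_distrib_right
      by (subst sum.swap, intro sum.cong refl) (simp add: mult.assoc[symmetric] Const_mult mult.commute[of "X w _ _"])
    then have "Xvar v * (Xvar w * \<beta> b' - (\<Sum>c\<in>B. Const (X w c b') * \<beta> c))
      + (\<Sum>c\<in>B. Const (X w c b') * (Xvar v * \<beta> c - (\<Sum>d\<in>B. Const (X v d c) * \<beta> d)))
      = Xvar v * (Xvar w * \<beta> b') - (\<Sum>d\<in>B. Const (\<Sum>c\<in>B. X v d c * X w c b') * \<beta> d)"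
      by (simp add: right_diff_distrib sum_subtractf sum_distrib_left mult.left_commute)
    then show ?thesis using is_idealD(2)[OF I 1 2] by simp
  qed
  have "(Xvar w * (Xvar v * \<beta> b') - (\<Sum>d\<in>B. Const (\<Sum>c\<in>B. X w d c * X v c b') * \<beta> d))
      - (Xvar v * (Xvar w * \<beta> b') - (\<Sum>d\<in>B. Const (\<Sum>c\<in>B. X v d c * X w c b') * \<beta> d)) \<in> I"
    by (rule is_idealD(5)[OF I prod prod])
  also have "(Xvar w * (Xvar v * \<beta> b') - (\<Sum>d\<in>B. Const (\<Sum>c\<in>B. X w d c * X v c b') * \<beta> d))
      - (Xvar v * (Xvar w * \<beta> b') - (\<Sum>d\<in>B. Const (\<Sum>c\<in>B. X v d c * X w c b') * \<beta> d))
    = (\<Sum>d\<in>B. Const ((\<Sum>c\<in>B. X v d c * X w c b') - (\<Sum>c\<in>B. X w d c * X v c b')) * \<beta> d)"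
    by (simp add: single_diff left_diff_distrib sum_subtractf mult.left_commute)
  finally have "(\<Sum>c\<in>B. X v b c * X w c b') - (\<Sum>c\<in>B. X w b c * X v c b') = 0" by (rule indep[OF _ b(1)])
  then show ?thesis by simp
qed

section \<open>Monomial basis, dual basis and the two resolutions\<close>

context dual_functional
begin

lemma lam_mult_Const: "lam (q * (Const c * p)) = c * lam (q * p)"
  unfolding mult.left_commute[of q "Const c" p] by (rule lam_Const)

lemma lam_mult_sum: "lam (q * (\<Sum>x\<in>A. Const (c x) * p x)) = (\<Sum>x\<in>A. c x * lam (q * p x))"
  by (simp add: sum_distrib_left lam_sum lam_mult_Const)

definition independent :: "('n \<Rightarrow>\<^sub>0 nat) set \<Rightarrow> bool" where
  "independent B \<longleftrightarrow> (\<forall>c. (\<Sum>b\<in>B. Const (c b) * single b 1) \<in> I \<longrightarrow> (\<forall>b\<in>B. c b = 0))"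

text \<open>A largest independent set among the finitely many monomials of degree at most
  \<open>s\<close>; all monomials of higher degree lie in \<open>I\<close>.\<close>

lemma monomial_basis_exists:
  "\<exists>B. finite B \<and> independent B \<and> (\<forall>\<alpha>. \<exists>c. single \<alpha> 1 - (\<Sum>b\<in>B. Const (c b) * single b 1) \<in> I)"
proof -
  let ?M = "{\<alpha> :: 'n \<Rightarrow>\<^sub>0 nat. mdeg \<alpha> \<le> s}"
  let ?P = "\<lambda>B. B \<subseteq> ?M \<and> independent B"
  have finM: "finite ?M" by (rule finite_mdeg_le)
  have "finite (card ` {B. ?P B})" using finite_subset[of "{B. ?P B}" "Pow ?M"] finM by auto
  moreover have "card ` {B. ?P B} \<noteq> {}" by (auto simp: independent_def intro!: exI[of _ "{}"])
  ultimately have "Max (card ` {B. ?P B}) \<in> card ` {B. ?P B}" by (rule Max_in)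
  then obtain B where B: "?P B" "card B = Max (card ` {B. ?P B})" by auto
  have max: "card B' \<le> card B" if "?P B'" for B'
    unfolding B(2) by (rule Max_ge) (use \<open>finite (card ` {B. ?P B})\<close> that in auto)
  have finB: "finite B" using B(1) finM finite_subset by blast
  have "\<exists>c. single \<alpha> 1 - (\<Sum>b\<in>B. Const (c b) * single b 1) \<in> I" for \<alpha> :: "'n \<Rightarrow>\<^sub>0 nat"
  proof -
    consider "mdeg \<alpha> > s" | "\<alpha> \<in> B" | "mdeg \<alpha> \<le> s" "\<alpha> \<notin> B" by linarith
    then show ?thesis
    proof cases
      case 1
      then have "single \<alpha> 1 \<in> I" by (intro homog_in_I homog_single) auto
      then show ?thesis by (intro exI[of _ "\<lambda>_. 0"]) simp
    next
      case 2
      have "(\<Sum>b\<in>B. Const (if b = \<alpha> then 1 else 0) * single b 1) = (\<Sum>b\<in>B. if b = \<alpha> then single \<alpha> 1 else (0 :: ('n, 'k) mpoly))"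
        by (rule sum.cong) auto
      also have "\<dots> = single \<alpha> 1" using 2 finB by simp
      finally show ?thesis using is_idealD(1)[OF I_ideal] by (intro exI[of _ "\<lambda>b. if b = \<alpha> then 1 else 0"]) simp
    next
      case 3
      have "\<not> independent (insert \<alpha> B)"
        using max[of "insert \<alpha> B"] 3 B(1) finB by auto
      then obtain c b where c: "(\<Sum>b\<in>insert \<alpha> B. Const (c b) * single b 1) \<in> I" "b \<in> insert \<alpha> B" "c b \<noteq> 0"
        by (auto simp only: independent_def)
      have c1: "Const (c \<alpha>) * single \<alpha> 1 + (\<Sum>b\<in>B. Const (c b) * single b 1) \<in> I"
        using c(1) by (subst (asm) sum.insert[OF finB 3(2)])
      have ca: "c \<alpha> \<noteq> 0"
      proof
        assume 0: "c \<alpha> = 0"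
        then have "\<forall>b\<in>B. c b = 0" using c1 B(1) by (simp add: independent_def)
        then show False using 0 c(2,3) by auto
      qed
      have "Const (inverse (c \<alpha>)) * (Const (c \<alpha>) * single \<alpha> 1 + (\<Sum>b\<in>B. Const (c b) * single b 1)) \<in> I"
        using c1 by (rule is_idealD(3)[OF I_ideal])
      also have "Const (inverse (c \<alpha>)) * (Const (c \<alpha>) * single \<alpha> 1 + (\<Sum>b\<in>B. Const (c b) * single b 1))
          = single \<alpha> 1 - (\<Sum>b\<in>B. Const (- inverse (c \<alpha>) * c b) * single b 1)"
        using ca by (simp add: distrib_left sum_distrib_left mult.assoc[symmetric] Const_mult single_uminus sum_negf)
      finally show ?thesis by (rule exI[of _ "\<lambda>b. - inverse (c \<alpha>) * c b"])
    qed
  qed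
  then show ?thesis using finB B(1) by blast
qed

theorem dual_resolutions_exist:
  "\<exists>(S :: (('n \<Rightarrow>\<^sub>0 nat) \<times> bool list) set) h a D. dual_resolutions S h a D I (int s + int CARD('n))"
proof -
  obtain B where finB: "finite B" and ind: "independent B"
    and span1: "\<And>\<alpha>. \<exists>c. single \<alpha> 1 - (\<Sum>b\<in>B. Const (c b) * single b 1) \<in> I"
    using monomial_basis_exists by blast
  define \<beta> :: "('n \<Rightarrow>\<^sub>0 nat) \<Rightarrow> ('n, 'k) mpoly" where "\<beta> = (\<lambda>b. single b 1)"
  have indep: "c b = 0" if "(\<Sum>b\<in>B. Const (c b) * \<beta> b) \<in> I" "b \<in> B" for c b
    using ind that unfolding independent_def \<beta>_def by blast
  have span: "\<exists>c. p - (\<Sum>b\<in>B. Const (c b) * \<beta> b) \<in> I" for p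
  proof -
    have "\<forall>\<alpha>. \<exists>c. single \<alpha> 1 - (\<Sum>b\<in>B. Const (c b) * \<beta> b) \<in> I" using span1 unfolding \<beta>_def by blast
    from choice[OF this] obtain C where C: "\<And>\<alpha>. single \<alpha> 1 - (\<Sum>b\<in>B. Const (C \<alpha> b) * \<beta> b) \<in> I" by blast
    have "(\<Sum>\<alpha>\<in>keys p. Const (lookup p \<alpha>) * (single \<alpha> 1 - (\<Sum>b\<in>B. Const (C \<alpha> b) * \<beta> b))) \<in> I"
      by (intro is_ideal_sum[OF I_ideal] is_idealD(3)[OF I_ideal] C)
    also have "(\<Sum>\<alpha>\<in>keys p. Const (lookup p \<alpha>) * (single \<alpha> 1 - (\<Sum>b\<in>B. Const (C \<alpha> b) * \<beta> b)))
      = (\<Sum>\<alpha>\<in>keys p. single \<alpha> (lookup p \<alpha>)) - (\<Sum>\<alpha>\<in>keys p. \<Sum>b\<in>B. Const (lookup p \<alpha> * C \<alpha> b) * \<beta> b)"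
      by (simp add: right_diff_distrib sum_subtractf sum_distrib_left mult.assoc[symmetric] Const_mult mult_single)
    also have "(\<Sum>\<alpha>\<in>keys p. \<Sum>b\<in>B. Const (lookup p \<alpha> * C \<alpha> b) * \<beta> b)
        = (\<Sum>b\<in>B. Const (\<Sum>\<alpha>\<in>keys p. lookup p \<alpha> * C \<alpha> b) * \<beta> b)"
      by (subst sum.swap) (simp add: Const_sum sum_distrib_right)
    finally show ?thesis
      unfolding monomial_expansion[symmetric] by (rule exI[of _ "\<lambda>b. \<Sum>\<alpha>\<in>keys p. lookup p \<alpha> * C \<alpha> b"])
  qed
  \<comment> \<open>Since \<open>I\<close> is homogeneous, a form is expanded by basis monomials of
    its own degree. Hence a variable raises basis degrees by exactly 1, as the grading of the
    complex requires.\<close>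
  have hspan: "\<exists>c. p - (\<Sum>b\<in>B. Const (c b) * \<beta> b) \<in> I \<and> (\<forall>b. c b \<noteq> 0 \<longrightarrow> mdeg b = d)" if "homog d p" for p d
  proof -
    obtain c where c: "p - (\<Sum>b\<in>B. Const (c b) * \<beta> b) \<in> I" using span by blast
    have "hcomp d (Const (c b) * \<beta> b) = Const (if mdeg b = d then c b else 0) * \<beta> b" for b
      by (subst hcomp_homog[of "mdeg b"]) (auto simp: \<beta>_def mult_single homog_single)
    then have "hcomp d (p - (\<Sum>b\<in>B. Const (c b) * \<beta> b)) = p - (\<Sum>b\<in>B. Const (if mdeg b = d then c b else 0) * \<beta> b)"
      using that by (simp add: hcomp_diff hcomp_sum hcomp_id)
    then show ?thesis using hcomp_in_I[OF c, of d] by (intro exI[of _ "\<lambda>b. if mdeg b = d then c b else 0"]) auto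
  qed
  have "\<forall>vb. \<exists>c. (case vb of (v, b) \<Rightarrow> Xvar v * \<beta> b - (\<Sum>b'\<in>B. Const (c b') * \<beta> b') \<in> I \<and> (\<forall>b'. c b' \<noteq> 0 \<longrightarrow> mdeg b' = 1 + mdeg b))"
    unfolding split_paired_All split by (intro allI hspan homog_mult homog_Xvar) (simp add: \<beta>_def homog_single)
  from choice[OF this] obtain Y where "\<forall>vb. (case vb of (v, b) \<Rightarrow> Xvar v * \<beta> b - (\<Sum>b'\<in>B. Const (Y vb b') * \<beta> b') \<in> I \<and>
      (\<forall>b'. Y vb b' \<noteq> 0 \<longrightarrow> mdeg b' = 1 + mdeg b))" ..
  then have Y: "\<And>v b. Xvar v * \<beta> b - (\<Sum>b'\<in>B. Const (Y (v, b) b') * \<beta> b') \<in> I"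
      "\<And>v b b'. Y (v, b) b' \<noteq> 0 \<Longrightarrow> mdeg b' = 1 + mdeg b" by fast+
  define X where "X = (\<lambda>v b' b. Y (v, b) b')"
  have mult: "Xvar v * \<beta> b - (\<Sum>b'\<in>B. Const (X v b' b) * \<beta> b') \<in> I" for v b using Y(1) by (simp add: X_def)
  have Xdeg: "X v b b' \<noteq> 0 \<Longrightarrow> mdeg b = 1 + mdeg b'" for v b b' using Y(2) by (simp add: X_def)
  have comm: "(\<Sum>c\<in>B. X v b c * X w c b') = (\<Sum>c\<in>B. X w b c * X v c b')" if "b \<in> B" "b' \<in> B" for b b' v w
    by (rule multiplication_matrices_commute[where \<beta> = \<beta>, OF I_ideal finB])
      (use mult indep that in auto)
  have lam_span: "p \<in> I" if "\<And>b. b \<in> B \<Longrightarrow> lam (\<beta> b * p) = 0" for p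
    unfolding I_eq
  proof (intro CollectI allI)
    fix r
    obtain c where c: "r - (\<Sum>b\<in>B. Const (c b) * \<beta> b) \<in> I" using span by blast
    have "lam ((r - (\<Sum>b\<in>B. Const (c b) * \<beta> b)) * p) = 0" using lam_I[OF is_idealD(4)[OF I_ideal c]] .
    moreover have "lam ((\<Sum>b\<in>B. Const (c b) * \<beta> b) * p) = 0"
      using that by (simp add: sum_distrib_right lam_sum mult.assoc lam_Const)
    ultimately show "lam (r * p) = 0" by (simp add: left_diff_distrib lam_diff)
  qed
  \<comment> \<open>The Gram matrix of the pairing is invertible: a vector in its kernel gives an
    element orthogonal to a spanning set, hence in \<open>I\<close>. Its inverse supplies the
    coordinates of the dual basis.\<close>
  have "\<forall>b. \<exists>c. \<forall>i\<in>B. (\<Sum>j\<in>B. lam (\<beta> i * \<beta> j) * c j) = (if i = b then 1 else 0)"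
  proof (rule allI, rule square_system_solvable[OF finB])
    fix c :: "('n \<Rightarrow>\<^sub>0 nat) \<Rightarrow> 'k" and b assume 0: "\<And>i. i \<in> B \<Longrightarrow> (\<Sum>j\<in>B. lam (\<beta> i * \<beta> j) * c j) = 0" and b: "b \<in> B"
    have "lam (\<beta> i * (\<Sum>j\<in>B. Const (c j) * \<beta> j)) = (\<Sum>j\<in>B. lam (\<beta> i * \<beta> j) * c j)" for i
      unfolding lam_mult_sum by (rule sum.cong) (simp_all add: mult.commute)
    then have "(\<Sum>j\<in>B. Const (c j) * \<beta> j) \<in> I" using 0 by (intro lam_span) simp
    then show "c b = 0" using indep b by blast
  qed
  from choice[OF this] obtain C where
    C: "\<And>b i. i \<in> B \<Longrightarrow> (\<Sum>j\<in>B. lam (\<beta> i * \<beta> j) * C b j) = (if i = b then 1 else 0)" by blast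
  \<comment> \<open>In the dual basis, multiplication by \<open>x\<^sub>v\<close> has the transposed matrix.\<close>
  define \<beta>' where "\<beta>' = (\<lambda>b. \<Sum>j\<in>B. Const (C b j) * \<beta> j)"
  have pair: "lam (\<beta> i * \<beta>' b) = (if i = b then 1 else 0)" if "i \<in> B" for i b
    using C[OF that, of b] unfolding \<beta>'_def lam_mult_sum by (simp add: mult.commute[of "C _ _"])
  have lam_comb: "lam (\<beta> i * (\<Sum>b\<in>B. Const (c b) * \<beta>' b)) = c i" if "i \<in> B" for c i
  proof -
    have "lam (\<beta> i * (\<Sum>b\<in>B. Const (c b) * \<beta>' b)) = (\<Sum>b\<in>B. c b * lam (\<beta> i * \<beta>' b))"
      by (rule lam_mult_sum)
    also have "\<dots> = (\<Sum>b\<in>B. if b = i then c b else 0)"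
      by (rule sum.cong) (use pair[OF that] in auto)
    finally show ?thesis using finB that by simp
  qed
  have mult': "Xvar v * \<beta>' b - (\<Sum>b'\<in>B. Const (X v b b') * \<beta>' b') \<in> I" if b: "b \<in> B" for v b
  proof (rule lam_span)
    fix i assume i: "i \<in> B"
    have "lam ((Xvar v * \<beta> i - (\<Sum>d\<in>B. Const (X v d i) * \<beta> d)) * \<beta>' b) = 0"
      by (rule lam_I[OF is_idealD(4)[OF I_ideal mult]])
    then have "lam (Xvar v * \<beta> i * \<beta>' b) = (\<Sum>d\<in>B. X v d i * lam (\<beta> d * \<beta>' b))"
      by (simp add: left_diff_distrib lam_diff sum_distrib_right lam_sum mult.assoc lam_Const)
    also have "\<dots> = (\<Sum>d\<in>B. if d = b then X v d i else 0)"
      by (rule sum.cong) (use pair in auto)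
    also have "\<dots> = X v b i" using finB b by simp
    finally show "lam (\<beta> i * (Xvar v * \<beta>' b - (\<Sum>b'\<in>B. Const (X v b b') * \<beta>' b'))) = 0"
      using lam_comb[OF i] by (simp add: right_diff_distrib lam_diff mult.assoc mult.left_commute)
  qed
  have indep': "c b = 0" if "(\<Sum>b\<in>B. Const (c b) * \<beta>' b) \<in> I" "b \<in> B" for c b
  proof -
    have "lam (\<beta> b * (\<Sum>b\<in>B. Const (c b) * \<beta>' b)) = 0" using that(1) by (simp add: I_eq)
    then show ?thesis using lam_comb[OF that(2)] by simp
  qed
  \<comment> \<open>The coordinates of 1 in the dual basis are the pairings of 1 with the basis; by
    \<open>lam_homog\<close> only monomials of degree \<open>s\<close> contribute.\<close>
  have unit': "1 - (\<Sum>b\<in>B. Const (lam (\<beta> b)) * \<beta>' b) \<in> I"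
    by (rule lam_span) (simp add: right_diff_distrib lam_diff lam_comb)
  have "homog 0 (1 :: ('n, 'k) mpoly)" by (simp add: homog_def)
  then obtain c0 where c0: "1 - (\<Sum>b\<in>B. Const (c0 b) * \<beta> b) \<in> I" "\<And>b. c0 b \<noteq> 0 \<Longrightarrow> mdeg b = 0" using hspan by blast
  obtain vs where vs: "set vs = (UNIV :: 'n set)" "distinct vs" using finite_distinct_list[of "UNIV :: 'n set"] by auto
  have len: "length vs = CARD('n)" using distinct_card[OF vs(2)] vs(1) by simp
  interpret M: commuting_matrices B X by unfold_locales (use finB comm in auto)
  define X' where "X' = (\<lambda>v b b'. X v b' b)"
  have comm': "(\<Sum>c\<in>B. X' v b c * X' w c b') = (\<Sum>c\<in>B. X' w b c * X' v c b')" if "b \<in> B" "b' \<in> B" for b b' v w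
    using comm[OF that(2,1), of w v] by (simp add: X'_def mult.commute)
  interpret M': commuting_matrices B X' by unfold_locales (use finB comm' in auto)
  let ?S = "koszul_idx B CARD('n)" and ?n = "int CARD('n)"
  let ?h = "\<lambda>(b :: 'n \<Rightarrow>\<^sub>0 nat, xs). int (count_True xs)"
    and ?a = "\<lambda>(b :: 'n \<Rightarrow>\<^sub>0 nat, xs). int (mdeg b) + int (count_True xs)"
  let ?D = "kmatrix M.Phi True vs"
  have "cyclic_resolution ?S ?h ?a ?D I 0"
    by (rule M.koszul_cyclic_resolution[where \<beta> = \<beta> and ?c0.0 = c0])
      (use vs I_ideal mult indep Xdeg c0 in auto)
  \<comment> \<open>The shift by n accounts for complementation: if a subset has c elements, the
    negated twist -(deg + c) is -deg - n plus the size n - c of its complement.\<close>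
  moreover have "cyclic_resolution ?S ?h (\<lambda>(b, xs). (- int (mdeg b) - ?n) + int (count_True xs)) (kmatrix M'.Phi False vs) I (- (int s + ?n))"
  proof (rule M'.koszul_cyclic_resolution[where \<beta> = \<beta>' and ?c0.0 = "\<lambda>b. lam (\<beta> b)"])
    show "- int (mdeg b) - ?n = - int (mdeg b') - ?n + 1" if "X' v b b' \<noteq> 0" for v b b'
      using Xdeg[of v b' b] that by (simp add: X'_def)
    show "- int (mdeg b) - ?n = - (int s + ?n)" if "lam (\<beta> b) \<noteq> 0" for b
    proof -
      have "homog (mdeg b) (\<beta> b)" by (simp add: \<beta>_def homog_single)
      then show ?thesis using lam_homog[of "mdeg b" "\<beta> b"] that by auto
    qed
  qed (use vs I_ideal mult' indep' unit' in \<open>auto simp: X'_def\<close>)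
  then have "cyclic_resolution ?S (\<lambda>j. ?n - ?h j) (\<lambda>j. - ?a j) (\<lambda>j k. ?D k j) I (- (int s + ?n))"
  proof (rule cyclic_resolution_relabel[where \<sigma> = "\<lambda>(b, xs). (b, map Not xs)"])
    fix j k :: "('n \<Rightarrow>\<^sub>0 nat) \<times> bool list"
    obtain b xs b' ys where jk: "j = (b, xs)" "k = (b', ys)" by (metis surj_pair)
    have "map Not (map Not xs) = xs" by (simp add: comp_def)
    then show "(case case j of (b, xs) \<Rightarrow> (b, map Not xs) of (b, xs) \<Rightarrow> (b, map Not xs)) = j"
      by (simp add: jk)
    assume "j \<in> ?S"
    then have j: "b \<in> B" "length xs = CARD('n)" by (auto simp: koszul_idx_def jk)
    then show "(case j of (b, xs) \<Rightarrow> (b, map Not xs)) \<in> ?S" by (auto simp: koszul_idx_def jk)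
    have "int (count_True (map Not xs)) + int (count_True xs) = ?n"
      using count_True_Not[of xs] j(2) by (metis of_nat_add)
    then show "?n - ?h j = ?h (case j of (b, xs) \<Rightarrow> (b, map Not xs))"
      "- ?a j = (case case j of (b, xs) \<Rightarrow> (b, map Not xs) of (b, xs) \<Rightarrow> - int (mdeg b) - ?n + int (count_True xs))"
      by (auto simp: jk)
    assume "k \<in> ?S"
    then have k: "b' \<in> B" "length ys = CARD('n)" by (auto simp: koszul_idx_def jk)
    have P: "(\<lambda>v b b'. M.Phi v b' b) = M'.Phi"
      unfolding M.Phi_def M'.Phi_def by (auto simp: X'_def fun_eq_iff)
    show "?D k j = kmatrix M'.Phi False vs (case j of (b, xs) \<Rightarrow> (b, map Not xs)) (case k of (b, xs) \<Rightarrow> (b, map Not xs))"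
      using kmat_transpose[of ys vs xs M.Phi True b' b] j k len by (simp add: jk kmatrix_def P)
  qed
  ultimately show ?thesis unfolding dual_resolutions_def by blast
qed

end

section \<open>The last twist of a linear resolution\<close>

lemma maximal_ideal_functional:
  "dual_functional {p :: ('n::finite, 'k::field) mpoly. ccoeff p = 0} ccoeff 0"
proof
  fix p q :: "('n, 'k) mpoly" and c :: 'k
  show "ccoeff (p + q) = ccoeff p + ccoeff q" by simp
  show "ccoeff (Const c * p) = c * ccoeff p" by simp
  show "ccoeff (hcomp 0 p) = ccoeff p" by (simp add: ccoeff_def lookup_hcomp)
  show "\<exists>r :: ('n, 'k) mpoly. ccoeff r \<noteq> 0" by (rule exI[of _ 1]) simp
  have "ccoeff g = 0 \<longleftrightarrow> (\<forall>r. ccoeff (r * g) = 0)" for g :: "('n, 'k) mpoly"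
    by (auto dest: spec[of _ 1])
  then show "{p :: ('n, 'k) mpoly. ccoeff p = 0} = {g. \<forall>r. ccoeff (r * g) = 0}" by blast
qed

text \<open>The case \<open>s = 0\<close> of the same construction, in effect the Koszul complex of
  the variables; its dual generator has degree -n.\<close>

lemma minimal_resolution_of_residue_field:
  obtains S :: "(('n::finite \<Rightarrow>\<^sub>0 nat) \<times> bool list) set" and h a
    and D :: "_ \<Rightarrow> _ \<Rightarrow> ('n, 'k::field) mpoly"
  where "minimal_resolution S h a D {p. ccoeff p = 0} 0"
    "minimal_resolution S (\<lambda>j. int CARD('n) - h j) (\<lambda>j. - a j) (\<lambda>j k. D k j) {p. ccoeff p = 0} (- int CARD('n))"
proof -
  interpret dual_functional "{p :: ('n, 'k) mpoly. ccoeff p = 0}" ccoeff 0 by (rule maximal_ideal_functional)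
  obtain S h a and D :: "(('n \<Rightarrow>\<^sub>0 nat) \<times> bool list) \<Rightarrow> _ \<Rightarrow> ('n, 'k) mpoly"
    where K: "dual_resolutions S h a D {p. ccoeff p = 0} (int 0 + int CARD('n))" using dual_resolutions_exist by blast
  from minimal_dual_resolutions[OF K] obtain T and E :: "_ \<Rightarrow> _ \<Rightarrow> ('n, 'k) mpoly"
    where T: "dual_resolutions T h a E {p. ccoeff p = 0} (int 0 + int CARD('n))" "minimal T E" by blast
  show thesis
    by (rule that[of T h a E]; unfold_locales) (use T one_notin_I in \<open>auto simp: dual_resolutions_def minimal_def\<close>)
qed

section \<open>Matrices between free modules, in the format of condition (i)\<close>

lemma matvec_fvecs [simp]: "matvec A r c v \<in> fvecs r"
  by (auto simp: matvec_def fvecs_def)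

lemma matvec_cong: "(\<And>k. k < c \<Longrightarrow> v k = w k) \<Longrightarrow> matvec A r c v = matvec A r c w"
  by (simp add: matvec_def cong: if_cong)

lemma matvec_in_image: "matvec A r c v \<in> matvec A r c ` fvecs c"
proof -
  have "matvec A r c v = matvec A r c (\<lambda>k. if k < c then v k else 0)" by (rule matvec_cong) simp
  moreover have "(\<lambda>k. if k < c then v k else 0) \<in> fvecs c" by (simp add: fvecs_def)
  ultimately show ?thesis by blast
qed

lemma matvec_lincomb:
  "matvec A r c (\<lambda>k. \<Sum>l\<in>S. x l * u l k) = (\<lambda>j. \<Sum>l\<in>S. x l * matvec A r c (u l) j)"
proof
  fix j
  have "(\<Sum>k<c. A j k * (\<Sum>l\<in>S. x l * u l k)) = (\<Sum>l\<in>S. x l * (\<Sum>k<c. A j k * u l k))"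
    unfolding sum_distrib_left by (subst sum.swap) (simp add: mult.left_commute)
  then show "matvec A r c (\<lambda>k. \<Sum>l\<in>S. x l * u l k) j = (\<Sum>l\<in>S. x l * matvec A r c (u l) j)"
    by (simp add: matvec_def)
qed

lemma matvec_diff: "matvec A r c (\<lambda>k. u k - v k) = (\<lambda>j. matvec A r c u j - matvec A r c v j)"
  by (auto simp: matvec_def right_diff_distrib sum_subtractf)

text \<open>Makes the truncated differences in the degrees of the matrix entries true
  differences.\<close>

lemma res_shift_mono: "n \<ge> 2 \<Longrightarrow> i < n \<Longrightarrow> res_shift n d i \<le> res_shift n d (i + 1)"
  by (auto simp: res_shift_def)

lemma linear_gorenstein_resolutionE:
  fixes I :: "('n::finite, 'k::field) mpoly set"
  assumes "linear_gorenstein_resolution I d"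
  obtains b :: "nat \<Rightarrow> nat" and M :: "nat \<Rightarrow> nat \<Rightarrow> nat \<Rightarrow> ('n, 'k) mpoly" where
    "b 0 = 1" "b CARD('n) = 1"
    "\<And>i j k. i \<in> {1..CARD('n)} \<Longrightarrow> j < b (i - 1) \<Longrightarrow> k < b i \<Longrightarrow>
      homog (res_shift CARD('n) d i - res_shift CARD('n) d (i - 1)) (M i j k)"
    "(\<lambda>v. matvec (M 1) 1 (b 1) v 0) ` fvecs (b 1) = I"
    "\<And>i. i \<in> {1..<CARD('n)} \<Longrightarrow> {v\<in>fvecs (b i). matvec (M i) (b (i - 1)) (b i) v = (\<lambda>_. 0)}
      = matvec (M (i + 1)) (b i) (b (i + 1)) ` fvecs (b (i + 1))"
proof -
  let ?n = "CARD('n)"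
  from assms[unfolded linear_gorenstein_resolution_def Let_def]
  obtain b :: "nat \<Rightarrow> nat" and M :: "nat \<Rightarrow> nat \<Rightarrow> nat \<Rightarrow> ('n, 'k) mpoly" where L: "b 0 = 1 \<and> b ?n = 1 \<and>
       (\<forall>i\<in>{1..?n}. \<forall>j<b (i-1). \<forall>k<b i. homog (res_shift ?n d i - res_shift ?n d (i-1)) (M i j k)) \<and>
       (\<lambda>v. matvec (M 1) 1 (b 1) v 0) ` fvecs (b 1) = I \<and>
       (\<forall>i\<in>{1..<?n}. {v\<in>fvecs (b i). matvec (M i) (b (i-1)) (b i) v = (\<lambda>_. 0)}
                     = matvec (M (i+1)) (b i) (b (i+1)) ` fvecs (b (i+1))) \<and>
       (\<forall>v\<in>fvecs (b ?n). matvec (M ?n) (b (?n-1)) (b ?n) v = (\<lambda>_. 0) \<longrightarrow> v = (\<lambda>_. 0))"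
    by (elim exE)
  show thesis by (rule that[of b M]) (use L in blast)+
qed

text \<open>Degree count: the lift sends a basis element of homological degree i to a vector of
  total degree s + i in the i-th module. A nonzero constant coefficient at i = n therefore forces
  the last shift to be s + n.\<close>

lemma linear_resolution_last_shift:
  fixes z :: "('n::finite, 'k::field) mpoly"
  assumes lin: "linear_gorenstein_resolution I d" and n2: "CARD('n) \<ge> 2"
    and z: "homog s z" "z \<notin> I" and high: "\<And>p e. homog e p \<Longrightarrow> e > s \<Longrightarrow> p \<in> I"
  shows "res_shift (CARD('n)) d (CARD('n)) = s + CARD('n)"
proof -
  let ?n = "CARD('n)"
  let ?sh = "res_shift ?n d"
  obtain b M where b0: "b 0 = 1" and bn: "b ?n = 1"
    and hom: "\<And>i j k. i \<in> {1..?n} \<Longrightarrow> j < b (i - 1) \<Longrightarrow> k < b i \<Longrightarrow> homog (?sh i - ?sh (i - 1)) (M i j k :: ('n, 'k) mpoly)"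
    and imI: "(\<lambda>v. matvec (M 1) 1 (b 1) v 0) ` fvecs (b 1) = I"
    and ex: "\<And>i. i \<in> {1..<?n} \<Longrightarrow> {v\<in>fvecs (b i). matvec (M i) (b (i - 1)) (b i) v = (\<lambda>_. 0)}
                     = matvec (M (i + 1)) (b i) (b (i + 1)) ` fvecs (b (i + 1))"
    by (rule linear_gorenstein_resolutionE[OF lin]) (rule that)
  define F where "F i v = matvec (M i) (b (i - 1)) (b i) v" for i v
  have F0: "F i (F (i + 1) v) = (\<lambda>_. 0)" if "i \<in> {1..<?n}" for i v
    using ex[OF that] matvec_in_image[of "M (i + 1)" "b i" "b (i + 1)" v] by (auto simp: F_def)
  have Fex: "\<exists>y. F (i + 1) y = w" if "i \<in> {1..<?n}" "w \<in> fvecs (b i)" "F i w = (\<lambda>_. 0)" for i w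
  proof -
    have "w \<in> matvec (M (i + 1)) (b i) (b (i + 1)) ` fvecs (b (i + 1))"
      unfolding ex[OF that(1), symmetric] using that(2,3) by (simp add: F_def)
    then show ?thesis by (auto simp: F_def)
  qed
  have F1: "p \<in> I \<longleftrightarrow> (\<exists>y. F 1 y 0 = p)" for p
  proof
    assume "p \<in> I" then show "\<exists>y. F 1 y 0 = p" unfolding imI[symmetric] by (auto simp: F_def b0)
  next
    assume "\<exists>y. F 1 y 0 = p"
    then obtain y where y: "F 1 y 0 = p" by blast
    obtain v where "v \<in> fvecs (b 1)" "F 1 y = matvec (M 1) 1 (b 1) v"
      using matvec_in_image[of "M 1" 1 "b 1" y] by (auto simp: F_def b0)
    then show "p \<in> I" unfolding imI[symmetric] using y by auto
  qed
  have F_fvecs: "F (i + 1) y \<in> fvecs (b i)" for i y by (simp add: F_def)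
  obtain S h a and D :: "(('n \<Rightarrow>\<^sub>0 nat) \<times> bool list) \<Rightarrow> _ \<Rightarrow> ('n, 'k) mpoly"
    where KM: "minimal_resolution S h a D {p. ccoeff p = 0} 0"
      and GM: "minimal_resolution S (\<lambda>j. int ?n - h j) (\<lambda>j. - a j) (\<lambda>j k. D k j) {p. ccoeff p = 0} (- int ?n)"
    by (rule minimal_resolution_of_residue_field)
  interpret K: minimal_resolution S h a D "{p. ccoeff p = 0}" 0 by (rule KM)
  interpret G: minimal_resolution S "\<lambda>j. int ?n - h j" "\<lambda>j. - a j" "\<lambda>j k. D k j" "{p. ccoeff p = 0}" "- int ?n"
    by (rule GM)
  obtain j0 where j0: "{j\<in>S. h j = 0} = {j0}" "a j0 = 0" using K.bottom by metis
  obtain k1 where k1: "{j\<in>S. int ?n - h j = 0} = {k1}" "- a k1 = - int ?n"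
    "{p. ccoeff p = 0} = (\<lambda>u. app S (\<lambda>j k. D k j) u k1) ` vecs {k\<in>S. int ?n - h k = 1}"
    by (rule G.bottom)
  have j0S: "j0 \<in> S" "h j0 = 0" using j0(1) by auto
  have "k1 \<in> {j\<in>S. int ?n - h j = 0}" unfolding k1(1) by simp
  then have k1S: "k1 \<in> S" "h k1 = int ?n" by auto
  have cc: "0 < mdeg \<alpha>" if "ccoeff p = 0" "\<alpha> \<in> keys p" for p :: "('n, 'k) mpoly" and \<alpha>
    using that mdeg_eq_0_iff[of \<alpha>] by (cases "mdeg \<alpha>") (auto simp: ccoeff_def in_keys_iff)
  \<comment> \<open>The bounds from the two ends meet already with t = 0: the resolution of the
    field is linear.\<close>
  have ah: "a k = h k" if k: "k \<in> S" for k
  proof -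
    have "h k \<le> a k"
    proof (cases "h k = 0")
      case True
      then have "k \<in> {j\<in>S. h j = 0}" using k by simp
      then have "k = j0" unfolding j0(1) by simp
      then show ?thesis using True j0(2) by simp
    next
      case False
      then show ?thesis using K.degree_lower_bound[of 0 k] cc k K.h_nonneg[OF k] by simp
    qed
    moreover have "- a k \<ge> - h k"
    proof (cases "int ?n - h k = 0")
      case True
      then have "k \<in> {j\<in>S. int ?n - h j = 0}" using k by simp
      then have "k = k1" unfolding k1(1) by simp
      then show ?thesis using True k1(2) by simp
    next
      case False
      then show ?thesis using G.degree_lower_bound[of 0 k] cc k G.h_nonneg[OF k] by simp
    qed
    ultimately show ?thesis by simp
  qed
  have Ddeg: "mdeg \<alpha> = 1" if "j \<in> S" "k \<in> S" "\<alpha> \<in> keys (D j k)" for j k \<alpha>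
  proof -
    have "int (mdeg \<alpha>) + a j = a k" using K.gr that by (auto simp: graded_def)
    moreover have "D j k \<noteq> 0" using that(3) by auto
    ultimately show ?thesis using K.h_rel[OF that(1,2)] ah that by simp
  qed
  \<comment> \<open>A chain map up to homological degree \<open>i\<close>: \<open>\<psi> k\<close>
    is the image of the basis element \<open>k\<close>, homogeneous of total degree s +
    \<open>h k\<close>, and the generator \<open>j0\<close> goes to the socle element
    \<open>z\<close>.\<close>
  define good where "good i \<psi> \<longleftrightarrow> \<psi> j0 = (\<lambda>j. if j = 0 then z else 0) \<and>
      (\<forall>k\<in>S. h k \<le> int i \<longrightarrow> \<psi> k \<in> fvecs (b (nat (h k))) \<and>
        (\<forall>j. \<forall>\<alpha>\<in>keys (\<psi> k j). mdeg \<alpha> + ?sh (nat (h k)) = s + nat (h k)) \<and>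
        (h k \<ge> 1 \<longrightarrow> F (nat (h k)) (\<psi> k) = (\<lambda>j. \<Sum>l\<in>S. D l k * \<psi> l j)))"
    for i and \<psi> :: "(('n \<Rightarrow>\<^sub>0 nat) \<times> bool list) \<Rightarrow> nat \<Rightarrow> ('n, 'k) mpoly"
  have lift: "\<exists>\<psi>. good i \<psi>" if "i \<le> ?n" for i
    using that
  proof (induction i)
    case 0
    define \<psi> where "\<psi> = (\<lambda>_::('n \<Rightarrow>\<^sub>0 nat) \<times> bool list. \<lambda>j::nat. if j = 0 then z else 0)"
    have "good 0 \<psi>"
      unfolding good_def
    proof (intro conjI ballI impI allI)
      show "\<psi> j0 = (\<lambda>j. if j = 0 then z else 0)" by (simp add: \<psi>_def)
      fix k assume k: "k \<in> S" "h k \<le> int 0"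
      then have hk: "h k = 0" using K.h_nonneg[OF k(1)] by simp
      then show "\<psi> k \<in> fvecs (b (nat (h k)))" by (simp add: fvecs_def b0 \<psi>_def)
      show "mdeg \<alpha> + ?sh (nat (h k)) = s + nat (h k)" if "\<alpha> \<in> keys (\<psi> k j)" for j \<alpha>
        using that hk z(1) by (auto simp: \<psi>_def res_shift_def homog_def split: if_splits)
      show "F (nat (h k)) (\<psi> k) = (\<lambda>j. \<Sum>l\<in>S. D l k * \<psi> l j)" if "1 \<le> h k" using that hk by simp
    qed
    then show ?case by blast
  next
    case (Suc i)
    then obtain \<psi> where \<psi>: "good i \<psi>" by auto
    let ?i = "i + 1"
    have \<psi>0: "\<psi> j0 = (\<lambda>j. if j = 0 then z else 0)" using \<psi> by (simp add: good_def)
    have \<psi>f: "\<psi> l \<in> fvecs (b (nat (h l)))" and \<psi>d: "\<And>j \<alpha>. \<alpha> \<in> keys (\<psi> l j) \<Longrightarrow> mdeg \<alpha> + ?sh (nat (h l)) = s + nat (h l)"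
      and \<psi>c: "h l \<ge> 1 \<Longrightarrow> F (nat (h l)) (\<psi> l) = (\<lambda>j. \<Sum>m\<in>S. D m l * \<psi> m j)"
      if "l \<in> S" "h l \<le> int i" for l
      using \<psi> that unfolding good_def by blast+
    have step: "\<exists>y. y \<in> fvecs (b ?i) \<and> (\<forall>j. \<forall>\<alpha>\<in>keys (y j). mdeg \<alpha> + ?sh ?i = s + ?i) \<and>
        F ?i y = (\<lambda>j. \<Sum>l\<in>S. D l k * \<psi> l j)" if k: "k \<in> S" "h k = int ?i" for k
    proof -
      define w where "w = (\<lambda>j. \<Sum>l\<in>S. D l k * \<psi> l j)"
      have hl: "h l = int i" if "l \<in> S" "D l k \<noteq> 0" for l using K.h_rel[OF that(1) k(1) that(2)] k(2) by simp
      have wf: "w \<in> fvecs (b i)"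
        unfolding fvecs_def
      proof (intro CollectI allI impI)
        fix j assume j: "b i \<le> j"
        have "D l k * \<psi> l j = 0" if l: "l \<in> S" for l
        proof (cases "D l k = 0")
          case False
          then have "\<psi> l j = 0" using \<psi>f[OF l] hl[OF l] j by (simp add: fvecs_def)
          then show ?thesis by simp
        qed simp
        then show "w j = 0" by (simp add: w_def)
      qed
      have wd: "mdeg \<alpha> + ?sh i = s + ?i" if \<alpha>: "\<alpha> \<in> keys (w j)" for j \<alpha>
      proof -
        have "lookup (w j) \<alpha> \<noteq> 0" using \<alpha> by (simp add: in_keys_iff)
        then obtain l where l: "l \<in> S" "lookup (D l k * \<psi> l j) \<alpha> \<noteq> 0"
          unfolding w_def lookup_sum by (meson sum.neutral)
        then have "\<alpha> \<in> keys (D l k * \<psi> l j)" by (simp add: in_keys_iff)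
        then obtain \<beta> \<gamma> where bg: "\<beta> \<in> keys (D l k)" "\<gamma> \<in> keys (\<psi> l j)" "\<alpha> = \<beta> + \<gamma>"
          using keys_mult[of "D l k" "\<psi> l j"] by blast
        then have "h l = int i" using hl[OF l(1)] by (cases "D l k = 0") simp_all
        then show ?thesis using Ddeg[OF l(1) k(1) bg(1)] \<psi>d[OF l(1) _ bg(2)] bg(3) by simp
      qed
      \<comment> \<open>The boundary of \<open>k\<close> is mapped to a boundary: for
        \<open>i = 0\<close> the image has degree s + 1 and so lies in \<open>I\<close>; otherwise
        it is a cycle, and the given resolution is exact.\<close>
      have "\<exists>y. F ?i y = w"
      proof (cases "i = 0")
        case True
        have "homog (s + 1) (w 0)" unfolding homog_def using wd[of _ 0] True by (auto simp: res_shift_def)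
        then have "w 0 \<in> I" by (rule high) simp
        then obtain y where y: "F 1 y 0 = w 0" using F1 by blast
        have "F 1 y j = w j" for j
          using y wf F_fvecs[of 0 y] True b0 by (cases "j = 0") (auto simp: fvecs_def)
        then show ?thesis using True by auto
      next
        case False
        have "F i w = (\<lambda>j. \<Sum>l\<in>S. D l k * F i (\<psi> l) j)" unfolding w_def F_def by (rule matvec_lincomb)
        also have "\<dots> = (\<lambda>j. \<Sum>m\<in>S. (\<Sum>l\<in>S. D m l * D l k) * \<psi> m j)"
        proof
          fix j
          have "(\<Sum>l\<in>S. D l k * F i (\<psi> l) j) = (\<Sum>l\<in>S. D l k * (\<Sum>m\<in>S. D m l * \<psi> m j))"
          proof (rule sum.cong)
            fix l assume l: "l \<in> S"
            show "D l k * F i (\<psi> l) j = D l k * (\<Sum>m\<in>S. D m l * \<psi> m j)"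
            proof (cases "D l k = 0")
              case False
              then show ?thesis using \<psi>c[OF l] hl[OF l False] \<open>i \<noteq> 0\<close> by (simp add: fun_eq_iff)
            qed simp
          qed simp
          also have "\<dots> = (\<Sum>m\<in>S. (\<Sum>l\<in>S. D m l * D l k) * \<psi> m j)"
            unfolding sum_distrib_left sum_distrib_right
            by (subst sum.swap, intro sum.cong refl) (simp add: mult.left_commute mult.assoc)
          finally show "(\<Sum>l\<in>S. D l k * F i (\<psi> l) j) = (\<Sum>m\<in>S. (\<Sum>l\<in>S. D m l * D l k) * \<psi> m j)" .
        qed
        also have "\<dots> = (\<lambda>_. 0)"
        proof
          fix j show "(\<Sum>m\<in>S. (\<Sum>l\<in>S. D m l * D l k) * \<psi> m j) = 0"
            by (rule sum.neutral) (use K.cx k(1) in \<open>auto simp: cplx_def\<close>)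
        qed
        finally show ?thesis using Fex[of i w] wf False Suc.prems by auto
      qed
      then obtain y where y: "F ?i y = w" by blast
      have sh: "?sh i \<le> ?sh ?i" using res_shift_mono[OF n2, of i d] Suc.prems by simp
      let ?c = "?sh ?i - ?sh i"
      \<comment> \<open>A preimage need not be homogeneous. Its component of degree s + i + 1 minus
        the shift still solves the equation, and 0 solves it when that number is negative.\<close>
      define y' where "y' = (\<lambda>j. if j < b ?i \<and> ?sh ?i \<le> s + ?i then hcomp (s + ?i - ?sh ?i) (y j) else 0)"
      have "F ?i y' = w"
      proof
        fix j
        show "F ?i y' j = w j"
        proof (cases "j < b i")
          case True
          have whom: "hcomp (s + ?i - ?sh i) (w j) = w j" if "?sh i \<le> s + ?i"
            unfolding hcomp_id_iff
          proof
            fix \<alpha> assume "\<alpha> \<in> keys (w j)"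
            from wd[OF this] that show "mdeg \<alpha> = s + ?i - ?sh i" by linarith
          qed
          have hM: "homog ?c (M ?i j t)" if "t < b ?i" for t using hom[of ?i j t] True that Suc.prems by simp
          have wj: "w j = (\<Sum>t<b ?i. M ?i j t * y t)" using y True by (auto simp: F_def matvec_def)
          have y'j: "F ?i y' j = (\<Sum>t<b ?i. M ?i j t * y' t)" using True by (simp add: F_def matvec_def)
          show ?thesis
          proof (cases "?sh i \<le> s + ?i")
            case le: True
            have "w j = (\<Sum>t<b ?i. hcomp (s + ?i - ?sh i) (M ?i j t * y t))"
              using whom[OF le] unfolding wj hcomp_sum by simp
            also have "\<dots> = (\<Sum>t<b ?i. M ?i j t * y' t)"
            proof (rule sum.cong)
              fix t assume "t \<in> {..<b ?i}"
              then have t: "t < b ?i" by simp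
              have iff: "?c \<le> s + ?i - ?sh i \<longleftrightarrow> ?sh ?i \<le> s + ?i" using sh le by arith
              have eq: "?sh ?i \<le> s + ?i \<Longrightarrow> s + ?i - ?sh i - ?c = s + ?i - ?sh ?i" using sh by arith
              show "hcomp (s + ?i - ?sh i) (M ?i j t * y t) = M ?i j t * y' t"
                unfolding hcomp_mult_left[OF hM[OF t]] y'_def iff using t eq by auto
            qed simp
            finally show ?thesis using y'j by simp
          next
            case False
            then have "keys (w j) = {}" using wd[of _ j] by fastforce
            then have "w j = 0" by simp
            moreover have "y' t = 0" for t using False sh by (simp add: y'_def)
            ultimately show ?thesis using y'j by simp
          qed
        next
          case False
          then show ?thesis using wf F_fvecs[of i y'] by (auto simp: fvecs_def)
        qed
      qed
      moreover have "y' \<in> fvecs (b ?i)" by (simp add: y'_def fvecs_def)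
      moreover have "mdeg \<alpha> + ?sh ?i = s + ?i" if "\<alpha> \<in> keys (y' j)" for j \<alpha>
      proof -
        from that have le: "?sh ?i \<le> s + ?i" and "\<alpha> \<in> keys (hcomp (s + ?i - ?sh ?i) (y j))"
          by (auto simp: y'_def split: if_splits)
        then have "mdeg \<alpha> = s + ?i - ?sh ?i" using homog_hcomp homog_keysD by blast
        then show ?thesis using le by simp
      qed
      ultimately show ?thesis unfolding w_def by blast
    qed
    have "\<forall>k. \<exists>y. k \<in> S \<and> h k = int ?i \<longrightarrow> y \<in> fvecs (b ?i) \<and> (\<forall>j. \<forall>\<alpha>\<in>keys (y j). mdeg \<alpha> + ?sh ?i = s + ?i) \<and>
        F ?i y = (\<lambda>j. \<Sum>l\<in>S. D l k * \<psi> l j)"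
      using step by blast
    from choice[OF this] obtain y where y: "\<And>k. k \<in> S \<Longrightarrow> h k = int ?i \<Longrightarrow> y k \<in> fvecs (b ?i) \<and>
        (\<forall>j. \<forall>\<alpha>\<in>keys (y k j). mdeg \<alpha> + ?sh ?i = s + ?i) \<and> F ?i (y k) = (\<lambda>j. \<Sum>l\<in>S. D l k * \<psi> l j)"
      by blast
    define \<psi>' where "\<psi>' = (\<lambda>k. if h k = int ?i then y k else \<psi> k)"
    have sum': "(\<lambda>j. \<Sum>l\<in>S. D l k * \<psi>' l j) = (\<lambda>j. \<Sum>l\<in>S. D l k * \<psi> l j)" if k: "k \<in> S" "h k \<le> int ?i" for k
    proof
      fix j
      show "(\<Sum>l\<in>S. D l k * \<psi>' l j) = (\<Sum>l\<in>S. D l k * \<psi> l j)"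
      proof (rule sum.cong)
        fix l assume l: "l \<in> S"
        show "D l k * \<psi>' l j = D l k * \<psi> l j"
          using K.h_rel[OF l k(1)] k(2) by (cases "D l k = 0") (auto simp: \<psi>'_def)
      qed simp
    qed
    have "good (Suc i) \<psi>'"
      unfolding good_def
    proof (intro conjI ballI impI)
      show "\<psi>' j0 = (\<lambda>j. if j = 0 then z else 0)" using \<psi>0 j0S by (simp add: \<psi>'_def)
      fix k assume k: "k \<in> S" "h k \<le> int (Suc i)"
      have *: "\<psi>' k \<in> fvecs (b (nat (h k))) \<and> (\<forall>j. \<forall>\<alpha>\<in>keys (\<psi>' k j). mdeg \<alpha> + ?sh (nat (h k)) = s + nat (h k)) \<and>
        (h k \<ge> 1 \<longrightarrow> F (nat (h k)) (\<psi>' k) = (\<lambda>j. \<Sum>l\<in>S. D l k * \<psi>' l j))"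
      proof (cases "h k = int ?i")
        case True
        then have "nat (h k) = ?i" by linarith
        then show ?thesis using y[OF k(1) True] True sum'[OF k(1)] by (simp add: \<psi>'_def)
      next
        case False
        then have le: "h k \<le> int i" using k(2) by simp
        then show ?thesis using \<psi>f[OF k(1) le] \<psi>d[OF k(1) le] \<psi>c[OF k(1) le] False sum'[OF k(1)] by (simp add: \<psi>'_def)
      qed
      show "\<psi>' k \<in> fvecs (b (nat (h k)))" using * by blast
      show "\<forall>j. \<forall>\<alpha>\<in>keys (\<psi>' k j). mdeg \<alpha> + ?sh (nat (h k)) = s + nat (h k)" using * by blast
      show "F (nat (h k)) (\<psi>' k) = (\<lambda>j. \<Sum>l\<in>S. D l k * \<psi>' l j)" if "1 \<le> h k" using * that by blast
    qed
    then show ?case by blast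
  qed
  obtain \<psi> where \<psi>: "good ?n \<psi>" using lift[of ?n] by blast
  have hle: "h k \<le> int ?n" if "k \<in> S" for k using G.h_nonneg[OF that] by simp
  have \<psi>0: "\<psi> j0 = (\<lambda>j. if j = 0 then z else 0)" using \<psi> by (simp add: good_def)
  have \<psi>f: "\<psi> l \<in> fvecs (b (nat (h l)))" and \<psi>d: "\<And>j \<alpha>. \<alpha> \<in> keys (\<psi> l j) \<Longrightarrow> mdeg \<alpha> + ?sh (nat (h l)) = s + nat (h l)"
    and \<psi>c: "h l \<ge> 1 \<Longrightarrow> F (nat (h l)) (\<psi> l) = (\<lambda>j. \<Sum>m\<in>S. D m l * \<psi> m j)"
    if "l \<in> S" for l
    using \<psi> that hle[OF that] unfolding good_def by blast+
  have "ccoeff (\<psi> k1 0) \<noteq> 0"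
  proof
    assume "ccoeff (\<psi> k1 0) = 0"
    \<comment> \<open>The ideal of the variables is the image of the dual differential that ends at
      \<open>k1\<close>.\<close>
    then have "\<psi> k1 0 \<in> (\<lambda>u. app S (\<lambda>j k. D k j) u k1) ` vecs {k\<in>S. int ?n - h k = 1}"
      unfolding k1(3)[symmetric] by simp
    then obtain u0 where u0: "\<psi> k1 0 = app S (\<lambda>j k. D k j) u0 k1" by blast
    \<comment> \<open>Descending induction on \<open>i\<close>: up to cycles \<open>\<rho>\<close>, the lift \<open>\<psi>\<close> factors in degree \<open>i\<close> through the
      differential of the Koszul complex; in degree 0 this differential vanishes.\<close>
    define P where "P i \<longleftrightarrow> (\<exists>\<rho> \<eta>. \<forall>k\<in>S. h k = int i \<longrightarrow>
        (\<forall>j<b i. \<psi> k j = \<rho> k j + (\<Sum>l\<in>S. D l k * \<eta> l j)) \<and>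
        (if i = 0 then \<rho> k 0 \<in> I else F i (\<rho> k) = (\<lambda>_. 0)))" for i
    have Pn: "P ?n"
    proof -
      have "\<psi> k j = 0 + (\<Sum>l\<in>S. D l k * u0 l)" if "k \<in> S" "h k = int ?n" "j < b ?n" for k j
      proof -
        have "k \<in> {j\<in>S. int ?n - h j = 0}" using that by simp
        then have "k = k1" unfolding k1(1) by simp
        then show ?thesis using that bn u0 k1S by (simp add: app_def)
      qed
      moreover have "F ?n (\<lambda>_. 0) = (\<lambda>_. 0)" by (auto simp: F_def matvec_def)
      ultimately show ?thesis unfolding P_def
        by (intro exI[of _ "\<lambda>_ _. 0"] exI[of _ "\<lambda>l _. u0 l"]) simp
    qed
    have down: "P i" if "i < ?n" and Pi: "P (i + 1)" for i
    proof -
      obtain \<rho> \<eta> where re: "\<And>k j. k \<in> S \<Longrightarrow> h k = int (i + 1) \<Longrightarrow> j < b (i + 1) \<Longrightarrow> \<psi> k j = \<rho> k j + (\<Sum>l\<in>S. D l k * \<eta> l j)"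
        "\<And>k. k \<in> S \<Longrightarrow> h k = int (i + 1) \<Longrightarrow> F (i + 1) (\<rho> k) = (\<lambda>_. 0)"
        using Pi unfolding P_def by auto
      \<comment> \<open>What remains of \<open>\<psi>\<close> after subtracting the part that
        factors through the given resolution. It vanishes on boundaries, so each of its coordinates
        is a cycle of the dual complex.\<close>
      define \<chi> where "\<chi> = (\<lambda>l j. \<psi> l j - F (i + 1) (\<eta> l) j)"
      have zero: "(\<Sum>l\<in>S. D l k * \<chi> l j) = 0" if k: "k \<in> S" "h k = int (i + 1)" for k j
      proof -
        have "(\<Sum>l\<in>S. D l k * \<chi> l j) = (\<Sum>l\<in>S. D l k * \<psi> l j) - (\<Sum>l\<in>S. D l k * F (i + 1) (\<eta> l) j)"
          by (simp add: \<chi>_def right_diff_distrib sum_subtractf)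
        also have "(\<Sum>l\<in>S. D l k * \<psi> l j) = F (i + 1) (\<psi> k) j"
          using \<psi>c[OF k(1)] k(2) nat_int[of "i + 1"] by (simp add: fun_eq_iff)
        also have "(\<Sum>l\<in>S. D l k * F (i + 1) (\<eta> l) j) = F (i + 1) (\<lambda>j. \<Sum>l\<in>S. D l k * \<eta> l j) j"
          unfolding F_def matvec_lincomb ..
        also have "F (i + 1) (\<psi> k) j - F (i + 1) (\<lambda>j. \<Sum>l\<in>S. D l k * \<eta> l j) j
            = F (i + 1) (\<lambda>j. \<psi> k j - (\<Sum>l\<in>S. D l k * \<eta> l j)) j"
          unfolding F_def matvec_diff ..
        also have "F (i + 1) (\<lambda>j. \<psi> k j - (\<Sum>l\<in>S. D l k * \<eta> l j)) = F (i + 1) (\<rho> k)"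
          unfolding F_def by (rule matvec_cong) (use re(1)[OF k] in simp)
        finally show ?thesis using re(2)[OF k] by simp
      qed
      have "\<exists>u. \<forall>l\<in>S. h l = int i \<longrightarrow> \<chi> l j = (\<Sum>m\<in>S. D m l * u m)" for j
      proof -
        \<comment> \<open>Coordinate \<open>j\<close> of \<open>\<chi>\<close>, placed in dual
          homological degree n - i. This is positive, so exactness of the dual complex
          applies.\<close>
        define x where "x = (\<lambda>l. if l \<in> S \<and> h l = int i then \<chi> l j else 0)"
        have "app S (\<lambda>j k. D k j) x k = 0" for k
        proof (cases "k \<in> S \<and> h k = int (i + 1)")
          case True
          have "(\<Sum>l\<in>S. D l k * x l) = (\<Sum>l\<in>S. D l k * \<chi> l j)"
          proof (rule sum.cong)
            fix l assume l: "l \<in> S"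
            show "D l k * x l = D l k * \<chi> l j" using K.h_rel[OF l, of k] True l by (cases "D l k = 0") (auto simp: x_def)
          qed simp
          then show ?thesis using zero True by (simp add: app_def)
        next
          case False
          have "k \<in> S \<Longrightarrow> l \<in> S \<Longrightarrow> D l k * x l = 0" for l
            using K.h_rel[of l k] False by (cases "D l k = 0") (auto simp: x_def)
          then show ?thesis by (simp add: app_def)
        qed
        then have "app S (\<lambda>j k. D k j) x = (\<lambda>_. 0)" by auto
        moreover have "x \<in> vecs S" by (simp add: x_def vecs_def)
        moreover have "\<forall>j\<in>S. int ?n - h j = 0 \<longrightarrow> x j = 0" using that(1) by (auto simp: x_def)
        ultimately obtain u where u: "x = app S (\<lambda>j k. D k j) u" using G.ac unfolding acyclic_above_def by blast
        have "\<chi> l j = (\<Sum>m\<in>S. D m l * u m)" if "l \<in> S" "h l = int i" for l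
          using fun_cong[OF u, of l] that by (simp add: x_def app_def)
        then show ?thesis by blast
      qed
      then have "\<forall>j. \<exists>u. \<forall>l\<in>S. h l = int i \<longrightarrow> \<chi> l j = (\<Sum>m\<in>S. D m l * u m)" by blast
      from choice[OF this] obtain U where U: "\<And>j l. l \<in> S \<Longrightarrow> h l = int i \<Longrightarrow> \<chi> l j = (\<Sum>m\<in>S. D m l * U j m)" by blast
      have 1: "\<psi> k j = F (i + 1) (\<eta> k) j + (\<Sum>l\<in>S. D l k * U j l)" if "k \<in> S" "h k = int i" for k j
        using U[OF that, of j] by (simp add: \<chi>_def algebra_simps)
      have 2: "if i = 0 then F (i + 1) (\<eta> k) 0 \<in> I else F i (F (i + 1) (\<eta> k)) = (\<lambda>_. 0)" for k
        using F1[of "F (i + 1) (\<eta> k) 0"] F0[of i "\<eta> k"] that(1) by auto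
      show "P i" unfolding P_def
        using 1 2 by (intro exI[of _ "\<lambda>k. F (i + 1) (\<eta> k)"] exI[of _ "\<lambda>l j. U j l"]) blast
    qed
    have "P i" if "i \<le> ?n" for i
      using that by (induction rule: inc_induct) (use Pn down in auto)
    then have "P 0" by blast
    then obtain \<rho> \<eta> where re: "\<psi> j0 0 = \<rho> j0 0 + (\<Sum>l\<in>S. D l j0 * \<eta> l 0)" "\<rho> j0 0 \<in> I"
      unfolding P_def using j0S b0 by force
    have "(\<Sum>l\<in>S. D l j0 * \<eta> l 0) = 0"
      by (rule sum.neutral) (use cplx_bottom[OF K.cx _ j0S] in auto)
    then show False using re \<psi>0 z(2) by simp
  qed
  \<comment> \<open>The monomial 1 occurs in an entry whose degree plus the last shift is s +
    n.\<close>
  then have "0 \<in> keys (\<psi> k1 0)" by (simp add: ccoeff_def in_keys_iff)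
  then show ?thesis using \<psi>d[OF k1S(1), of 0 0] k1S(2) by simp
qed

section \<open>Ranks and minors\<close>

definition columns_independent :: "('r \<Rightarrow> 'c \<Rightarrow> 'k::field) \<Rightarrow> 'r set \<Rightarrow> 'c set \<Rightarrow> bool" where
  "columns_independent A R C \<longleftrightarrow> (\<forall>c. (\<forall>r\<in>R. (\<Sum>\<beta>\<in>C. c \<beta> * A r \<beta>) = 0) \<longrightarrow> (\<forall>\<beta>\<in>C. c \<beta> = 0))"

lemma mat_rank_eq_card_iff:
  assumes fin: "finite C"
  shows "mat_rank A R C = card C \<longleftrightarrow> columns_independent A R C"
proof -
  let ?S = "{card D | D. D \<subseteq> C \<and> columns_independent A R D}"
  have rank: "mat_rank A R C = Max ?S" by (simp add: mat_rank_def columns_independent_def)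
  have "?S \<subseteq> {..card C}" using card_mono[OF fin] by auto
  then have finS: "finite ?S" by (rule finite_subset) simp
  have "columns_independent A R {}" by (simp add: columns_independent_def)
  then have ne: "?S \<noteq> {}" by blast
  show ?thesis
  proof
    assume "mat_rank A R C = card C"
    then have "card C \<in> ?S" using Max_in[OF finS ne] rank by simp
    then obtain D where D: "D \<subseteq> C" "columns_independent A R D" "card D = card C" by auto
    then have "D = C" using card_subset_eq[OF fin] by blast
    then show "columns_independent A R C" using D(2) by simp
  next
    assume "columns_independent A R C"
    then have "card C \<in> ?S" by blast
    moreover have "x \<le> card C" if "x \<in> ?S" for x using that card_mono[OF fin] by auto
    ultimately show "mat_rank A R C = card C" unfolding rank using finS by (intro Max_eqI) auto
  qed
qed

definition minor :: "nat \<Rightarrow> ('r \<Rightarrow> 'c \<Rightarrow> 'a::comm_ring_1) \<Rightarrow> (nat \<Rightarrow> 'r) \<Rightarrow> (nat \<Rightarrow> 'c) \<Rightarrow> 'a" where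
  "minor k A r c = (\<Sum>p | p permutes {..<k}. of_int (sign p) * (\<Prod>i<k. A (r i) (c (p i))))"

lemma minors_eq: "minors k A R C = {minor k A r c | r c.
    inj_on r {..<k} \<and> r ` {..<k} \<subseteq> R \<and> inj_on c {..<k} \<and> c ` {..<k} \<subseteq> C}"
  by (simp add: minors_def minor_def)

lemma minor_det: "minor k A r c = det (mat k k (\<lambda>(i, j). A (r i) (c j)))"
proof -
  have "det (mat k k (\<lambda>(i, j). A (r i) (c j)))
      = (\<Sum>p | p permutes {0..<k}. of_int (sign p) * (\<Prod>i = 0..<k. mat k k (\<lambda>(i, j). A (r i) (c j)) $$ (i, p i)))"
    by (rule det_def') simp
  also have "\<dots> = minor k A r c"
    unfolding minor_def atLeast0LessThan
  proof (intro sum.cong refl, goal_cases)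
    case (1 p)
    have "(\<Prod>i<k. mat k k (\<lambda>(i, j). A (r i) (c j)) $$ (i, p i)) = (\<Prod>i<k. A (r i) (c (p i)))"
    proof (rule prod.cong)
      fix i assume i: "i \<in> {..<k}"
      then have "p i \<in> {..<k}" using 1 permutes_in_image by fastforce
      then show "mat k k (\<lambda>(i, j). A (r i) (c j)) $$ (i, p i) = A (r i) (c (p i))" using i by simp
    qed simp
    then show ?case by simp
  qed
  finally show ?thesis by simp
qed

lemma minor_nonzero_iff:
  fixes A :: "'r \<Rightarrow> 'c \<Rightarrow> 'k::field"
  shows "minor k A r c \<noteq> 0 \<longleftrightarrow> (\<forall>x. (\<forall>i<k. (\<Sum>j<k. A (r i) (c j) * x j) = 0) \<longrightarrow> (\<forall>j<k. x j = 0))"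
proof -
  let ?M = "mat k k (\<lambda>(i, j). A (r i) (c j))"
  have M: "?M \<in> carrier_mat k k" by simp
  have mv: "(?M *\<^sub>v v) $ i = (\<Sum>j<k. A (r i) (c j) * v $ j)" if "v \<in> carrier_vec k" "i < k" for v i
    using that by (simp add: scalar_prod_def atLeast0LessThan)
  have "minor k A r c = 0 \<longleftrightarrow> (\<exists>v. v \<in> carrier_vec k \<and> v \<noteq> 0\<^sub>v k \<and> ?M *\<^sub>v v = 0\<^sub>v k)"
    unfolding minor_det by (rule det_0_iff_vec_prod_zero_field[OF M])
  also have "\<dots> \<longleftrightarrow> (\<exists>x. (\<forall>i<k. (\<Sum>j<k. A (r i) (c j) * x j) = 0) \<and> (\<exists>j<k. x j \<noteq> 0))"
  proof
    assume "\<exists>v. v \<in> carrier_vec k \<and> v \<noteq> 0\<^sub>v k \<and> ?M *\<^sub>v v = 0\<^sub>v k"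
    then obtain v where v: "v \<in> carrier_vec k" "v \<noteq> 0\<^sub>v k" "?M *\<^sub>v v = 0\<^sub>v k" by blast
    have "(\<Sum>j<k. A (r i) (c j) * v $ j) = 0" if "i < k" for i using mv[OF v(1) that] v(3) that by simp
    moreover have "\<exists>j<k. v $ j \<noteq> 0"
    proof (rule ccontr)
      assume "\<not> ?thesis"
      then have "v = 0\<^sub>v k" using v(1) by (intro eq_vecI) auto
      then show False using v(2) by simp
    qed
    ultimately show "\<exists>x. (\<forall>i<k. (\<Sum>j<k. A (r i) (c j) * x j) = 0) \<and> (\<exists>j<k. x j \<noteq> 0)"
      by (intro exI[of _ "\<lambda>j. v $ j"]) blast
  next
    assume "\<exists>x. (\<forall>i<k. (\<Sum>j<k. A (r i) (c j) * x j) = 0) \<and> (\<exists>j<k. x j \<noteq> 0)"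
    then obtain x j where x: "\<forall>i<k. (\<Sum>j<k. A (r i) (c j) * x j) = 0" "j < k" "x j \<noteq> 0" by blast
    let ?v = "vec k x"
    have "?M *\<^sub>v ?v = 0\<^sub>v k"
    proof (rule eq_vecI)
      fix i assume "i < dim_vec (0\<^sub>v k :: 'k vec)"
      then have i: "i < k" by simp
      have "(?M *\<^sub>v ?v) $ i = (\<Sum>j<k. A (r i) (c j) * ?v $ j)" by (rule mv) (use i in auto)
      also have "\<dots> = (\<Sum>j<k. A (r i) (c j) * x j)" by (rule sum.cong) auto
      finally show "(?M *\<^sub>v ?v) $ i = 0\<^sub>v k $ i" using x(1) i by simp
    qed simp
    moreover have "?v \<noteq> 0\<^sub>v k" using x(2,3) by (metis index_vec index_zero_vec(1))
    ultimately show "\<exists>v. v \<in> carrier_vec k \<and> v \<noteq> 0\<^sub>v k \<and> ?M *\<^sub>v v = 0\<^sub>v k" by (intro exI[of _ ?v]) simp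
  qed
  finally show ?thesis by blast
qed

lemma minor_transpose: "minor k A r c = minor k (\<lambda>j i. A i j) c r"
proof -
  have "mat k k (\<lambda>(i, j). A (r j) (c i)) = transpose_mat (mat k k (\<lambda>(i, j). A (r i) (c j)))"
    by (rule eq_matI) auto
  then show ?thesis unfolding minor_det by (simp add: det_transpose[where n = k])
qed

text \<open>For the nonzero minor, a largest independent set \<open>Q\<close> of rows has exactly
  \<open>card C\<close> elements: not more, since more rows than columns are dependent; not fewer,
  since otherwise a nonzero vector would be annihilated by the rows in \<open>Q\<close>, hence by
  all rows, against independence of the columns.\<close>

lemma columns_independent_iff_minor:
  fixes A :: "'r \<Rightarrow> 'c \<Rightarrow> 'k::field"
  assumes finR: "finite R" and finC: "finite C"
  shows "columns_independent A R C \<longleftrightarrow> (\<exists>x\<in>minors (card C) A R C. x \<noteq> 0)"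
proof
  let ?k = "card C"
  assume "\<exists>x\<in>minors ?k A R C. x \<noteq> 0"
  then obtain r c where rc: "r ` {..<?k} \<subseteq> R" "inj_on c {..<?k}" "c ` {..<?k} \<subseteq> C" "minor ?k A r c \<noteq> 0"
    unfolding minors_eq by blast
  have "c ` {..<?k} = C" using card_subset_eq[OF finC rc(3)] card_image[OF rc(2)] by simp
  then have bij: "bij_betw c {..<?k} C" using rc(2) by (simp add: bij_betw_def)
  show "columns_independent A R C"
    unfolding columns_independent_def
  proof (intro allI impI ballI)
    fix x \<beta> assume x: "\<forall>r\<in>R. (\<Sum>\<beta>\<in>C. x \<beta> * A r \<beta>) = 0" and \<beta>: "\<beta> \<in> C"
    have "(\<Sum>j<?k. A (r i) (c j) * x (c j)) = 0" if "i < ?k" for i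
    proof -
      have "(\<Sum>j<?k. A (r i) (c j) * x (c j)) = (\<Sum>\<beta>\<in>C. A (r i) \<beta> * x \<beta>)"
        by (rule sum.reindex_bij_betw[OF bij])
      also have "\<dots> = 0" using x rc(1) that by (simp add: mult.commute[of "A _ _"] image_subset_iff)
      finally show ?thesis .
    qed
    then have "\<forall>j<?k. x (c j) = 0"
      using spec[OF rc(4)[unfolded minor_nonzero_iff], of "\<lambda>j. x (c j)"] by simp
    moreover obtain j where "j < ?k" "\<beta> = c j" using bij \<beta> by (auto simp: bij_betw_def)
    ultimately show "x \<beta> = 0" by simp
  qed
next
  let ?k = "card C"
  assume ind: "columns_independent A R C"
  let ?rows = "\<lambda>Q. columns_independent (\<lambda>j i. A i j) C Q"
  have "finite (card ` {Q. Q \<subseteq> R \<and> ?rows Q})" using finR by auto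
  moreover have "{} \<in> {Q. Q \<subseteq> R \<and> ?rows Q}" by (simp add: columns_independent_def)
  then have "card ` {Q. Q \<subseteq> R \<and> ?rows Q} \<noteq> {}" by blast
  ultimately have "Max (card ` {Q. Q \<subseteq> R \<and> ?rows Q}) \<in> card ` {Q. Q \<subseteq> R \<and> ?rows Q}" by (rule Max_in)
  then obtain Q where Q: "Q \<subseteq> R" "?rows Q" "card Q = Max (card ` {Q. Q \<subseteq> R \<and> ?rows Q})" by auto
  have max: "card Q' \<le> card Q" if "Q' \<subseteq> R" "?rows Q'" for Q'
    unfolding Q(3) by (rule Max_ge) (use finR that in auto)
  have finQ: "finite Q" using Q(1) finR finite_subset by blast
  have "card Q \<le> ?k"
  proof (rule ccontr)
    assume "\<not> ?thesis"
    then obtain d where "\<exists>i\<in>Q. d i \<noteq> 0" "\<forall>\<beta>\<in>C. (\<Sum>i\<in>Q. A i \<beta> * d i) = 0"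
      using homogeneous_system_nontrivial[OF finC finQ, of "\<lambda>\<beta> i. A i \<beta>"] by auto
    then show False using Q(2) unfolding columns_independent_def by (auto simp: mult.commute[of "d _"])
  qed
  moreover have "card Q \<ge> ?k"
  proof (rule ccontr)
    assume "\<not> ?thesis"
    then obtain c where c: "\<exists>\<beta>\<in>C. c \<beta> \<noteq> 0" "\<forall>i\<in>Q. (\<Sum>\<beta>\<in>C. A i \<beta> * c \<beta>) = 0"
      using homogeneous_system_nontrivial[OF finQ finC, of A] by auto
    have "(\<Sum>\<beta>\<in>C. A r \<beta> * c \<beta>) = 0" if r: "r \<in> R" for r
    proof (cases "r \<in> Q")
      case False
      have "\<not> ?rows (insert r Q)" using max[of "insert r Q"] Q(1) r False finQ by auto
      then obtain d where d: "\<forall>\<beta>\<in>C. (\<Sum>i\<in>insert r Q. d i * A i \<beta>) = 0" "\<exists>i\<in>insert r Q. d i \<noteq> 0"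
        unfolding columns_independent_def by blast
      have d': "d r * A r \<beta> + (\<Sum>i\<in>Q. d i * A i \<beta>) = 0" if "\<beta> \<in> C" for \<beta>
        using d(1) that finQ False by simp
      have "d r \<noteq> 0"
      proof
        assume 0: "d r = 0"
        then have "\<forall>i\<in>Q. d i = 0" using d' Q(2) unfolding columns_independent_def by simp
        then show False using 0 d(2) by auto
      qed
      have "0 = (\<Sum>\<beta>\<in>C. (d r * A r \<beta> + (\<Sum>i\<in>Q. d i * A i \<beta>)) * c \<beta>)" using d' by simp
      also have "\<dots> = d r * (\<Sum>\<beta>\<in>C. A r \<beta> * c \<beta>) + (\<Sum>\<beta>\<in>C. \<Sum>i\<in>Q. d i * (A i \<beta> * c \<beta>))"
        by (simp add: distrib_right sum.distrib sum_distrib_left sum_distrib_right mult.assoc)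
      also have "(\<Sum>\<beta>\<in>C. \<Sum>i\<in>Q. d i * (A i \<beta> * c \<beta>)) = (\<Sum>i\<in>Q. d i * (\<Sum>\<beta>\<in>C. A i \<beta> * c \<beta>))"
        by (subst sum.swap) (simp add: sum_distrib_left)
      also have "\<dots> = 0" using c(2) by simp
      finally show ?thesis using \<open>d r \<noteq> 0\<close> by simp
    qed (use c(2) in simp)
    then show False using ind c(1) unfolding columns_independent_def by (auto simp: mult.commute[of "c _"])
  qed
  ultimately have cQ: "card Q = ?k" by simp
  obtain r where r: "bij_betw r {..<?k} Q" using ex_bij_betw_nat_finite[OF finQ] cQ by (auto simp: atLeast0LessThan)
  obtain c where c: "bij_betw c {..<?k} C" using ex_bij_betw_nat_finite[OF finC] by (auto simp: atLeast0LessThan)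
  \<comment> \<open>Independence of the rows in \<open>Q\<close> is injectivity of the transposed
    square matrix, so the transposed minor is treated.\<close>
  have "minor ?k (\<lambda>j i. A i j) c r \<noteq> 0"
    unfolding minor_nonzero_iff
  proof (intro allI impI)
    fix x j assume x: "\<forall>i<?k. (\<Sum>j<?k. A (r j) (c i) * x j) = 0" and j: "j < ?k"
    define d where "d i = x (inv_into {..<?k} r i)" for i
    have dr: "d (r j) = x j" if "j < ?k" for j using r that by (simp add: d_def bij_betw_inv_into_left)
    have "(\<Sum>i\<in>Q. d i * A i \<beta>) = 0" if \<beta>: "\<beta> \<in> C" for \<beta>
    proof -
      obtain i where i: "i < ?k" "\<beta> = c i" using c \<beta> by (auto simp: bij_betw_def)
      have "(\<Sum>i\<in>Q. d i * A i \<beta>) = (\<Sum>j<?k. d (r j) * A (r j) \<beta>)" by (rule sum.reindex_bij_betw[OF r, symmetric])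
      also have "\<dots> = (\<Sum>j<?k. A (r j) (c i) * x j)" by (rule sum.cong) (auto simp: dr i)
      finally show ?thesis using x i by simp
    qed
    then have "\<forall>i\<in>Q. d i = 0" using Q(2) unfolding columns_independent_def by blast
    then show "x j = 0" using dr[OF j] r j by (auto simp: bij_betw_def)
  qed
  then have "minor ?k A r c \<noteq> 0" using minor_transpose[of ?k A r c] by simp
  moreover have "minor ?k A r c \<in> minors ?k A R C"
    unfolding minors_eq
    by (intro CollectI exI[of _ r] exI[of _ c]) (use r c Q(1) in \<open>auto simp: bij_betw_def\<close>)
  ultimately show "\<exists>x\<in>minors ?k A R C. x \<noteq> 0" by blast
qed

section \<open>Evaluation of polynomials at a point\<close>

lemma peval_superset:
  assumes "finite K" "keys g \<subseteq> K"
  shows "peval g P = (\<Sum>\<mu>\<in>K. lookup g \<mu> * (\<Prod>y\<in>keys \<mu>. P y ^ lookup \<mu> y))"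
  unfolding peval_def by (rule sum.mono_neutral_left) (use assms in \<open>auto simp: in_keys_iff\<close>)

lemma peval_add: "peval (p + q) P = peval p P + peval q P"
  using keys_add[of p q]
  by (simp add: peval_superset[of "keys p \<union> keys q"] lookup_add distrib_right sum.distrib)

lemma peval_0 [simp]: "peval 0 P = 0" by (simp add: peval_def)

lemma peval_sum: "peval (\<Sum>x\<in>A. p x) P = (\<Sum>x\<in>A. peval (p x) P)"
  by (induction A rule: infinite_finite_induct) (auto simp: peval_add)

lemma peval_single: "peval (single \<mu> c) P = c * (\<Prod>y\<in>keys \<mu>. P y ^ lookup \<mu> y)"
  by (subst peval_superset[of "{\<mu>}"]) auto

lemma monomial_value_add:
  "(\<Prod>y\<in>keys (\<mu> + \<nu>). P y ^ lookup (\<mu> + \<nu>) y) = (\<Prod>y\<in>keys \<mu>. P y ^ lookup \<mu> y) * (\<Prod>y\<in>keys \<nu>. P y ^ lookup \<nu> y)"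
  for P :: "'y \<Rightarrow> 'k::comm_semiring_1" and \<mu> \<nu> :: "'y \<Rightarrow>\<^sub>0 nat"
proof -
  let ?K = "keys \<mu> \<union> keys \<nu>"
  have ext: "(\<Prod>y\<in>keys \<xi>. P y ^ lookup \<xi> y) = (\<Prod>y\<in>?K. P y ^ lookup \<xi> y)" if "keys \<xi> \<subseteq> ?K" for \<xi> :: "'y \<Rightarrow>\<^sub>0 nat"
    by (rule prod.mono_neutral_left) (use that in \<open>auto simp: in_keys_iff\<close>)
  show ?thesis
    unfolding ext[OF keys_add] ext[OF Un_upper1] ext[OF Un_upper2]
    by (simp add: lookup_add power_add prod.distrib)
qed

lemma peval_mult: "peval (p * q) P = peval p P * peval q P"
  for P :: "'y \<Rightarrow> 'k::comm_semiring_1"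
proof -
  have "p * q = (\<Sum>\<mu>\<in>keys p. \<Sum>\<nu>\<in>keys q. single (\<mu> + \<nu>) (lookup p \<mu> * lookup q \<nu>))"
    by (subst (1) monomial_expansion[of p], subst (1) monomial_expansion[of q])
      (simp add: sum_product mult_single)
  then have "peval (p * q) P = (\<Sum>\<mu>\<in>keys p. \<Sum>\<nu>\<in>keys q.
      (lookup p \<mu> * (\<Prod>y\<in>keys \<mu>. P y ^ lookup \<mu> y)) * (lookup q \<nu> * (\<Prod>y\<in>keys \<nu>. P y ^ lookup \<nu> y)))"
    by (simp add: peval_sum peval_single monomial_value_add mult.assoc mult.left_commute)
  then show ?thesis by (simp add: peval_def sum_product)
qed

lemma peval_1 [simp]: "peval 1 P = (1 :: 'k::comm_semiring_1)"
  using peval_single[of 0 1 P] by simp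

lemma peval_prod: "peval (\<Prod>x\<in>A. p x) P = (\<Prod>x\<in>A. peval (p x) P)"
  for P :: "'y \<Rightarrow> 'k::comm_semiring_1"
  by (induction A rule: infinite_finite_induct) (auto simp: peval_mult)

lemma peval_uminus: "peval (- p) P = - peval p P" for P :: "'y \<Rightarrow> 'k::comm_ring_1"
  using peval_add[of p "- p" P] by (simp add: eq_neg_iff_add_eq_0 add.commute)

lemma peval_minor:
  fixes P :: "'y \<Rightarrow> 'k::comm_ring_1"
  shows "peval (minor k A r c) P = minor k (\<lambda>i j. peval (A i j) P) r c"
proof -
  have "peval (of_int (sign p)) P = of_int (sign p)" for p :: "nat \<Rightarrow> nat"
    by (simp add: sign_def peval_uminus)
  then show ?thesis by (simp add: minor_def peval_sum peval_mult peval_prod)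
qed

lemma not_in_zero_locus_minors:
  fixes P :: "'y \<Rightarrow> 'k::field"
  shows "P \<notin> zero_locus (ideal_gen (minors k A R C)) \<longleftrightarrow> (\<exists>x\<in>minors k (\<lambda>i j. peval (A i j) P) R C. x \<noteq> 0)"
proof -
  have "P \<in> zero_locus (ideal_gen G) \<longleftrightarrow> (\<forall>g\<in>G. peval g P = 0)" for G
  proof
    assume "P \<in> zero_locus (ideal_gen G)"
    then show "\<forall>g\<in>G. peval g P = 0" using ideal_gen_superset unfolding zero_locus_def by blast
  next
    assume "\<forall>g\<in>G. peval g P = 0"
    then have "peval (\<Sum>g\<in>F. c g * g) P = 0" if "F \<subseteq> G" for F c
      using that by (simp add: peval_sum peval_mult subset_iff)
    then show "P \<in> zero_locus (ideal_gen G)" unfolding zero_locus_def ideal_gen_def by blast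
  qed
  then show ?thesis unfolding minors_eq by (fastforce simp: peval_minor)
qed

lemma minors_cong:
  assumes "\<And>i j. i \<in> R \<Longrightarrow> j \<in> C \<Longrightarrow> A i j = A' i j"
  shows "minors k A R C = minors k A' R C"
proof -
  have "minor k A r c = minor k A' r c" if "r ` {..<k} \<subseteq> R" "c ` {..<k} \<subseteq> C" for r c
    unfolding minor_def
  proof (intro sum.cong refl arg_cong2[of _ _ _ _ "(*)"] prod.cong)
    fix p i assume "p \<in> {p. p permutes {..<k}}" "i \<in> {..<k}"
    then have "p i \<in> {..<k}" using permutes_in_image by fastforce
    then show "A (r i) (c (p i)) = A' (r i) (c (p i))" using assms that \<open>i \<in> {..<k}\<close> by (simp add: image_subset_iff)
  qed
  then show ?thesis unfolding minors_eq by (intro Collect_cong) metis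
qed

section \<open>The multiplication matrices of the theorem\<close>

lemma finite_Mcols: "finite (Mcols t :: ('n::finite \<Rightarrow>\<^sub>0 nat) set)"
  by (rule finite_subset[OF _ finite_mdeg_le[of t]]) (auto simp: Mcols_def)

lemma finite_Mrows: "finite (Mrows e t m :: ('n::finite \<Rightarrow>\<^sub>0 nat) set)"
  by (rule finite_subset[OF _ finite_mdeg_le[of "e + t"]]) (auto simp: Mrows_def)

text \<open>Stars and bars: along an enumeration of the variables, exponent vectors become lists of
  n naturals with sum t.\<close>

lemma card_Mcols: "card (Mcols t :: ('n::finite \<Rightarrow>\<^sub>0 nat) set) = (t + CARD('n) - 1) choose (CARD('n) - 1)"
proof -
  obtain vs where vs: "set vs = (UNIV :: 'n set)" "distinct vs" using finite_distinct_list[of "UNIV :: 'n set"] by auto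
  have len: "length vs = CARD('n)" using distinct_card[OF vs(2)] vs(1) by simp
  let ?L = "{l :: nat list. size l = CARD('n) \<and> sum_list l = t}"
  have sum: "sum_list (map g vs) = (\<Sum>i\<in>UNIV. g i)" for g :: "'n \<Rightarrow> nat"
    using sum_list_distinct_conv_sum_set[OF vs(2), of g] vs(1) by simp
  have "bij_betw (\<lambda>\<alpha>. map (lookup \<alpha>) vs) (Mcols t) ?L"
    unfolding bij_betw_def
  proof
    show "inj_on (\<lambda>\<alpha>. map (lookup \<alpha>) vs) (Mcols t)"
    proof (rule inj_onI)
      fix \<alpha> \<beta> :: "'n \<Rightarrow>\<^sub>0 nat" assume "map (lookup \<alpha>) vs = map (lookup \<beta>) vs"
      then have "lookup \<alpha> i = lookup \<beta> i" for i using vs(1) by simp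
      then show "\<alpha> = \<beta>" by (intro poly_mapping_eqI)
    qed
    show "(\<lambda>\<alpha>. map (lookup \<alpha>) vs) ` Mcols t = ?L"
    proof (intro equalityI subsetI)
      fix l assume "l \<in> (\<lambda>\<alpha>. map (lookup \<alpha>) vs) ` Mcols t"
      then show "l \<in> ?L" by (auto simp: Mcols_def mdeg_UNIV sum len)
    next
      fix l assume l: "l \<in> ?L"
      define g where "g = the \<circ> map_of (zip vs l)"
      have lg: "map g vs = l"
      proof (rule nth_equalityI)
        fix i assume "i < length (map g vs)"
        then show "map g vs ! i = l ! i" using l vs(2) len by (simp add: g_def map_of_zip_nth)
      qed (use l len in simp)
      define \<alpha> where "\<alpha> = Poly_Mapping.Abs_poly_mapping g"
      have la: "lookup \<alpha> = g" by (simp add: \<alpha>_def)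
      have "\<alpha> \<in> Mcols t" using l lg sum[of g] by (simp add: Mcols_def mdeg_UNIV la)
      then show "l \<in> (\<lambda>\<alpha>. map (lookup \<alpha>) vs) ` Mcols t" using lg la by (intro image_eqI[of _ _ \<alpha>]) auto
    qed
  qed
  then have "card (Mcols t :: ('n \<Rightarrow>\<^sub>0 nat) set) = card ?L" by (rule bij_betw_same_card)
  also have "\<dots> = (t + CARD('n) - 1) choose t" by (rule card_length_sum_list)
  also have "\<dots> = (t + CARD('n) - 1) choose (CARD('n) - 1)"
  proof -
    have "0 < CARD('n)" by simp
    then have "t + CARD('n) - 1 - t = CARD('n) - 1" by simp
    moreover have "t \<le> t + CARD('n) - 1" using \<open>0 < CARD('n)\<close> by linarith
    ultimately show ?thesis using binomial_symmetric[of t "t + CARD('n) - 1"] by simp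
  qed
  finally show ?thesis .
qed

text \<open>The matrix represents multiplication by \<open>f\<close> from forms of degree
  \<open>t\<close> to degree e + t of R/(x_1^m, ..., x_n^m), the rows being the monomials that
  survive there. A relation between columns is thus a form of degree \<open>t\<close> in the colon
  ideal.\<close>

lemma Mentry_columns_independent_iff:
  fixes f :: "('n::finite, 'k::field) mpoly"
  assumes m: "m \<ge> 1" and f: "homog e f"
  shows "columns_independent (Mentry f) (Mrows e t m) (Mcols t) \<longleftrightarrow>
    (\<forall>p\<in>colon_ideal (powers_ideal m) f. homog t p \<longrightarrow> p = 0)"
proof -
  have key: "(\<forall>\<gamma>\<in>Mrows e t m. (\<Sum>\<beta>\<in>Mcols t. c \<beta> * Mentry f \<gamma> \<beta>) = 0) \<longleftrightarrow>
      (\<Sum>\<beta>\<in>Mcols t. single \<beta> (c \<beta>)) \<in> colon_ideal (powers_ideal m) f" for c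
  proof -
    let ?p = "\<Sum>\<beta>\<in>Mcols t. single \<beta> (c \<beta>)"
    have coef: "(\<Sum>\<beta>\<in>Mcols t. c \<beta> * Mentry f \<gamma> \<beta>) = lookup (?p * f) \<gamma>" for \<gamma>
      unfolding sum_distrib_right lookup_sum
      by (rule sum.cong) (simp_all add: Mentry_def lookup_single_mult)
    have "homog t ?p" by (intro homog_sum homog_single) (simp add: Mcols_def)
    then have hp: "homog (t + e) (?p * f)" by (rule homog_mult[OF _ f])
    have rows: "\<gamma> \<in> Mrows e t m \<longleftrightarrow> \<not> (\<exists>i. m \<le> lookup \<gamma> i)" if "\<gamma> \<in> keys (?p * f)" for \<gamma>
    proof -
      have "mdeg \<gamma> = e + t" using homog_keysD[OF hp that] by simp
      moreover have "lookup \<gamma> i \<le> m - 1 \<longleftrightarrow> \<not> m \<le> lookup \<gamma> i" for i using m by linarith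
      ultimately show ?thesis by (simp add: Mrows_def)
    qed
    show ?thesis
      unfolding coef colon_ideal_def mem_Collect_eq powers_ideal_iff
    proof
      assume 0: "\<forall>\<gamma>\<in>Mrows e t m. lookup (?p * f) \<gamma> = 0"
      show "\<forall>\<alpha>\<in>keys (?p * f). \<exists>i. m \<le> lookup \<alpha> i"
      proof
        fix \<alpha> assume \<alpha>: "\<alpha> \<in> keys (?p * f)"
        then have "\<alpha> \<notin> Mrows e t m" using 0 in_keys_iff by blast
        then show "\<exists>i. m \<le> lookup \<alpha> i" using rows[OF \<alpha>] by blast
      qed
    next
      assume 0: "\<forall>\<alpha>\<in>keys (?p * f). \<exists>i. m \<le> lookup \<alpha> i"
      show "\<forall>\<gamma>\<in>Mrows e t m. lookup (?p * f) \<gamma> = 0"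
      proof (intro ballI, rule ccontr)
        fix \<gamma> assume \<gamma>: "\<gamma> \<in> Mrows e t m" "lookup (?p * f) \<gamma> \<noteq> 0"
        then have "\<gamma> \<in> keys (?p * f)" by (simp only: in_keys_iff) simp
        then show False using rows \<gamma>(1) 0 by blast
      qed
    qed
  qed
  show ?thesis
  proof
    assume ind: "columns_independent (Mentry f) (Mrows e t m) (Mcols t)"
    show "\<forall>p\<in>colon_ideal (powers_ideal m) f. homog t p \<longrightarrow> p = 0"
    proof (intro ballI impI)
      fix p assume p: "p \<in> colon_ideal (powers_ideal m) f" "homog t p"
      have "(\<Sum>\<beta>\<in>Mcols t. single \<beta> (lookup p \<beta>)) = (\<Sum>\<beta>\<in>keys p. single \<beta> (lookup p \<beta>))"
        by (rule sum.mono_neutral_right[OF finite_Mcols]) (use p(2) in \<open>auto simp: homog_def Mcols_def in_keys_iff\<close>)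
      then have "(\<Sum>\<beta>\<in>Mcols t. single \<beta> (lookup p \<beta>)) = p" using monomial_expansion[of p] by simp
      then have "\<forall>\<beta>\<in>Mcols t. lookup p \<beta> = 0" using key[of "lookup p"] p(1) ind unfolding columns_independent_def by simp
      then show "p = 0" using p(2) by (intro poly_mapping_eqI) (auto simp: homog_def Mcols_def in_keys_iff)
    qed
  next
    assume 0: "\<forall>p\<in>colon_ideal (powers_ideal m) f. homog t p \<longrightarrow> p = 0"
    show "columns_independent (Mentry f) (Mrows e t m) (Mcols t)"
      unfolding columns_independent_def
    proof (intro allI impI ballI)
      fix c :: "('n \<Rightarrow>\<^sub>0 nat) \<Rightarrow> 'k" and \<beta> :: "'n \<Rightarrow>\<^sub>0 nat"
      assume c: "\<forall>\<gamma>\<in>Mrows e t m. (\<Sum>\<beta>\<in>Mcols t. c \<beta> * Mentry f \<gamma> \<beta>) = 0" and \<beta>: "\<beta> \<in> Mcols t"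
      let ?p = "\<Sum>\<beta>\<in>Mcols t. single \<beta> (c \<beta>)"
      have "homog t ?p" by (intro homog_sum homog_single) (simp add: Mcols_def)
      then have "?p = 0" using 0 key[of c] c by blast
      moreover have "lookup ?p \<beta> = (\<Sum>\<beta>'\<in>Mcols t. if \<beta>' = \<beta> then c \<beta> else 0)"
        unfolding lookup_sum by (rule sum.cong) (auto simp: lookup_single when_def)
      ultimately show "c \<beta> = 0" using \<beta> by (simp add: finite_Mcols)
    qed
  qed
qed

lemma peval_MGentry:
  fixes f :: "('n::finite, 'k::field) mpoly"
  assumes "\<gamma> \<in> Mrows e t m" "\<beta> \<in> Mcols t"
  shows "peval (MGentry \<gamma> \<beta> :: (('n \<Rightarrow>\<^sub>0 nat) \<Rightarrow>\<^sub>0 nat) \<Rightarrow>\<^sub>0 'k) (coeff_point e f) = Mentry f \<gamma> \<beta>"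
proof (cases "\<forall>i. lookup \<beta> i \<le> lookup \<gamma> i")
  case True
  then have "\<gamma> = \<beta> + (\<gamma> - \<beta>)" by (auto intro!: poly_mapping_eqI simp: lookup_add lookup_minus)
  then have "mdeg \<gamma> = mdeg \<beta> + mdeg (\<gamma> - \<beta>)" by (metis mdeg_add)
  \<comment> \<open>\<open>coeff_point\<close> is cut off to degree \<open>e\<close>; on these rows
    and columns only coefficients of that degree occur.\<close>
  then have "mdeg (\<gamma> - \<beta>) = e" using assms by (simp add: Mrows_def Mcols_def)
  then show ?thesis using True by (simp add: MGentry_def Mentry_def Yvar_def peval_single coeff_point_def)
next
  case False
  then show ?thesis unfolding MGentry_def Mentry_def by auto
qed

section \<open>Linear resolutions of compressed Gorenstein algebras\<close>

lemma linear_resolution_generators: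
  fixes I :: "('n::finite, 'k::field) mpoly set"
  assumes lin: "linear_gorenstein_resolution I d" and n2: "CARD('n) \<ge> 2" and I: "is_ideal I"
  shows "I = ideal_gen {g \<in> I. homog d g}" and "p \<in> I \<Longrightarrow> \<alpha> \<in> keys p \<Longrightarrow> d \<le> mdeg \<alpha>"
proof -
  let ?n = "CARD('n)"
  obtain b M where b0: "b 0 = 1"
    and M: "\<And>i j k. i \<in> {1..?n} \<Longrightarrow> j < b (i - 1) \<Longrightarrow> k < b i \<Longrightarrow>
      homog (res_shift ?n d i - res_shift ?n d (i - 1)) (M i j k :: ('n, 'k) mpoly)"
    and im': "(\<lambda>v. matvec (M 1) 1 (b 1) v 0) ` fvecs (b 1) = I"
    by (rule linear_gorenstein_resolutionE[OF lin]) (rule that)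
  have hom: "homog d (M 1 0 k)" if "k < b 1" for k
  proof -
    have "homog (res_shift ?n d 1 - res_shift ?n d (1 - 1)) (M 1 0 k)"
      by (rule M) (use that n2 b0 in auto)
    \<comment> \<open>For n at least 2 the index 1 is not the last one, so its shift is
      \<open>d\<close>.\<close>
    then show ?thesis using n2 by (simp add: res_shift_def)
  qed
  note im = im'[symmetric]
  have mv: "matvec (M 1) 1 (b 1) v 0 = (\<Sum>k<b 1. M 1 0 k * v k)" for v by (simp add: matvec_def)
  have mem: "M 1 0 k \<in> I" if k: "k < b 1" for k
  proof -
    define u where "u = (\<lambda>i. if i = k then 1 else 0 :: ('n, 'k) mpoly)"
    have "(\<Sum>i<b 1. M 1 0 i * u i) = (\<Sum>i<b 1. if i = k then M 1 0 k else 0)"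
      by (rule sum.cong) (auto simp: u_def)
    then have "matvec (M 1) 1 (b 1) u 0 = M 1 0 k" unfolding mv using k by simp
    moreover have "u \<in> fvecs (b 1)" using k by (auto simp: u_def fvecs_def)
    ultimately show ?thesis unfolding im by (metis image_eqI)
  qed
  show "I = ideal_gen {g \<in> I. homog d g}"
  proof
    show "ideal_gen {g \<in> I. homog d g} \<subseteq> I" by (rule ideal_gen_least[OF I]) auto
    show "I \<subseteq> ideal_gen {g \<in> I. homog d g}"
    proof
      fix p assume "p \<in> I"
      then obtain v where "p = (\<Sum>k<b 1. M 1 0 k * v k)" unfolding im mv by blast
      moreover have "(\<Sum>k<b 1. M 1 0 k * v k) \<in> ideal_gen {g \<in> I. homog d g}"
        by (intro is_ideal_sum[OF ideal_gen_ideal] is_idealD(4)[OF ideal_gen_ideal] ideal_gen_superset)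
          (use mem hom in auto)
      ultimately show "p \<in> ideal_gen {g \<in> I. homog d g}" by simp
    qed
  qed
  show "d \<le> mdeg \<alpha>" if p: "p \<in> I" "\<alpha> \<in> keys p"
  proof (rule ccontr)
    assume less: "\<not> d \<le> mdeg \<alpha>"
    obtain v where v: "p = (\<Sum>k<b 1. M 1 0 k * v k)" using p(1) unfolding im mv by blast
    have "hcomp (mdeg \<alpha>) p = (\<Sum>k<b 1. hcomp (mdeg \<alpha>) (M 1 0 k * v k))" unfolding v by (rule hcomp_sum)
    also have "\<dots> = 0" by (rule sum.neutral) (use hcomp_mult_left[OF hom] less in auto)
    finally have "lookup (hcomp (mdeg \<alpha>) p) \<alpha> = 0" by simp
    then show False using p(2) by (simp add: lookup_hcomp in_keys_iff)
  qed
qed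

section \<open>The two implications for an ideal given by a dual functional\<close>

context dual_functional
begin

text \<open>A nonzero component of degree below \<open>t\<close> could be multiplied by a power of
  one variable to reach degree \<open>t\<close>; it would stay in \<open>I\<close> and stay
  nonzero.\<close>

lemma low_degree_vanishing:
  assumes 0: "\<And>p. p \<in> I \<Longrightarrow> homog t p \<Longrightarrow> p = 0" and p: "p \<in> I" "\<alpha> \<in> keys p"
  shows "t < mdeg \<alpha>"
proof (rule ccontr)
  assume "\<not> ?thesis"
  then have le: "mdeg \<alpha> \<le> t" by simp
  obtain i :: 'n where True by simp
  let ?\<gamma> = "single i (t - mdeg \<alpha>)"
  have "homog (mdeg ?\<gamma> + mdeg \<alpha>) (single ?\<gamma> 1 * hcomp (mdeg \<alpha>) p)"
    by (intro homog_mult homog_single homog_hcomp) simp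
  then have "homog t (single ?\<gamma> 1 * hcomp (mdeg \<alpha>) p)" using le by simp
  moreover have "single ?\<gamma> 1 * hcomp (mdeg \<alpha>) p \<in> I"
    by (intro is_idealD(3)[OF I_ideal] hcomp_in_I p)
  ultimately have "single ?\<gamma> 1 * hcomp (mdeg \<alpha>) p = 0" using 0 by blast
  then have "lookup (single ?\<gamma> 1 * hcomp (mdeg \<alpha>) p) (?\<gamma> + \<alpha>) = 0" by simp
  then show False using p(2) by (simp add: lookup_single_mult_add lookup_hcomp in_keys_iff)
qed

theorem linear_resolution_imp_compressed:
  assumes n2: "CARD('n) \<ge> 2" and lin: "linear_gorenstein_resolution I d"
  shows "even s" "d = s div 2 + 1" "\<And>p. p \<in> I \<Longrightarrow> homog (s div 2) p \<Longrightarrow> p = 0"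
proof -
  obtain z where z: "homog s z" "z \<notin> I" using socle_exists by blast
  have "res_shift CARD('n) d CARD('n) = s + CARD('n)"
    by (rule linear_resolution_last_shift[OF lin n2 z homog_in_I])
  then have "2 * d + CARD('n) - 2 = s + CARD('n)" using n2 by (simp add: res_shift_def)
  then have s: "2 * d = s + 2" using n2 by linarith
  show "even s" using s by presburger
  show d: "d = s div 2 + 1" using s by presburger
  show "p = 0" if p: "p \<in> I" "homog (s div 2) p" for p
  proof (rule ccontr)
    assume "p \<noteq> 0"
    then obtain \<alpha> where "\<alpha> \<in> keys p" by (metis ex_in_conv keys_eq_empty)
    then show False
      using linear_resolution_generators(2)[OF lin n2 I_ideal p(1)] homog_keysD[OF p(2)] d by fastforce
  qed
qed

theorem compressed_imp_linear_resolution: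
  assumes n2: "CARD('n) \<ge> 2" and s: "even s"
    and 0: "\<And>p. p \<in> I \<Longrightarrow> homog (s div 2) p \<Longrightarrow> p = 0"
  shows "linear_gorenstein_resolution I (s div 2 + 1)"
proof -
  obtain S h a and D :: "(('n \<Rightarrow>\<^sub>0 nat) \<times> bool list) \<Rightarrow> _ \<Rightarrow> ('n, 'k) mpoly"
    where "dual_resolutions S h a D I (int s + int CARD('n))" using dual_resolutions_exist by blast
  moreover have "int s = 2 * int (s div 2)" using s by (metis dvd_mult_div_cancel of_nat_mult of_nat_numeral)
  ultimately have dr: "dual_resolutions S h a D I (2 * int (s div 2) + int CARD('n))" by simp
  show ?thesis
    by (rule linear_resolution_of_dual_resolutions[OF dr n2 one_notin_I]) (rule low_degree_vanishing[OF 0])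
qed

end

theorem theorem4p4:
  fixes f :: "('n::finite \<Rightarrow>\<^sub>0 nat) \<Rightarrow>\<^sub>0 'k::field"
    and m e :: nat
  assumes n2: "CARD('n) \<ge> 2"
    and m1: "m \<ge> 1"
    and fnz: "f \<noteq> 0"
    and fform: "homog e f"
    and fnotin: "f \<notin> powers_ideal m"
  defines "s \<equiv> CARD('n) * (m - 1) - e"
    and "I \<equiv> colon_ideal (powers_ideal m) f"
  shows "((\<exists>d. linear_gorenstein_resolution I d)
            \<longleftrightarrow> (even s \<and> mat_rank (Mentry f) (Mrows e (s div 2) m) (Mcols (s div 2))
                             = (s div 2 + CARD('n) - 1) choose (CARD('n) - 1)))
       \<and> ((even s \<and> mat_rank (Mentry f) (Mrows e (s div 2) m) (Mcols (s div 2))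
                             = (s div 2 + CARD('n) - 1) choose (CARD('n) - 1))
            \<longleftrightarrow> (even s \<and> coeff_point e f \<notin>
                   zero_locus (ideal_gen (minors ((s div 2 + CARD('n) - 1) choose (CARD('n) - 1))
                       (MGentry :: _ \<Rightarrow> _ \<Rightarrow> (('n \<Rightarrow>\<^sub>0 nat) \<Rightarrow>\<^sub>0 nat) \<Rightarrow>\<^sub>0 'k)
                       (Mrows e (s div 2) m) (Mcols (s div 2))))))
       \<and> ((\<exists>d. linear_gorenstein_resolution I d)
            \<longrightarrow> I = ideal_gen {g \<in> I. homog (s div 2 + 1) g})"
proof -
  interpret dual_functional I "\<lambda>g. lookup (g * f) (top_exponent m)" s
    unfolding I_def s_def by (rule colon_dual_functional(1)[OF m1 fform fnotin])
  let ?t = "s div 2"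
  let ?R = "Mrows e ?t m" and ?C = "Mcols ?t :: ('n \<Rightarrow>\<^sub>0 nat) set"
  have card: "(?t + CARD('n) - 1) choose (CARD('n) - 1) = card ?C" by (simp add: card_Mcols)
  have rank: "mat_rank (Mentry f) ?R ?C = card ?C \<longleftrightarrow> columns_independent (Mentry f) ?R ?C"
    by (rule mat_rank_eq_card_iff[OF finite_Mcols])
  have low: "columns_independent (Mentry f) ?R ?C \<longleftrightarrow> (\<forall>p\<in>I. homog ?t p \<longrightarrow> p = 0)"
    unfolding I_def by (rule Mentry_columns_independent_iff[OF m1 fform])
  have minors: "columns_independent (Mentry f) ?R ?C \<longleftrightarrow> coeff_point e f \<notin>
      zero_locus (ideal_gen (minors (card ?C) (MGentry :: _ \<Rightarrow> _ \<Rightarrow> (('n \<Rightarrow>\<^sub>0 nat) \<Rightarrow>\<^sub>0 nat) \<Rightarrow>\<^sub>0 'k) ?R ?C))"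
  proof -
    have "minors (card ?C) (\<lambda>\<gamma> \<beta>. peval (MGentry \<gamma> \<beta> :: (('n \<Rightarrow>\<^sub>0 nat) \<Rightarrow>\<^sub>0 nat) \<Rightarrow>\<^sub>0 'k) (coeff_point e f)) ?R ?C
        = minors (card ?C) (Mentry f) ?R ?C"
      by (rule minors_cong) (rule peval_MGentry)
    then show ?thesis
      unfolding not_in_zero_locus_minors columns_independent_iff_minor[OF finite_Mrows finite_Mcols] by simp
  qed
  have "(\<exists>d. linear_gorenstein_resolution I d) \<longleftrightarrow> even s \<and> (\<forall>p\<in>I. homog ?t p \<longrightarrow> p = 0)"
    using linear_resolution_imp_compressed[OF n2] compressed_imp_linear_resolution[OF n2] by blast
  moreover have "I = ideal_gen {g \<in> I. homog (?t + 1) g}" if ex: "\<exists>d. linear_gorenstein_resolution I d"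
  proof -
    obtain d where d: "linear_gorenstein_resolution I d" using ex by blast
    then have "d = ?t + 1" by (rule linear_resolution_imp_compressed(2)[OF n2])
    then show ?thesis using linear_resolution_generators(1)[OF d n2 I_ideal] by simp
  qed
  ultimately show ?thesis
    unfolding card rank minors[symmetric] low by blast
qed

end
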